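(* Let $X_{1,3,4}$ be the blowup of $\mathbb P^1\times\mathbb P^3$ in $4$ points in general position. The effective cone $\operatorname{Eff}(X_{1,3,4})\subset N^1(X_{1,3,4})$ is the convex cone generated by the classes $E_i$, $H_1-E_i$ ($1\le i\le 4$) and $H_2-E_i-E_j-E_k$ ($1\le i<j<k\le 4$). Equivalently, it is the set of classes $d_1H_1+d_2H_2-\sum_{i=1}^4 m_iE_i$ (with real coefficients) such that for every permutation $\sigma$ of $\{1,2,3,4\}$ and every vector $(\alpha_1,\alpha_2;\beta_1,\dots,\beta_4)$ in the list below, $\alpha_1d_1+\alpha_2d_2\ge\sum_{i=1}^4\beta_i m_{\sigma(i)}$: $$(1,0;0,0,0,0),\ (0,1;0,0,0,0),\ (1,1;1,0,0,0),\ (1,2;1,1,0,0),\ (1,3;1,1,1,0),\ (1,3;1,1,1,1).$$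
   Context: Everything is over $\mathbb C$. "In general position" means: for all sets of points corresponding to the complement of some proper Zariski closed subset of the Hilbert scheme of points of $\mathbb P^1\times\mathbb P^3$ of the given length. $H_1$ and $H_2$ are the pullbacks of the hyperplane classes of $\mathbb P^1$ and $\mathbb P^3$, and $E_i$ is the exceptional divisor over the $i$-th blown-up point. $N^1(X)$ is the real vector space of Cartier divisors modulo numerical equivalence tensored with $\mathbb R$; $N^1(X_{1,3,4})$ has basis $H_1,H_2,E_1,\dots,E_4$. $\operatorname{Eff}(X)\subset N^1(X)$ is the convex cone spanned by classes of effective divisors. *)

theory Defs
  imports "HOL-Analysis.Analysis"
begin

section \<open>Products of projective spaces\<close>

text \<open>
  A product of projective spaces is described by a map \<^term>\<open>g\<close> sending each homogeneous coordinate
  to the factor it belongs to. A point is the set of all its vectors of homogeneous coordinates,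
  so it is an orbit under independent nonzero rescalings of the factors.
\<close>

definition mpoint :: "('k \<Rightarrow> 'b) \<Rightarrow> ('k \<Rightarrow> complex) \<Rightarrow> ('k \<Rightarrow> complex) set" where
  "mpoint g z = {(\<lambda>k. c (g k) * z k) | c. \<forall>b. c b \<noteq> 0}"

definition mproj :: "('k \<Rightarrow> 'b) \<Rightarrow> ('k \<Rightarrow> complex) set set" where
  "mproj g = {mpoint g z | z. \<forall>b. \<exists>k. g k = b \<and> z k \<noteq> 0}"

text \<open>\<open>form g d F\<close>: \<^term>\<open>F\<close> is a multihomogeneous polynomial, of degree \<^term>\<open>d b\<close> in the coordinates
  of the factor \<^term>\<open>b\<close>.\<close>

inductive form :: "('k \<Rightarrow> 'b) \<Rightarrow> ('b \<Rightarrow> nat) \<Rightarrow> (('k \<Rightarrow> complex) \<Rightarrow> complex) \<Rightarrow> bool"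
  for g :: "'k \<Rightarrow> 'b" where
  const: "form g (\<lambda>_. 0) (\<lambda>_. c)"
| var: "form g (\<lambda>b. if b = g k then 1 else 0) (\<lambda>z. z k)"
| add: "form g d F \<Longrightarrow> form g d G \<Longrightarrow> form g d (\<lambda>z. F z + G z)"
| mult: "form g d F \<Longrightarrow> form g e G \<Longrightarrow> form g (\<lambda>b. d b + e b) (\<lambda>z. F z * G z)"

definition zariski :: "('k \<Rightarrow> 'b) \<Rightarrow> ('k \<Rightarrow> complex) set topology" where
  "zariski g = topology_generated_by {{P \<in> mproj g. \<forall>z\<in>P. F z \<noteq> 0} | d F. form g d F}"

definition irreducible_closed :: "'a topology \<Rightarrow> 'a set \<Rightarrow> bool" where
  "irreducible_closed T S \<longleftrightarrow> closedin T S \<and> S \<noteq> {} \<and>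
     (\<forall>A B. closedin T A \<and> closedin T B \<and> S \<subseteq> A \<union> B \<longrightarrow> S \<subseteq> A \<or> S \<subseteq> B)"

text \<open>Irreducible closed subsets of dimension 1.\<close>

definition curve :: "'a topology \<Rightarrow> 'a set \<Rightarrow> bool" where
  "curve T C \<longleftrightarrow> irreducible_closed T C \<and> (\<forall>P. C \<noteq> {P}) \<and>
     (\<forall>Z. irreducible_closed T Z \<and> Z \<subset> C \<longrightarrow> (\<exists>P. Z = {P}))"


section \<open>Local rings and rational functions\<close>

text \<open>
  Here \<^term>\<open>S\<close> is an irreducible closed subvariety of \<^term>\<open>mproj g\<close>.
  Regular and rational functions on \<^term>\<open>S\<close> are represented by total functions on points whose values
  off a dense open subset of \<^term>\<open>S\<close> carry no meaning; equality of rational functions is \<open>rat_eq\<close>.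
\<close>

definition regular_at ::
  "('k \<Rightarrow> 'b) \<Rightarrow> ('k \<Rightarrow> complex) set set \<Rightarrow> ('k \<Rightarrow> complex) set \<Rightarrow> (('k \<Rightarrow> complex) set \<Rightarrow> complex) \<Rightarrow> bool"
where
  "regular_at g S P f \<longleftrightarrow> (\<exists>d G H. form g d G \<and> form g d H \<and> (\<forall>z\<in>P. H z \<noteq> 0) \<and>
     (\<forall>R\<in>S. \<forall>z\<in>R. H z \<noteq> 0 \<longrightarrow> f R = G z / H z))"

definition rat_eq ::
  "('k \<Rightarrow> 'b) \<Rightarrow> ('k \<Rightarrow> complex) set set \<Rightarrow> (('k \<Rightarrow> complex) set \<Rightarrow> complex)
   \<Rightarrow> (('k \<Rightarrow> complex) set \<Rightarrow> complex) \<Rightarrow> bool"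
where
  "rat_eq g S f h \<longleftrightarrow> (\<exists>U. openin (zariski g) U \<and> U \<inter> S \<noteq> {} \<and> (\<forall>R \<in> U \<inter> S. f R = h R))"

text \<open>\<open>is_quotient_at g S P f a b\<close>: \<^term>\<open>f\<close> is a nonzero rational function, written as \<open>a / b\<close> with nonzero
  \<^term>\<open>a\<close>, \<^term>\<open>b\<close> in the local ring at \<^term>\<open>P\<close>.\<close>

definition is_quotient_at where
  "is_quotient_at g S P f a b \<longleftrightarrow> regular_at g S P a \<and> regular_at g S P b \<and>
     \<not> rat_eq g S a (\<lambda>_. 0) \<and> \<not> rat_eq g S b (\<lambda>_. 0) \<and> rat_eq g S f (\<lambda>R. a R / b R)"

definition nonzero_rational where
  "nonzero_rational g S f \<longleftrightarrow> (\<exists>P\<in>S. \<exists>a b. is_quotient_at g S P f a b)"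


section \<open>Cartier divisors\<close>

text \<open>
  A Cartier divisor on \<^term>\<open>S\<close> is a global section of the sheaf of nonzero rational functions modulo
  units. It is given by a choice of a local equation \<^term>\<open>D P\<close> at each point \<^term>\<open>P\<close>; the chosen
  equation has to remain a local equation at all points near \<^term>\<open>P\<close>. Divisors are added by multiplying
  their local equations.
\<close>

definition unit_at where
  "unit_at g S P f u \<longleftrightarrow> regular_at g S P u \<and> u P \<noteq> 0 \<and> rat_eq g S f u"

definition cartier where
  "cartier g S D \<longleftrightarrow> (\<forall>P\<in>S. nonzero_rational g S (D P) \<and>
     (\<exists>U. openin (zariski g) U \<and> P \<in> U \<and>
        (\<forall>Q \<in> U \<inter> S. \<exists>u. unit_at g S Q (\<lambda>R. D P R / D Q R) u)))"

definition effective where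
  "effective g S D \<longleftrightarrow> cartier g S D \<and> (\<forall>P\<in>S. \<exists>a. regular_at g S P a \<and> rat_eq g S (D P) a)"

text \<open>The divisor cut out by a form \<^term>\<open>F\<close> of multidegree \<^term>\<open>d\<close>: its local equation at \<^term>\<open>P\<close> is
  \<open>F / G\<close> for some form \<open>G\<close> of the same multidegree with \<open>G P \<noteq> 0\<close>.\<close>

definition form_divisor where
  "form_divisor g d F P =
     (let G = (SOME G. form g d G \<and> (\<forall>z\<in>P. G z \<noteq> 0)) in
      (\<lambda>R. let z = (SOME z. z \<in> R) in F z / G z))"


section \<open>Numerical equivalence\<close>

text \<open>\<open>colength g C P a n\<close>: the quotient of the local ring of \<^term>\<open>C\<close> at \<^term>\<open>P\<close> by \<^term>\<open>a\<close> has
  complex dimension \<^term>\<open>n\<close>, with a basis given by the classes of \<open>e 0, \<dots>, e (n - 1)\<close>.\<close>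

definition colength where
  "colength g C P a n \<longleftrightarrow> (\<exists>e. (\<forall>i<n. regular_at g C P (e i)) \<and>
     (\<forall>f. regular_at g C P f \<longrightarrow>
        (\<exists>!c :: nat \<Rightarrow> complex. (\<forall>i\<ge>n. c i = 0) \<and>
           (\<exists>h. regular_at g C P h \<and> rat_eq g C f (\<lambda>R. (\<Sum>i<n. c i * e i R) + a R * h R)))))"

definition has_ord where
  "has_ord g C P f (m :: int) \<longleftrightarrow> (\<exists>a b k l. is_quotient_at g C P f a b \<and>
     colength g C P a k \<and> colength g C P b l \<and> m = int k - int l)"

text \<open>
  A nonzero rational section of the restriction to a curve \<^term>\<open>C\<close> of the line bundle \<open>\<O>(D)\<close>, where
  \<^term>\<open>D\<close> is a Cartier divisor on \<^term>\<open>S\<close>: a family of rational functions on \<^term>\<open>C\<close> that transforms by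
  the restrictions of the transition functions \<open>D P / D Q\<close>. (The curve may lie in the support of
  \<^term>\<open>D\<close>, so \<^term>\<open>D\<close> itself need not restrict.) In particular if \<open>D P\<close> restricts to a nonzero rational
  function on \<^term>\<open>C\<close> for all \<open>P\<close>, the restrictions form a section.
\<close>

definition rational_section where
  "rational_section g S C D s \<longleftrightarrow> (\<forall>P\<in>C. nonzero_rational g C (s P) \<and>
     (\<exists>U. openin (zariski g) U \<and> P \<in> U \<and>
        (\<forall>Q \<in> U \<inter> C. \<exists>u. unit_at g S Q (\<lambda>R. D P R / D Q R) u \<and>
            rat_eq g C (\<lambda>R. s P R / s Q R) u)))"

text \<open>\<open>intersection_number g S D C n\<close>: the degree of \<open>\<O>(D)\<close> on the (complete) curve \<^term>\<open>C\<close> is \<^term>\<open>n\<close>.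
  The degree of a rational section does not depend on the section.\<close>

definition intersection_number where
  "intersection_number g S D C (n :: int) \<longleftrightarrow> (\<exists>s ord. rational_section g S C D s \<and>
     (\<forall>P\<in>C. has_ord g C P (s P) (ord P)) \<and> finite {P\<in>C. ord P \<noteq> 0} \<and>
     n = (\<Sum>P \<in> {P\<in>C. ord P \<noteq> 0}. ord P))"

definition numerically_equivalent where
  "numerically_equivalent g S D D' \<longleftrightarrow>
     (\<forall>C. curve (zariski g) C \<and> C \<subseteq> S \<longrightarrow> intersection_number g S (\<lambda>P R. D P R / D' P R) C 0)"


section \<open>The blowup of \<open>\<P>\<^sup>1 \<times> \<P>\<^sup>3\<close> in four points\<close>

datatype yvar = XVar 2 | YVar 4
datatype factor = FacP1 | FacP3

fun yfac :: "yvar \<Rightarrow> factor" where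
  "yfac (XVar _) = FacP1"
| "yfac (YVar _) = FacP3"

type_synonym ypoint = "(yvar \<Rightarrow> complex) set"

text \<open>
  In Segre coordinates, the bidegree (1,1) forms \<open>minor a\<close> generate the ideal sheaf of the
  point \<^term>\<open>a\<close>, twisted by \<open>\<O>(1,1)\<close>. The blowup is therefore the closure of the graph of the
  rational map they define; for several points, of the product of these maps.
  The ambient space has the coordinates of \<open>\<P>\<^sup>1 \<times> \<P>\<^sup>3\<close> and one further projective space,
  with coordinates \<open>Dir i r s\<close>, for each of the points \<open>p i\<close>.
\<close>

definition segre :: "(yvar \<Rightarrow> complex) \<Rightarrow> 2 \<times> 4 \<Rightarrow> complex" where
  "segre z = (\<lambda>(j, k). z (XVar j) * z (YVar k))"

definition minor :: "(yvar \<Rightarrow> complex) \<Rightarrow> (yvar \<Rightarrow> complex) \<Rightarrow> 2 \<times> 4 \<Rightarrow> 2 \<times> 4 \<Rightarrow> complex" where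
  "minor a z r s = segre z r * segre a s - segre z s * segre a r"

datatype avar = Base yvar | Dir 4 "2 \<times> 4" "2 \<times> 4"

fun afac :: "avar \<Rightarrow> factor + 4" where
  "afac (Base v) = Inl (yfac v)"
| "afac (Dir i _ _) = Inr i"

type_synonym apoint = "(avar \<Rightarrow> complex) set"

definition blowup :: "(4 \<Rightarrow> ypoint) \<Rightarrow> apoint set" where
  "blowup p = zariski afac closure_of
     {mpoint afac (case_avar z (\<lambda>i. minor (a i) z)) | z a.
        mpoint yfac z \<in> mproj yfac \<and> (\<forall>i. a i \<in> p i \<and> z \<notin> p i)}"

type_synonym divisor = "apoint \<Rightarrow> apoint \<Rightarrow> complex"

text \<open>Pullbacks of a hyperplane in \<open>\<P>\<^sup>1\<close> and of one in \<open>\<P>\<^sup>3\<close>.\<close>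

definition H1_div :: divisor where
  "H1_div = form_divisor afac (\<lambda>b. if b = Inl FacP1 then 1 else 0) (\<lambda>z. z (Base (XVar 0)))"

definition H2_div :: divisor where
  "H2_div = form_divisor afac (\<lambda>b. if b = Inl FacP3 then 1 else 0) (\<lambda>z. z (Base (YVar 0)))"

text \<open>Pullbacks to the blowup of the functions \<open>G / H\<close> on \<open>\<P>\<^sup>1 \<times> \<P>\<^sup>3\<close> which are regular at the image of
  \<^term>\<open>P\<close> and whose numerator vanishes at \<open>p i\<close>.\<close>

definition pulled_back_ideal :: "(4 \<Rightarrow> ypoint) \<Rightarrow> 4 \<Rightarrow> apoint \<Rightarrow> (apoint \<Rightarrow> complex) set" where
  "pulled_back_ideal p i P = {f. \<exists>d G H. form yfac d G \<and> form yfac d H \<and>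
     (\<forall>a \<in> p i. G a = 0) \<and> (\<forall>z\<in>P. H (z \<circ> Base) \<noteq> 0) \<and>
     (\<forall>R \<in> blowup p. \<forall>z\<in>R. H (z \<circ> Base) \<noteq> 0 \<longrightarrow> f R = G (z \<circ> Base) / H (z \<circ> Base))}"

text \<open>The exceptional divisor over \<open>p i\<close> is defined by the inverse image ideal sheaf of \<open>p i\<close>, which is
  invertible on the blowup. (An ideal of a local ring which is principal is generated by an element of
  any given set of generators.)\<close>

definition E_div :: "(4 \<Rightarrow> ypoint) \<Rightarrow> 4 \<Rightarrow> divisor" where
  "E_div p i P = (SOME f. f \<in> pulled_back_ideal p i P \<and>
     (\<forall>h \<in> pulled_back_ideal p i P. \<exists>u. regular_at afac (blowup p) P u \<and>
        rat_eq afac (blowup p) h (\<lambda>R. u R * f R)))"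


section \<open>The effective cone\<close>

text \<open>\<open>N\<^sup>1\<close> of the blowup, with coordinates in the basis \<open>H\<^sub>1, H\<^sub>2, E\<^sub>1, \<dots>, E\<^sub>4\<close>.\<close>

type_synonym N1 = "real \<times> real \<times> (real ^ 4)"

definition H1_class :: N1 where "H1_class = (1, 0, 0)"
definition H2_class :: N1 where "H2_class = (0, 1, 0)"
definition E_class :: "4 \<Rightarrow> N1" where "E_class i = (0, 0, axis i 1)"

text \<open>The divisor \<open>a H\<^sub>1 + b H\<^sub>2 + \<Sum> c i E\<^sub>i\<close>.\<close>

definition combination :: "(4 \<Rightarrow> ypoint) \<Rightarrow> int \<Rightarrow> int \<Rightarrow> (4 \<Rightarrow> int) \<Rightarrow> divisor" where
  "combination p a b c =
     (\<lambda>P R. H1_div P R powi a * H2_div P R powi b * (\<Prod>i\<in>UNIV. E_div p i P R powi c i))"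

text \<open>
  It suffices to use integral coordinates: as \<open>H\<^sub>1, H\<^sub>2, E\<^sub>i\<close> are a basis of \<open>N\<^sup>1\<close>, the class of any
  Cartier divisor has rational coordinates, and a positive multiple of it, which is effective
  if it is, has integral ones.
\<close>

definition Eff :: "(4 \<Rightarrow> ypoint) \<Rightarrow> N1 set" where
  "Eff p = convex_cone hull
     {of_int a *\<^sub>R H1_class + of_int b *\<^sub>R H2_class + (\<Sum>i\<in>UNIV. of_int (c i) *\<^sub>R E_class i) | a b c.
        \<exists>D. effective afac (blowup p) D \<and>
            numerically_equivalent afac (blowup p) D (combination p a b c)}"


section \<open>General position\<close>

text \<open>
  Points of \<open>mproj qfac\<close> are ordered quadruples of points of \<open>\<P>\<^sup>1 \<times> \<P>\<^sup>3\<close>, and \<open>entry q i\<close> is the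
  \<open>i\<close>-th one. The quadruples of distinct points, up to order, form a dense open subset of the (irreducible)
  Hilbert scheme of points of length 4. So the sets of four points outside a proper closed subset
  of it are the quadruples of distinct points outside a proper closed \<^term>\<open>W\<close> which is
  invariant under reordering.
\<close>

fun qfac :: "4 \<times> yvar \<Rightarrow> 4 \<times> factor" where
  "qfac (i, v) = (i, yfac v)"

definition entry :: "(4 \<times> yvar \<Rightarrow> complex) set \<Rightarrow> 4 \<Rightarrow> ypoint" where
  "entry q i = (\<lambda>z v. z (i, v)) ` q"

definition in_general_position :: "((4 \<Rightarrow> ypoint) \<Rightarrow> bool) \<Rightarrow> bool" where
  "in_general_position \<Phi> \<longleftrightarrow> (\<exists>W. closedin (zariski qfac) W \<and> W \<noteq> mproj qfac \<and>
     (\<forall>\<sigma> :: 4 \<Rightarrow> 4. bij \<sigma> \<longrightarrow> (\<forall>q\<in>W. (\<lambda>z (i, v). z (\<sigma> i, v)) ` q \<in> W)) \<and>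
     (\<forall>q \<in> mproj qfac - W. inj (entry q) \<longrightarrow> \<Phi> (entry q)))"

end

theory Submission
  imports Defs "HOL-Computational_Algebra.Fundamental_Theorem_Algebra"
begin

text \<open>
  \<^bold>\<open>Upper bound.\<close> Every family of curves which covers the blowup gives an inequality for the classes of effective
  divisors. A local equation of an effective divisor \<open>D\<close> does not vanish at a general point
  (\<open>effective_general_point\<close>); so on a curve through that point it restricts to a nonzero regular section of \<open>\<O>(D)\<close>,
  and the degree of \<open>D\<close> on the curve is nonnegative. The curves are strict transforms of graphs of morphisms \<open>f\<close> of
  degree \<open>e\<close> from the projective line to projective 3-space. If the graph passes through the points with index in
  \<open>T\<close> and through no others, then the class \<open>d1 H1 + d2 H2 - \<Sum> m i E i\<close> has degree \<open>d1 + e d2 - (\<Sum>i\<in>T. m i)\<close> on it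
  (\<open>degree_nonneg\<close>). Such curves exist through a general point of the blowup for \<open>T\<close> empty and any \<open>e\<close>, which gives
  \<open>d1 \<ge> 0\<close> and, as \<open>e\<close> grows, \<open>d2 \<ge> 0\<close> (\<open>inequality_none\<close>); for \<open>e = card T \<le> 3\<close>, by Lagrange interpolation
  (\<open>inequality_some\<close>); and for \<open>e = 3\<close> and all four points (\<open>inequality_all\<close>). Four points are general enough for this
  if their images in the projective line are distinct and their images in projective 3-space are linearly
  independent.

  \<^bold>\<open>Lower bound.\<close> These inequalities cut out exactly the cone spanned by the proposed generators, which is linear algebra
  (\<open>cone_ineq_imp_hull\<close>). The generators are effective: they are the classes of the exceptional divisors
  (\<open>E_class_realized\<close>) and of the strict transforms of hyperplanes through some of the points
  (\<open>hyperplane_realized\<close>). The numerical equivalences which are needed here are linear equivalences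
  (\<open>numerically_equivalent_principal\<close>).

  \<^bold>\<open>Degrees on curves.\<close> The curves are isomorphic to the projective line by the projection to the first factor, so rational
  functions on them are quotients of binary forms of the same degree. The local rings are discrete valuation
  rings, and the order of a function, which is defined by colengths, is the difference of the vanishing orders of
  numerator and denominator (\<open>has_ord_vord\<close>). As a binary form of degree \<open>n\<close> has \<open>n\<close> zeros (\<open>sum_vord\<close>), the orders of
  a rational function add up to 0. Hence the degree of a line bundle can be computed by any section, in particular by
  the one which is given by the local equations.

  \<^bold>\<open>Exceptional divisors.\<close> On the blowup, the vectors of the minors and of the coordinates \<open>Dir i\<close> are proportional. Where
  \<open>Dir i r s\<close> does not vanish, all minors are therefore multiples of the minor with indices \<open>r\<close>, \<open>s\<close>, and this minor
  generates the ideal of the point (\<open>local_eq_generates\<close>), because the minors generate the ideal of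
  the point in the base (\<open>divisible_congruence\<close>).
\<close>

section \<open>Multihomogeneous forms\<close>

instance factor :: finite
proof
  have "(UNIV :: factor set) = {FacP1, FacP3}"
    using factor.exhaust by auto
  then show "finite (UNIV :: factor set)" by (metis finite.emptyI finite_insert)
qed

lemma form_degree_cong: "form g d F \<Longrightarrow> d = e \<Longrightarrow> form g e F"
  by simp

lemma form_mult': "form g d F \<Longrightarrow> form g e G \<Longrightarrow> (\<And>b. h b = d b + e b) \<Longrightarrow> form g h (\<lambda>z. F z * G z)"
  using form.mult[of g d F e G] by (simp add: fun_eq_iff form_degree_cong)

lemma form_var': "(\<And>b. d b = (if b = g k then 1 else 0)) \<Longrightarrow> form g d (\<lambda>z. z k)"
  using form.var[of g k] by (simp add: fun_eq_iff form_degree_cong)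

lemma form_cmult: "form g d F \<Longrightarrow> form g d (\<lambda>z. c * F z)"
  using form.mult[OF form.const[of g c], of d F] by simp

lemma form_minus: "form g d F \<Longrightarrow> form g d (\<lambda>z. - F z)"
  using form_cmult[of g d F "-1"] by simp

lemma form_diff: "form g d F \<Longrightarrow> form g d G \<Longrightarrow> form g d (\<lambda>z. F z - G z)"
  using form.add[OF _ form_minus, of g d F G] by simp

lemma form_zero: "form g d F \<Longrightarrow> form g d (\<lambda>z. 0)"
  using form_cmult[of g d F 0] by simp

lemma form_sum:
  "finite A \<Longrightarrow> A \<noteq> {} \<Longrightarrow> (\<And>i. i \<in> A \<Longrightarrow> form g d (F i)) \<Longrightarrow> form g d (\<lambda>z. \<Sum>i\<in>A. F i z)"
  by (induction A rule: finite_ne_induct) (auto intro: form.add)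

lemma form_prod:
  "finite A \<Longrightarrow> (\<And>i. i \<in> A \<Longrightarrow> form g (d i) (F i)) \<Longrightarrow>
   form g (\<lambda>b. \<Sum>i\<in>A. d i b) (\<lambda>z. \<Prod>i\<in>A. F i z)"
proof (induction A rule: finite_induct)
  case empty
  show ?case using form.const[of g 1] by simp
next
  case (insert x A)
  show ?case
    using insert.hyps by (simp, intro form_mult'[OF insert.prems insert.IH]) (auto intro: insert.prems)
qed

lemma form_power: "form g d F \<Longrightarrow> form g (\<lambda>b. n * d b) (\<lambda>z. F z ^ n)"
  using form_prod[of "{..<n}" g "\<lambda>_. d" "\<lambda>_. F"] by simp

text \<open>Substitution of forms into a form. It yields the restriction of forms to parametrized curves and to the graph of the
  rational map that defines the blowup, and the pullback of forms along the blowup map.\<close>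

lemma form_subst:
  fixes g :: "'k \<Rightarrow> 'b::finite"
  assumes "form g d F" and sub: "\<And>k. form g' (\<delta> (g k)) (\<phi> k)"
  shows "form g' (\<lambda>b'. \<Sum>b\<in>UNIV. d b * \<delta> b b') (\<lambda>z. F (\<lambda>k. \<phi> k z))"
  using assms(1)
proof induction
  case (const c)
  show ?case using form.const[of g' c] by simp
next
  case (var k)
  show ?case using sub[of k] by (simp add: if_distrib[of "\<lambda>x. x * _"] cong: if_cong)
next
  case (add d F G)
  then show ?case by (auto intro: form.add)
next
  case (mult d F e G)
  then show ?case
    by (auto intro!: form_mult'[OF mult.IH(1) mult.IH(2)] simp: algebra_simps sum.distrib)
qed

lemma form_poly_curve:
  assumes "form g d F"
  shows "\<exists>A. \<forall>\<tau>. F (\<lambda>k. poly (c k) \<tau>) = poly A \<tau>"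
  using assms
proof induction
  case (const c)
  show ?case by (rule exI[of _ "[:c:]"]) simp
next
  case (add d F G)
  then show ?case by (metis poly_add)
next
  case (mult d F e G)
  then show ?case by (metis poly_mult)
qed auto

text \<open>Polynomial functions form a domain: restricted to the line through a point where \<open>F\<close> does not vanish and a point where
  \<open>G\<close> does not vanish, both become nonzero univariate polynomials, which have only finitely many zeros.\<close>

lemma form_common_nonzero:
  assumes "form g d F" "form g' e G" "F z \<noteq> 0" "G w \<noteq> 0"
  shows "\<exists>v. F v \<noteq> 0 \<and> G v \<noteq> 0"
proof -
  \<comment> \<open>the line from \<open>z\<close> to \<open>w\<close>\<close>
  define c where "c = (\<lambda>k. [:z k, w k - z k:])"
  obtain A where A: "\<And>\<tau>. F (\<lambda>k. poly (c k) \<tau>) = poly A \<tau>" using form_poly_curve[OF assms(1), of c] by auto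
  obtain B where B: "\<And>\<tau>. G (\<lambda>k. poly (c k) \<tau>) = poly B \<tau>" using form_poly_curve[OF assms(2), of c] by auto
  have "poly A 0 \<noteq> 0" using A[of 0] assms by (simp add: c_def)
  moreover have "poly B 1 \<noteq> 0" using B[of 1] assms by (simp add: c_def)
  ultimately have "A * B \<noteq> 0" by auto
  then have "finite {\<tau>. poly (A * B) \<tau> = 0}" by (rule poly_roots_finite)
  then obtain \<tau> where "poly (A * B) \<tau> \<noteq> 0"
    using infinite_UNIV_char_0[where ?'a = complex] by (metis (mono_tags) ex_new_if_finite mem_Collect_eq)
  then show ?thesis using A B by (metis mult_eq_0_iff poly_mult)
qed

lemma forms_common_nonzero:
  assumes "finite \<F>" "\<And>F. F \<in> \<F> \<Longrightarrow> \<exists>d. form g d F" "\<And>F. F \<in> \<F> \<Longrightarrow> \<exists>w. F w \<noteq> 0"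
  shows "\<exists>z. \<forall>F\<in>\<F>. F z \<noteq> 0"
proof -
  have "\<exists>d P z. form g d P \<and> P z \<noteq> 0 \<and> (\<forall>w. P w \<noteq> 0 \<longrightarrow> (\<forall>F\<in>\<F>. F w \<noteq> 0))"
    using assms
  proof (induction \<F> rule: finite_induct)
    case empty
    show ?case using form.const[of g 1] by (intro exI[of _ "\<lambda>_. 0"] exI[of _ "\<lambda>_. 1"]) simp
  next
    case (insert F \<F>)
    then obtain d P z where P: "form g d P" "P z \<noteq> 0" "\<forall>w. P w \<noteq> 0 \<longrightarrow> (\<forall>F\<in>\<F>. F w \<noteq> 0)" by auto
    obtain e w where F: "form g e F" "F w \<noteq> 0" using insert.prems by blast
    obtain v where "P v \<noteq> 0" "F v \<noteq> 0"
      using form_common_nonzero[where F = P and G = F, OF P(1) F(1) P(2) F(2)] by blast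
    then show ?case using P(3) form.mult[OF P(1) F(1)]
      by (intro exI[of _ "\<lambda>b. d b + e b"] exI[of _ "\<lambda>z. P z * F z"] exI[of _ v]) auto
  qed
  then show ?thesis by blast
qed

lemma form_scale:
  fixes g :: "'k \<Rightarrow> 'b::finite"
  assumes "form g d F"
  shows "F (\<lambda>k. c (g k) * z k) = (\<Prod>b\<in>UNIV. c b ^ d b) * F z"
  using assms
proof induction
  case (var k)
  have "(\<Prod>b\<in>UNIV. c b ^ (if b = g k then 1 else 0)) = (\<Prod>b\<in>UNIV. if b = g k then c b else 1)"
    by (rule prod.cong) auto
  then show ?case by simp
next
  case (mult d F e G)
  then show ?case by (simp add: power_add prod.distrib)
qed (auto simp: algebra_simps)


section \<open>Points and the Zariski topology\<close>

text \<open>The vectors of homogeneous coordinates of the points of \<^term>\<open>mproj g\<close>.\<close>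

definition coords :: "('k \<Rightarrow> 'b) \<Rightarrow> ('k \<Rightarrow> complex) \<Rightarrow> bool" where
  "coords g z \<longleftrightarrow> (\<forall>b. \<exists>k. g k = b \<and> z k \<noteq> 0)"

lemma mproj_iff: "P \<in> mproj g \<longleftrightarrow> (\<exists>z. coords g z \<and> P = mpoint g z)"
  by (auto simp: mproj_def coords_def)

lemma mpoint_refl [simp]: "z \<in> mpoint g z"
  unfolding mpoint_def by (rule CollectI, rule exI[of _ "\<lambda>_. 1"]) simp

lemma mpointE:
  assumes "w \<in> mpoint g z"
  obtains c where "\<And>b. c b \<noteq> 0" "w = (\<lambda>k. c (g k) * z k)"
  using assms by (auto simp: mpoint_def)

lemma mpointI: "(\<And>b. c b \<noteq> 0) \<Longrightarrow> w = (\<lambda>k. c (g k) * z k) \<Longrightarrow> w \<in> mpoint g z"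
  by (auto simp: mpoint_def)

lemma mpoint_eqI:
  assumes "w \<in> mpoint g z" shows "mpoint g w = mpoint g z"
proof -
  obtain c where c: "\<And>b. c b \<noteq> 0" "w = (\<lambda>k. c (g k) * z k)" using assms by (auto elim: mpointE)
  show ?thesis
  proof (intro set_eqI iffI)
    fix v assume "v \<in> mpoint g w"
    then obtain e where e: "\<And>b. e b \<noteq> 0" "v = (\<lambda>k. e (g k) * w k)" by (auto elim: mpointE)
    show "v \<in> mpoint g z"
      by (rule mpointI[of "\<lambda>b. e b * c b"]) (auto simp: c e mult.assoc)
  next
    fix v assume "v \<in> mpoint g z"
    then obtain e where e: "\<And>b. e b \<noteq> 0" "v = (\<lambda>k. e (g k) * z k)" by (auto elim: mpointE)
    show "v \<in> mpoint g w"
      by (rule mpointI[of "\<lambda>b. e b / c b"]) (auto simp: c e)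
  qed
qed

lemma mproj_rep: "P \<in> mproj g \<Longrightarrow> z \<in> P \<Longrightarrow> P = mpoint g z"
  by (auto simp: mproj_iff mpoint_eqI)

lemma mproj_coords: "P \<in> mproj g \<Longrightarrow> z \<in> P \<Longrightarrow> coords g z"
  by (fastforce simp: mproj_iff coords_def elim!: mpointE)

lemma mproj_nonempty: "P \<in> mproj g \<Longrightarrow> \<exists>z. z \<in> P"
  by (auto simp: mproj_iff intro: mpoint_refl)

lemma mpoint_in_mproj: "coords g z \<Longrightarrow> mpoint g z \<in> mproj g"
  by (auto simp: mproj_iff)

text \<open>Proportionality of the vectors in each factor is a system of polynomial equations; this is how points and curves are
  seen to be closed.\<close>

lemma mpoint_proportional:
  assumes z: "coords g z" and w: "coords g w"
    and pr: "\<And>k l. g k = g l \<Longrightarrow> z k * w l = z l * w k"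
  shows "z \<in> mpoint g w"
proof -
  have "\<exists>l. g l = b \<and> w l \<noteq> 0" for b using w by (auto simp: coords_def)
  then obtain l where l: "\<And>b. g (l b) = b" "\<And>b. w (l b) \<noteq> 0" by metis
  define c where "c b = z (l b) / w (l b)" for b
  have eq: "z k = c (g k) * w k" for k
    using pr[of k "l (g k)"] l[of "g k"] by (simp add: c_def field_simps)
  have "c b \<noteq> 0" for b
  proof -
    obtain k where "g k = b" "z k \<noteq> 0" using z by (auto simp: coords_def)
    then show ?thesis using eq[of k] by auto
  qed
  then show ?thesis by (intro mpointI[of c]) (auto simp: eq)
qed

lemma mpoint_proportional_rev: "z \<in> mpoint g w \<Longrightarrow> g k = g l \<Longrightarrow> z k * w l = z l * w k"
  by (auto elim!: mpointE)

definition nonvanishing :: "('k \<Rightarrow> 'b) \<Rightarrow> (('k \<Rightarrow> complex) \<Rightarrow> complex) \<Rightarrow> ('k \<Rightarrow> complex) set set" where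
  "nonvanishing g F = {P \<in> mproj g. \<forall>z\<in>P. F z \<noteq> 0}"

lemma form_zero_mpoint_iff:
  fixes g :: "'k \<Rightarrow> 'b::finite"
  assumes "form g d F" "w \<in> mpoint g z" shows "F w = 0 \<longleftrightarrow> F z = 0"
  using assms(2) by (auto elim!: mpointE simp: form_scale[OF assms(1)])

lemma nonvanishing_iff:
  fixes g :: "'k \<Rightarrow> 'b::finite"
  assumes "form g d F" "P \<in> mproj g" "z \<in> P"
  shows "P \<in> nonvanishing g F \<longleftrightarrow> F z \<noteq> 0" "(\<forall>w\<in>P. F w \<noteq> 0) \<longleftrightarrow> F z \<noteq> 0"
proof -
  have P: "P = mpoint g z" using mproj_rep[OF assms(2,3)] .
  show "(\<forall>w\<in>P. F w \<noteq> 0) \<longleftrightarrow> F z \<noteq> 0"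
    using form_zero_mpoint_iff[OF assms(1)] assms(3) unfolding P by blast
  then show "P \<in> nonvanishing g F \<longleftrightarrow> F z \<noteq> 0"
    using assms(2) by (simp add: nonvanishing_def)
qed

lemma openin_nonvanishing: "form g d F \<Longrightarrow> openin (zariski g) (nonvanishing g F)"
  unfolding zariski_def nonvanishing_def by (rule topology_generated_by_Basis) auto

lemma nonvanishing_one: "nonvanishing g (\<lambda>_. 1) = mproj g"
  by (auto simp: nonvanishing_def)

lemma topspace_zariski [simp]: "topspace (zariski g) = mproj g"
proof -
  have "mproj g \<subseteq> \<Union>{{P \<in> mproj g. \<forall>z\<in>P. F z \<noteq> 0} | d F. form g d F}"
    using nonvanishing_one[of g] form.const[of g 1] unfolding nonvanishing_def by blast
  then show ?thesis by (auto simp: zariski_def)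
qed

lemma openin_mproj: "openin (zariski g) (mproj g)"
  by (metis openin_topspace topspace_zariski)

lemma nonvanishing_mult: "nonvanishing g F \<inter> nonvanishing g G = nonvanishing g (\<lambda>z. F z * G z)"
  by (auto simp: nonvanishing_def)

text \<open>The principal open sets are closed under intersection, since products of forms are forms; so they are a basis and
  not just a subbasis of the topology.\<close>

lemma openin_zariski_basic:
  assumes "openin (zariski g) U" "P \<in> U"
  shows "\<exists>d F. form g d F \<and> P \<in> nonvanishing g F \<and> nonvanishing g F \<subseteq> U"
proof -
  have "generate_topology_on {{P \<in> mproj g. \<forall>z\<in>P. F z \<noteq> 0} | d F. form g d F} U"
    using assms(1) by (simp add: zariski_def openin_topology_generated_by_iff)
  then show ?thesis using assms(2)
  proof (induction arbitrary: P)
    case (Int a b)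
    obtain d F where F: "form g d F" "P \<in> nonvanishing g F" "nonvanishing g F \<subseteq> a"
      using Int.IH(1)[of P] Int.prems by auto
    obtain e G where G: "form g e G" "P \<in> nonvanishing g G" "nonvanishing g G \<subseteq> b"
      using Int.IH(2)[of P] Int.prems by auto
    show ?case
    proof (intro exI conjI)
      show "form g (\<lambda>b. d b + e b) (\<lambda>z. F z * G z)" using F G by (intro form.mult)
      show "P \<in> nonvanishing g (\<lambda>z. F z * G z)" "nonvanishing g (\<lambda>z. F z * G z) \<subseteq> a \<inter> b"
        using F G by (auto simp flip: nonvanishing_mult)
    qed
  next
    case (UN K)
    then obtain k where k: "k \<in> K" "P \<in> k" by auto
    then obtain d F where "form g d F" "P \<in> nonvanishing g F" "nonvanishing g F \<subseteq> k"
      using UN.IH[of k P] by auto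
    then show ?case using k by blast
  next
    case (Basis s)
    then show ?case by (auto simp: nonvanishing_def)
  qed simp
qed

text \<open>A monomial in coordinates which do not vanish at the point. Dividing by it turns forms into regular functions.\<close>

lemma ex_nonvanishing_form:
  fixes g :: "'k \<Rightarrow> 'b::finite"
  assumes "P \<in> mproj g"
  shows "\<exists>K. form g d K \<and> (\<forall>z\<in>P. K z \<noteq> 0)"
proof -
  obtain z where z: "z \<in> P" using assms mproj_nonempty by blast
  then obtain k where k: "\<And>b. g (k b) = b \<and> z (k b) \<noteq> 0"
    using mproj_coords[OF assms z] unfolding coords_def by metis
  let ?K = "\<lambda>z. \<Prod>b\<in>UNIV. (\<lambda>z. z (k b)) z ^ d b"
  have K: "form g (\<lambda>b'. \<Sum>b\<in>UNIV. d b * (if b' = g (k b) then 1 else 0)) ?K"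
    by (intro form_prod form_power form.var) auto
  have "(\<lambda>b'. \<Sum>b\<in>UNIV. d b * (if b' = g (k b) then 1 else 0)) = d"
    by (simp add: fun_eq_iff k if_distrib[of "\<lambda>x. _ * x"] cong: if_cong)
  then have K': "form g d ?K" using K by simp
  have "?K z \<noteq> 0" using k by simp
  then show ?thesis using K' nonvanishing_iff(2)[OF K' assms z] by blast
qed

lemma closedin_vanishing:
  fixes g :: "'k \<Rightarrow> 'b::finite"
  assumes "\<And>i. i \<in> I \<Longrightarrow> form g (d i) (F i)"
  shows "closedin (zariski g) {P \<in> mproj g. \<forall>i\<in>I. \<forall>z\<in>P. F i z = 0}"
proof -
  have eq: "mproj g - {P \<in> mproj g. \<forall>i\<in>I. \<forall>z\<in>P. F i z = 0} = (\<Union>i\<in>I. nonvanishing g (F i))"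
  proof (intro equalityI subsetI)
    fix P assume P: "P \<in> mproj g - {P \<in> mproj g. \<forall>i\<in>I. \<forall>z\<in>P. F i z = 0}"
    then obtain i z where "i \<in> I" "z \<in> P" "F i z \<noteq> 0" by auto
    then show "P \<in> (\<Union>i\<in>I. nonvanishing g (F i))"
      using P nonvanishing_iff(1)[OF assms, of i P z] by auto
  next
    fix P assume "P \<in> (\<Union>i\<in>I. nonvanishing g (F i))"
    then obtain i where i: "i \<in> I" "P \<in> mproj g" "\<forall>z\<in>P. F i z \<noteq> 0" by (auto simp: nonvanishing_def)
    moreover obtain z where "z \<in> P" using mproj_nonempty[OF i(2)] by blast
    ultimately show "P \<in> mproj g - {P \<in> mproj g. \<forall>i\<in>I. \<forall>z\<in>P. F i z = 0}" by blast
  qed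
  show ?thesis
    unfolding closedin_def
  proof (intro conjI)
    show "openin (zariski g) (topspace (zariski g) - {P \<in> mproj g. \<forall>i\<in>I. \<forall>z\<in>P. F i z = 0})"
      unfolding topspace_zariski eq using openin_nonvanishing[OF assms] by blast
  qed auto
qed

lemma closedin_point:
  fixes g :: "'k \<Rightarrow> 'b::finite"
  assumes "P \<in> mproj g"
  shows "closedin (zariski g) {P}"
proof -
  obtain w where w: "w \<in> P" using assms mproj_nonempty by blast
  have cw: "coords g w" using mproj_coords[OF assms w] .
  let ?I = "{(k, l). g k = g l}"
  let ?F = "\<lambda>(k, l) z. z k * w l - z l * w k"
  have "closedin (zariski g) {Q \<in> mproj g. \<forall>i\<in>?I. \<forall>z\<in>Q. ?F i z = 0}"
  proof (rule closedin_vanishing)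
    fix i assume "i \<in> ?I"
    then show "form g (\<lambda>b. if b = g (fst i) then 1 else 0) (?F i)"
      by (auto intro!: form_diff form_cmult[where c = "w _", unfolded mult.commute[of "w _"]] form_var' split: prod.split)
  qed
  also have "{Q \<in> mproj g. \<forall>i\<in>?I. \<forall>z\<in>Q. ?F i z = 0} = {P}"
  proof (intro equalityI subsetI)
    fix Q assume Q: "Q \<in> {Q \<in> mproj g. \<forall>i\<in>?I. \<forall>z\<in>Q. ?F i z = 0}"
    then obtain z where z: "z \<in> Q" using mproj_nonempty by blast
    have "z \<in> mpoint g w"
      using Q z by (intro mpoint_proportional cw mproj_coords[of Q]) auto
    then have "Q = P" using Q z w assms by (metis (no_types, lifting) mem_Collect_eq mpoint_eqI mproj_rep)
    then show "Q \<in> {P}" by simp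
  next
    fix Q assume "Q \<in> {P}"
    then show "Q \<in> {Q \<in> mproj g. \<forall>i\<in>?I. \<forall>z\<in>Q. ?F i z = 0}"
      using assms mproj_rep[OF assms w] by (auto dest: mpoint_proportional_rev)
  qed
  finally show ?thesis .
qed

text \<open>The shape of a local equation of \<^term>\<open>form_divisor\<close>. The choice of the representative does not matter if both
  forms have the same multidegree.\<close>

definition ratio :: "(('k \<Rightarrow> complex) \<Rightarrow> complex) \<Rightarrow> (('k \<Rightarrow> complex) \<Rightarrow> complex) \<Rightarrow> ('k \<Rightarrow> complex) set \<Rightarrow> complex" where
  "ratio F G R = (let z = (SOME z. z \<in> R) in F z / G z)"

lemma ratio_eval:
  fixes g :: "'k \<Rightarrow> 'b::finite"
  assumes "form g d F" "form g d G" "R \<in> mproj g" "z \<in> R"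
  shows "ratio F G R = F z / G z"
proof -
  define w where "w = (SOME z. z \<in> R)"
  have "w \<in> R" unfolding w_def using someI[of "\<lambda>z. z \<in> R" z] assms(4) by simp
  then obtain c where "\<And>b. c b \<noteq> 0" "w = (\<lambda>k. c (g k) * z k)"
    using mproj_rep[OF assms(3,4)] by (auto elim: mpointE)
  then show ?thesis
    by (simp add: ratio_def w_def[symmetric] Let_def form_scale[OF assms(1)] form_scale[OF assms(2)])
qed

section \<open>Rational and regular functions on an irreducible set\<close>

text \<open>The filter of dense open subsets; equality of rational functions is equality along this filter. It is a proper filter
  because any two nonempty open subsets of an irreducible set meet.\<close>

definition generic :: "('k \<Rightarrow> 'b) \<Rightarrow> ('k \<Rightarrow> complex) set set \<Rightarrow> ('k \<Rightarrow> complex) set filter" where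
  "generic g S = (INF U\<in>{U. openin (zariski g) U \<and> U \<inter> S \<noteq> {}}. principal (U \<inter> S))"

definition near :: "('k \<Rightarrow> 'b) \<Rightarrow> ('k \<Rightarrow> complex) set set \<Rightarrow> ('k \<Rightarrow> complex) set \<Rightarrow> ('k \<Rightarrow> complex) set filter" where
  "near g S P = inf (nhdsin (zariski g) P) (principal S)"

lemma eventually_near:
  "P \<in> mproj g \<Longrightarrow> eventually Pr (near g S P) \<longleftrightarrow>
    (\<exists>U. openin (zariski g) U \<and> P \<in> U \<and> (\<forall>R\<in>U \<inter> S. Pr R))"
  by (auto simp: near_def eventually_inf_principal eventually_nhdsin)

lemma near_mono: "C \<subseteq> S \<Longrightarrow> eventually Pr (near g S P) \<Longrightarrow> eventually Pr (near g C P)"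
  by (auto simp: near_def eventually_inf_principal elim!: eventually_mono)

lemma near_self: "P \<in> S \<Longrightarrow> P \<in> mproj g \<Longrightarrow> eventually Pr (near g S P) \<Longrightarrow> Pr P"
  by (auto simp: eventually_near)

lemma near_in: "eventually (\<lambda>R. R \<in> S) (near g S P)"
  by (simp add: near_def eventually_inf_principal)

lemma regular_at_mono: "regular_at g S P f \<Longrightarrow> C \<subseteq> S \<Longrightarrow> regular_at g C P f"
  unfolding regular_at_def by blast

lemma near_form_nonzero:
  fixes g :: "'k \<Rightarrow> 'b::finite"
  assumes "form g d F" "P \<in> mproj g" "\<forall>z\<in>P. F z \<noteq> 0"
  shows "eventually (\<lambda>R. \<forall>z\<in>R. F z \<noteq> 0) (near g S P)"
  unfolding eventually_near[OF assms(2)]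
  using openin_nonvanishing[OF assms(1)] assms(2,3)
  by (intro exI[of _ "nonvanishing g F"]) (auto simp: nonvanishing_def)

text \<open>Irreducibility in terms of open sets, for the blowup as well as for the curves in it.\<close>

locale irreducible_subset =
  fixes g :: "'k \<Rightarrow> 'b::finite" and S
  assumes subset: "S \<subseteq> mproj g" and nonempty: "S \<noteq> {}"
    and opens_meet: "\<And>U V. openin (zariski g) U \<Longrightarrow> openin (zariski g) V \<Longrightarrow>
           U \<inter> S \<noteq> {} \<Longrightarrow> V \<inter> S \<noteq> {} \<Longrightarrow> U \<inter> V \<inter> S \<noteq> {}"
begin

lemma in_mproj: "P \<in> S \<Longrightarrow> P \<in> mproj g"
  using subset by blast

lemma eventually_generic:
  "eventually Pr (generic g S) \<longleftrightarrow>
    (\<exists>U. openin (zariski g) U \<and> U \<inter> S \<noteq> {} \<and> (\<forall>R\<in>U \<inter> S. Pr R))"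
  unfolding generic_def
proof (subst eventually_INF_base)
  show "{U. openin (zariski g) U \<and> U \<inter> S \<noteq> {}} \<noteq> {}"
    using openin_mproj subset nonempty by blast
next
  fix U V assume "U \<in> {U. openin (zariski g) U \<and> U \<inter> S \<noteq> {}}" "V \<in> {U. openin (zariski g) U \<and> U \<inter> S \<noteq> {}}"
  then show "\<exists>x\<in>{U. openin (zariski g) U \<and> U \<inter> S \<noteq> {}}.
      principal (x \<inter> S) \<le> inf (principal (U \<inter> S)) (principal (V \<inter> S))"
    using opens_meet by (intro bexI[of _ "U \<inter> V"]) auto
qed (auto simp: eventually_principal)

lemma rat_eq_iff: "rat_eq g S f h \<longleftrightarrow> eventually (\<lambda>R. f R = h R) (generic g S)"
  by (simp add: rat_eq_def eventually_generic)

lemma near_generic: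
  assumes "P \<in> S" "eventually Pr (near g S P)" shows "eventually Pr (generic g S)"
  using assms by (auto simp: eventually_near[OF in_mproj] eventually_generic)

lemma generic_neq_bot [simp]: "generic g S \<noteq> bot"
  by (auto simp: trivial_limit_def eventually_generic)

lemma generic_in: "eventually (\<lambda>R. R \<in> S) (generic g S)"
  using nonempty near_generic[OF _ near_in] by blast

lemma generic_form_nonzero:
  assumes "form g d F" "P \<in> S" "\<forall>z\<in>P. F z \<noteq> 0"
  shows "eventually (\<lambda>R. \<forall>z\<in>R. F z \<noteq> 0) (generic g S)"
  using near_generic[OF assms(2) near_form_nonzero[OF assms(1) in_mproj[OF assms(2)] assms(3)]] .

lemma near_nonzero_imp_generic:
  assumes "form g d F" "\<not> (\<forall>P\<in>S. \<forall>z\<in>P. F z = 0)"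
  shows "eventually (\<lambda>R. \<forall>z\<in>R. F z \<noteq> 0) (generic g S)"
proof -
  obtain P z where "P \<in> S" "z \<in> P" "F z \<noteq> 0" using assms by blast
  then show ?thesis using generic_form_nonzero[OF assms(1)] nonvanishing_iff(2)[OF assms(1) in_mproj] by blast
qed

lemma regularE:
  assumes "regular_at g S P f" "P \<in> S"
  obtains d G H where "form g d G" "form g d H" "\<forall>z\<in>P. H z \<noteq> 0"
    "eventually (\<lambda>R. \<forall>z\<in>R. H z \<noteq> 0 \<and> f R = G z / H z) (near g S P)"
proof -
  obtain d G H where *: "form g d G" "form g d H" "\<forall>z\<in>P. H z \<noteq> 0"
    "\<forall>R\<in>S. \<forall>z\<in>R. H z \<noteq> 0 \<longrightarrow> f R = G z / H z"
    using assms unfolding regular_at_def by blast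
  have "eventually (\<lambda>R. \<forall>z\<in>R. H z \<noteq> 0) (near g S P)"
    by (intro near_form_nonzero[of _ d] * in_mproj assms)
  then have "eventually (\<lambda>R. \<forall>z\<in>R. H z \<noteq> 0 \<and> f R = G z / H z) (near g S P)"
    using near_in[of S g P] by eventually_elim (use *(4) in auto)
  then show ?thesis using * that by blast
qed

lemma regular_ratio:
  assumes "form g d G" "form g d H" "\<forall>z\<in>P. H z \<noteq> 0"
  shows "regular_at g S P (ratio G H)"
  unfolding regular_at_def using assms ratio_eval[OF assms(1,2) in_mproj] by blast

lemma regular_const: "regular_at g S P (\<lambda>_. c)"
  unfolding regular_at_def
  by (intro exI[of _ "\<lambda>_. 0"] exI[of _ "\<lambda>_. c"] exI[of _ "\<lambda>_. 1"]) (auto intro: form.const)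

lemma regular_add:
  assumes "regular_at g S P f" "regular_at g S P h"
  shows "regular_at g S P (\<lambda>R. f R + h R)"
proof -
  obtain d G H where *: "form g d G" "form g d H" "\<forall>z\<in>P. H z \<noteq> 0"
    "\<And>R z. R\<in>S \<Longrightarrow> z\<in>R \<Longrightarrow> H z \<noteq> 0 \<Longrightarrow> f R = G z / H z"
    using assms(1) unfolding regular_at_def by blast
  obtain d' G' H' where **: "form g d' G'" "form g d' H'" "\<forall>z\<in>P. H' z \<noteq> 0"
    "\<And>R z. R\<in>S \<Longrightarrow> z\<in>R \<Longrightarrow> H' z \<noteq> 0 \<Longrightarrow> h R = G' z / H' z"
    using assms(2) unfolding regular_at_def by blast
  show ?thesis
    unfolding regular_at_def
  proof (intro exI conjI ballI impI)
    show "form g (\<lambda>b. d b + d' b) (\<lambda>z. G z * H' z + H z * G' z)"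
      "form g (\<lambda>b. d b + d' b) (\<lambda>z. H z * H' z)"
      by (intro form.add form.mult *(1,2) **(1,2))+
    show "H z * H' z \<noteq> 0" if "z \<in> P" for z using * ** that by auto
    show "f R + h R = (G z * H' z + H z * G' z) / (H z * H' z)"
      if "R \<in> S" "z \<in> R" "H z * H' z \<noteq> 0" for R z
      using *(4)[OF that(1,2)] **(4)[OF that(1,2)] that(3) by (auto simp: field_simps)
  qed
qed

lemma regular_mult:
  assumes "regular_at g S P f" "regular_at g S P h"
  shows "regular_at g S P (\<lambda>R. f R * h R)"
proof -
  obtain d G H where *: "form g d G" "form g d H" "\<forall>z\<in>P. H z \<noteq> 0"
    "\<And>R z. R\<in>S \<Longrightarrow> z\<in>R \<Longrightarrow> H z \<noteq> 0 \<Longrightarrow> f R = G z / H z"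
    using assms(1) unfolding regular_at_def by blast
  obtain d' G' H' where **: "form g d' G'" "form g d' H'" "\<forall>z\<in>P. H' z \<noteq> 0"
    "\<And>R z. R\<in>S \<Longrightarrow> z\<in>R \<Longrightarrow> H' z \<noteq> 0 \<Longrightarrow> h R = G' z / H' z"
    using assms(2) unfolding regular_at_def by blast
  show ?thesis
    unfolding regular_at_def
  proof (intro exI conjI ballI impI)
    show "form g (\<lambda>b. d b + d' b) (\<lambda>z. G z * G' z)"
      "form g (\<lambda>b. d b + d' b) (\<lambda>z. H z * H' z)"
      by (intro form.mult *(1,2) **(1,2))+
    show "H z * H' z \<noteq> 0" if "z \<in> P" for z using * ** that by auto
    show "f R * h R = (G z * G' z) / (H z * H' z)"
      if "R \<in> S" "z \<in> R" "H z * H' z \<noteq> 0" for R z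
      using *(4)[OF that(1,2)] **(4)[OF that(1,2)] that(3) by simp
  qed
qed

lemma regular_inverse:
  assumes "regular_at g S P f" "f P \<noteq> 0" "P \<in> S"
  shows "regular_at g S P (\<lambda>R. 1 / f R)"
proof -
  obtain d G H where *: "form g d G" "form g d H" "\<forall>z\<in>P. H z \<noteq> 0"
    "\<And>R z. R\<in>S \<Longrightarrow> z\<in>R \<Longrightarrow> H z \<noteq> 0 \<Longrightarrow> f R = G z / H z"
    using assms(1) unfolding regular_at_def by blast
  show ?thesis
    unfolding regular_at_def
  proof (intro exI conjI ballI impI)
    show "form g (\<lambda>b. d b + d b) (\<lambda>z. H z * H z)" "form g (\<lambda>b. d b + d b) (\<lambda>z. G z * H z)"
      by (intro form.mult *(1,2))+
    show "G z * H z \<noteq> 0" if "z \<in> P" for z using * assms that by force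
    show "1 / f R = (H z * H z) / (G z * H z)"
      if "R \<in> S" "z \<in> R" "G z * H z \<noteq> 0" for R z
      using *(4)[OF that(1,2)] that(3) by simp
  qed
qed

lemma regular_sum:
  "finite I \<Longrightarrow> (\<And>i. i \<in> I \<Longrightarrow> regular_at g S P (f i)) \<Longrightarrow> regular_at g S P (\<lambda>R. \<Sum>i\<in>I. f i R)"
  by (induction I rule: finite_induct) (auto intro: regular_const regular_add)

lemma regular_prod:
  "finite I \<Longrightarrow> (\<And>i. i \<in> I \<Longrightarrow> regular_at g S P (f i)) \<Longrightarrow> regular_at g S P (\<lambda>R. \<Prod>i\<in>I. f i R)"
  by (induction I rule: finite_induct) (auto intro: regular_const regular_mult)

lemma regular_power: "regular_at g S P f \<Longrightarrow> regular_at g S P (\<lambda>R. f R ^ n)"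
  using regular_prod[of "{..<n}" P "\<lambda>_. f"] by simp

lemma regular_near:
  assumes "regular_at g S P f" "P \<in> S"
  shows "eventually (\<lambda>Q. regular_at g S Q f) (near g S P)"
proof -
  obtain d G H where *: "form g d G" "form g d H" "\<forall>z\<in>P. H z \<noteq> 0"
    "\<forall>R\<in>S. \<forall>z\<in>R. H z \<noteq> 0 \<longrightarrow> f R = G z / H z"
    using assms unfolding regular_at_def by blast
  have "eventually (\<lambda>R. \<forall>z\<in>R. H z \<noteq> 0) (near g S P)"
    by (intro near_form_nonzero[of _ d] * in_mproj assms)
  then show ?thesis
    by eventually_elim (use * in \<open>unfold regular_at_def, blast\<close>)
qed

lemma regular_nonzero_near:
  assumes "regular_at g S P f" "P \<in> S" "f P \<noteq> 0"
  shows "eventually (\<lambda>Q. f Q \<noteq> 0) (near g S P)"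
proof -
  obtain d G H where *: "form g d G" "form g d H" "\<forall>z\<in>P. H z \<noteq> 0"
    "eventually (\<lambda>R. \<forall>z\<in>R. H z \<noteq> 0 \<and> f R = G z / H z) (near g S P)"
    using regularE[OF assms(1,2)] by blast
  have "\<forall>z\<in>P. G z \<noteq> 0"
    using near_self[OF assms(2) in_mproj[OF assms(2)] *(4)] assms(3) by auto
  then have "eventually (\<lambda>R. \<forall>z\<in>R. G z \<noteq> 0) (near g S P)"
    by (intro near_form_nonzero[of _ d] * in_mproj assms)
  then show ?thesis using *(4) near_in[of S g P]
  proof eventually_elim
    case (elim R)
    then show ?case using mproj_nonempty[OF in_mproj[of R]] by fastforce
  qed
qed

text \<open>The difference of the two functions is, near \<^term>\<open>P\<close>, a quotient of forms whose numerator vanishes on a dense open subset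
  of \<^term>\<open>S\<close>, hence on all of \<^term>\<open>S\<close>. This is what allows to restrict an equality of rational functions on a variety
  to a curve in it.\<close>

lemma regular_eq_near:
  assumes "regular_at g S P f" "regular_at g S P h" "P \<in> S"
    and eq: "eventually (\<lambda>R. f R = h R) (generic g S)"
  shows "eventually (\<lambda>R. f R = h R) (near g S P)"
proof -
  obtain d G H where *: "form g d G" "form g d H" "\<forall>z\<in>P. H z \<noteq> 0"
    "eventually (\<lambda>R. \<forall>z\<in>R. H z \<noteq> 0 \<and> f R = G z / H z) (near g S P)"
    using regularE[OF assms(1,3)] by blast
  obtain d' G' H' where **: "form g d' G'" "form g d' H'" "\<forall>z\<in>P. H' z \<noteq> 0"
    "eventually (\<lambda>R. \<forall>z\<in>R. H' z \<noteq> 0 \<and> h R = G' z / H' z) (near g S P)"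
    using regularE[OF assms(2,3)] by blast
  define K where "K = (\<lambda>z. G z * H' z - H z * G' z)"
  have K: "form g (\<lambda>b. d b + d' b) K"
    unfolding K_def by (intro form_diff form.mult *(1,2) **(1,2))
  have K0: "\<forall>R\<in>S. \<forall>z\<in>R. K z = 0"
  proof (rule ccontr)
    assume "\<not> ?thesis"
    then have "eventually (\<lambda>R. \<forall>z\<in>R. K z \<noteq> 0) (generic g S)"
      by (rule near_nonzero_imp_generic[OF K])
    then have "eventually (\<lambda>R. False) (generic g S)"
      using eq near_generic[OF assms(3) *(4)] near_generic[OF assms(3) **(4)] generic_in
    proof eventually_elim
      case (elim R)
      obtain z where z: "z \<in> R" using mproj_nonempty[OF in_mproj[OF elim(5)]] by blast
      have "G z / H z = G' z / H' z" using elim z by metis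
      then show ?case using elim z by (auto simp: K_def field_simps)
    qed
    then show False by simp
  qed
  show ?thesis
    using *(4) **(4) near_in[of S g P]
  proof eventually_elim
    case (elim R)
    obtain z where z: "z \<in> R" using mproj_nonempty[OF in_mproj] elim by blast
    have "K z = 0" "H z \<noteq> 0" "H' z \<noteq> 0" using elim z K0 by auto
    moreover have "f R = G z / H z" "h R = G' z / H' z" using elim z by auto
    ultimately show ?case by (simp add: K_def frac_eq_eq mult.commute)
  qed
qed

lemma regular_eq_at:
  assumes "regular_at g S P f" "regular_at g S P h" "P \<in> S"
    and "eventually (\<lambda>R. f R = h R) (generic g S)"
  shows "f P = h P"
  using near_self[OF assms(3) in_mproj[OF assms(3)] regular_eq_near[OF assms]] .

lemma regular_nonzero_generic:
  assumes "regular_at g S P f" "P \<in> S" "\<not> rat_eq g S f (\<lambda>_. 0)"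
  shows "eventually (\<lambda>R. f R \<noteq> 0) (generic g S)"
proof -
  obtain d G H where *: "form g d G" "form g d H" "\<forall>z\<in>P. H z \<noteq> 0"
    "eventually (\<lambda>R. \<forall>z\<in>R. H z \<noteq> 0 \<and> f R = G z / H z) (near g S P)"
    using regularE[OF assms(1,2)] by blast
  note ev = near_generic[OF assms(2) *(4)]
  have "\<not> (\<forall>R\<in>S. \<forall>z\<in>R. G z = 0)"
  proof
    assume G0: "\<forall>R\<in>S. \<forall>z\<in>R. G z = 0"
    have "eventually (\<lambda>R. f R = 0) (generic g S)"
      using ev generic_in
    proof eventually_elim
      case (elim R)
      then show ?case using mproj_nonempty[OF in_mproj[of R]] G0 by fastforce
    qed
    then show False using assms(3) by (simp add: rat_eq_iff)
  qed
  then have "eventually (\<lambda>R. \<forall>z\<in>R. G z \<noteq> 0) (generic g S)"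
    by (rule near_nonzero_imp_generic[OF *(1)])
  then show ?thesis using ev generic_in
  proof eventually_elim
    case (elim R)
    then show ?case using mproj_nonempty[OF in_mproj[of R]] by fastforce
  qed
qed

lemma generic_nonzero_not_zero:
  "eventually (\<lambda>R. f R \<noteq> 0) (generic g S) \<Longrightarrow> \<not> rat_eq g S f (\<lambda>_. 0)"
  using eventually_conj[of "\<lambda>R. f R \<noteq> 0" "generic g S" "\<lambda>R. f R = 0"]
  by (auto simp: rat_eq_iff)

lemma ratio_nonzero_generic:
  assumes "form g d F" "form g d G" "eventually (\<lambda>R. \<forall>z\<in>R. F z \<noteq> 0) (generic g S)"
    "eventually (\<lambda>R. \<forall>z\<in>R. G z \<noteq> 0) (generic g S)"
  shows "eventually (\<lambda>R. ratio F G R \<noteq> 0) (generic g S)"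
  using assms(3,4) generic_in
proof eventually_elim
  case (elim R)
  obtain z where z: "z \<in> R" using mproj_nonempty[OF in_mproj] elim by blast
  then show ?case using ratio_eval[OF assms(1,2) in_mproj z] elim by auto
qed

text \<open>Unlike \<^term>\<open>is_quotient_at\<close>, this does not refer to a point. Multiplicativity of \<^term>\<open>nonzero_rational\<close> is
  immediate in this form.\<close>

definition quotient_of :: "('b \<Rightarrow> nat) \<Rightarrow> (('k \<Rightarrow> complex) \<Rightarrow> complex) \<Rightarrow> (('k \<Rightarrow> complex) \<Rightarrow> complex) \<Rightarrow>
    (('k \<Rightarrow> complex) set \<Rightarrow> complex) \<Rightarrow> bool" where
  "quotient_of d F G f \<longleftrightarrow> form g d F \<and> form g d G \<and>
     eventually (\<lambda>R. \<forall>z\<in>R. F z \<noteq> 0 \<and> G z \<noteq> 0 \<and> f R = F z / G z) (generic g S)"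

lemma is_quotient_atD:
  assumes "is_quotient_at g S P f a b" "P \<in> S"
  shows "eventually (\<lambda>R. a R \<noteq> 0 \<and> b R \<noteq> 0 \<and> f R = a R / b R) (generic g S)"
  using assms regular_nonzero_generic[of P a] regular_nonzero_generic[of P b]
  by (auto simp: is_quotient_at_def rat_eq_iff eventually_conj_iff)

text \<open>Dividing numerator and denominator by the same form, one that does not vanish at \<^term>\<open>P\<close>, makes both regular
  there.\<close>

lemma quotient_of_imp_quotient_at:
  assumes "quotient_of d F G f" "P \<in> S"
  shows "\<exists>a b. is_quotient_at g S P f a b"
proof -
  obtain K where K: "form g d K" "\<forall>z\<in>P. K z \<noteq> 0"
    using ex_nonvanishing_form[OF in_mproj[OF assms(2)]] by blast
  have F: "form g d F" and G: "form g d G"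
    and ev: "eventually (\<lambda>R. \<forall>z\<in>R. F z \<noteq> 0 \<and> G z \<noteq> 0 \<and> f R = F z / G z) (generic g S)"
    using assms(1) by (auto simp: quotient_of_def)
  have evK: "eventually (\<lambda>R. \<forall>z\<in>R. K z \<noteq> 0) (generic g S)"
    using generic_form_nonzero[OF K(1) assms(2) K(2)] .
  have all: "eventually (\<lambda>R. ratio F K R \<noteq> 0 \<and> ratio G K R \<noteq> 0 \<and> f R = ratio F K R / ratio G K R) (generic g S)"
    using ev evK generic_in
  proof eventually_elim
    case (elim R)
    obtain z where z: "z \<in> R" using mproj_nonempty[OF in_mproj] elim by blast
    then show ?case
      using ratio_eval[OF F K(1) in_mproj z] ratio_eval[OF G K(1) in_mproj z] elim by auto
  qed
  have "is_quotient_at g S P f (ratio F K) (ratio G K)"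
    unfolding is_quotient_at_def
    using all by (auto simp: rat_eq_iff[of f] eventually_conj_iff
      intro!: regular_ratio[OF F K] regular_ratio[OF G K] dest!: generic_nonzero_not_zero)
  then show ?thesis by blast
qed

lemma nonzero_rational_iff: "nonzero_rational g S f \<longleftrightarrow> (\<exists>d F G. quotient_of d F G f)"
proof
  assume "nonzero_rational g S f"
  then obtain P a b where P: "P \<in> S" and q: "is_quotient_at g S P f a b"
    by (auto simp: nonzero_rational_def)
  have ra: "regular_at g S P a" and rb: "regular_at g S P b"
    using q by (auto simp: is_quotient_at_def)
  obtain d G H where *: "form g d G" "form g d H" "\<forall>z\<in>P. H z \<noteq> 0"
    "eventually (\<lambda>R. \<forall>z\<in>R. H z \<noteq> 0 \<and> a R = G z / H z) (near g S P)"
    using regularE[OF ra P] by blast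
  obtain d' G' H' where **: "form g d' G'" "form g d' H'" "\<forall>z\<in>P. H' z \<noteq> 0"
    "eventually (\<lambda>R. \<forall>z\<in>R. H' z \<noteq> 0 \<and> b R = G' z / H' z) (near g S P)"
    using regularE[OF rb P] by blast
  have "quotient_of (\<lambda>b. d b + d' b) (\<lambda>z. G z * H' z) (\<lambda>z. H z * G' z) f"
    unfolding quotient_of_def
  proof (intro conjI)
    show "form g (\<lambda>b. d b + d' b) (\<lambda>z. G z * H' z)" "form g (\<lambda>b. d b + d' b) (\<lambda>z. H z * G' z)"
      by (intro form.mult *(1,2) **(1,2))+
    show "eventually (\<lambda>R. \<forall>z\<in>R. G z * H' z \<noteq> 0 \<and> H z * G' z \<noteq> 0 \<and> f R = G z * H' z / (H z * G' z)) (generic g S)"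
      using near_generic[OF P *(4)] near_generic[OF P **(4)] is_quotient_atD[OF q P]
      by eventually_elim auto
  qed
  then show "\<exists>d F G. quotient_of d F G f" by blast
next
  assume "\<exists>d F G. quotient_of d F G f"
  then show "nonzero_rational g S f"
    using nonempty quotient_of_imp_quotient_at unfolding nonzero_rational_def by blast
qed

lemma nonzero_rational_nonzero:
  assumes "nonzero_rational g S f"
  shows "eventually (\<lambda>R. f R \<noteq> 0) (generic g S)"
proof -
  obtain d F G where "quotient_of d F G f" using assms by (auto simp: nonzero_rational_iff)
  then have "eventually (\<lambda>R. \<forall>z\<in>R. F z \<noteq> 0 \<and> G z \<noteq> 0 \<and> f R = F z / G z) (generic g S)"
    by (auto simp: quotient_of_def)
  then show ?thesis using generic_in
  proof eventually_elim
    case (elim R)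
    then show ?case using mproj_nonempty[OF in_mproj[of R]] by fastforce
  qed
qed

lemma nonzero_rational_mult:
  assumes "nonzero_rational g S f" "nonzero_rational g S h"
  shows "nonzero_rational g S (\<lambda>R. f R * h R)"
proof -
  obtain d F G where q: "quotient_of d F G f" using assms(1) by (auto simp: nonzero_rational_iff)
  obtain d' F' G' where q': "quotient_of d' F' G' h" using assms(2) by (auto simp: nonzero_rational_iff)
  have "eventually (\<lambda>R. \<forall>z\<in>R. F z * F' z \<noteq> 0 \<and> G z * G' z \<noteq> 0 \<and> f R * h R = F z * F' z / (G z * G' z)) (generic g S)"
    using q[unfolded quotient_of_def, THEN conjunct2, THEN conjunct2]
      q'[unfolded quotient_of_def, THEN conjunct2, THEN conjunct2]
    by eventually_elim simp
  then have "quotient_of (\<lambda>b. d b + d' b) (\<lambda>z. F z * F' z) (\<lambda>z. G z * G' z) (\<lambda>R. f R * h R)"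
    using q q' by (simp add: quotient_of_def form.mult)
  then show ?thesis by (auto simp: nonzero_rational_iff)
qed

lemma nonzero_rational_inverse:
  assumes "nonzero_rational g S f"
  shows "nonzero_rational g S (\<lambda>R. 1 / f R)"
proof -
  obtain d F G where "quotient_of d F G f" using assms by (auto simp: nonzero_rational_iff)
  then have "quotient_of d G F (\<lambda>R. 1 / f R)"
    unfolding quotient_of_def by (auto elim!: eventually_mono)
  then show ?thesis by (auto simp: nonzero_rational_iff)
qed

lemma nonzero_rational_regular:
  assumes "P \<in> S" "regular_at g S P f" "\<not> rat_eq g S f (\<lambda>_. 0)"
  shows "nonzero_rational g S f"
  unfolding nonzero_rational_def is_quotient_at_def
  using assms regular_const[of P 1] generic_nonzero_not_zero[of "\<lambda>_. 1"]
  by (intro bexI[of _ P] exI[of _ f] exI[of _ "\<lambda>_. 1"]) (auto simp: rat_eq_iff)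

lemma unit_at_mult:
  assumes "unit_at g S P f u" "unit_at g S P h v"
  shows "unit_at g S P (\<lambda>R. f R * h R) (\<lambda>R. u R * v R)"
  using assms by (auto simp: unit_at_def rat_eq_iff intro: regular_mult elim: eventually_elim2)

lemma unit_at_inverse:
  assumes "unit_at g S P f u" "P \<in> S"
  shows "unit_at g S P (\<lambda>R. 1 / f R) (\<lambda>R. 1 / u R)"
  using assms by (auto simp: unit_at_def rat_eq_iff intro: regular_inverse elim: eventually_mono)

lemma unit_at_cong:
  assumes "unit_at g S P f u" "eventually (\<lambda>R. f R = h R) (generic g S)"
  shows "unit_at g S P h u"
  using assms by (auto simp: unit_at_def rat_eq_iff elim: eventually_elim2)

lemma unit_at_near:
  assumes "unit_at g S P f u" "P \<in> S"
  shows "eventually (\<lambda>Q. unit_at g S Q f u) (near g S P)"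
proof -
  have "eventually (\<lambda>Q. regular_at g S Q u) (near g S P)" "eventually (\<lambda>Q. u Q \<noteq> 0) (near g S P)"
    using assms regular_near regular_nonzero_near by (auto simp: unit_at_def)
  then show ?thesis by eventually_elim (use assms in \<open>auto simp: unit_at_def\<close>)
qed


section \<open>Cartier divisors\<close>

lemma cartier_iff:
  "cartier g S D \<longleftrightarrow> (\<forall>P\<in>S. nonzero_rational g S (D P) \<and>
     eventually (\<lambda>Q. \<exists>u. unit_at g S Q (\<lambda>R. D P R / D Q R) u) (near g S P))"
  by (simp add: cartier_def eventually_near in_mproj)

lemma cartier_mult:
  assumes "cartier g S D" "cartier g S D'"
  shows "cartier g S (\<lambda>P R. D P R * D' P R)"
  unfolding cartier_iff
proof (intro ballI conjI)
  fix P assume P: "P \<in> S"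
  show "nonzero_rational g S (\<lambda>R. D P R * D' P R)"
    using assms P by (auto simp: cartier_iff intro: nonzero_rational_mult)
  have "eventually (\<lambda>Q. \<exists>u. unit_at g S Q (\<lambda>R. D P R / D Q R) u) (near g S P)"
    "eventually (\<lambda>Q. \<exists>u. unit_at g S Q (\<lambda>R. D' P R / D' Q R) u) (near g S P)"
    using assms P by (auto simp: cartier_iff)
  then show "eventually (\<lambda>Q. \<exists>u. unit_at g S Q (\<lambda>R. D P R * D' P R / (D Q R * D' Q R)) u) (near g S P)"
  proof eventually_elim
    case (elim Q)
    then obtain u v where "unit_at g S Q (\<lambda>R. D P R / D Q R) u" "unit_at g S Q (\<lambda>R. D' P R / D' Q R) v" by blast
    then have "unit_at g S Q (\<lambda>R. D P R / D Q R * (D' P R / D' Q R)) (\<lambda>R. u R * v R)" by (rule unit_at_mult)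
    then show ?case by auto
  qed
qed

lemma cartier_inverse:
  assumes "cartier g S D"
  shows "cartier g S (\<lambda>P R. 1 / D P R)"
  unfolding cartier_iff
proof (intro ballI conjI)
  fix P assume P: "P \<in> S"
  show "nonzero_rational g S (\<lambda>R. 1 / D P R)"
    using assms P by (auto simp: cartier_iff intro: nonzero_rational_inverse)
  have "eventually (\<lambda>Q. \<exists>u. unit_at g S Q (\<lambda>R. D P R / D Q R) u) (near g S P)"
    using assms P by (auto simp: cartier_iff)
  then show "eventually (\<lambda>Q. \<exists>u. unit_at g S Q (\<lambda>R. (1 / D P R) / (1 / D Q R)) u) (near g S P)"
    using near_in[of S g P]
  proof eventually_elim
    case (elim Q)
    then obtain u where "unit_at g S Q (\<lambda>R. D P R / D Q R) u" by blast
    then have "unit_at g S Q (\<lambda>R. 1 / (D P R / D Q R)) (\<lambda>R. 1 / u R)"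
      using elim by (intro unit_at_inverse)
    then show ?case by auto
  qed
qed

lemma cartier_one: "cartier g S (\<lambda>_ _. 1)"
  unfolding cartier_iff
proof (intro ballI conjI)
  fix P assume P: "P \<in> S"
  show "nonzero_rational g S (\<lambda>R. 1)"
    using P generic_nonzero_not_zero[of "\<lambda>_. 1"] by (intro nonzero_rational_regular[OF P] regular_const) auto
  show "eventually (\<lambda>Q. \<exists>u. unit_at g S Q (\<lambda>R. 1 / 1) u) (near g S P)"
    by (intro always_eventually allI exI[of _ "\<lambda>_. 1"])
      (auto simp: unit_at_def rat_eq_iff intro: regular_const)
qed

lemma cartier_prod:
  "finite I \<Longrightarrow> (\<And>i. i \<in> I \<Longrightarrow> cartier g S (D i)) \<Longrightarrow> cartier g S (\<lambda>P R. \<Prod>i\<in>I. D i P R)"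
  by (induction I rule: finite_induct) (auto intro: cartier_one cartier_mult)

lemma form_divisor_ratio:
  assumes "P \<in> mproj g"
  obtains G where "form g d G" "\<forall>z\<in>P. G z \<noteq> 0" "\<And>F. form_divisor g d F P = ratio F G"
proof -
  define G where "G = (SOME G. form g d G \<and> (\<forall>z\<in>P. G z \<noteq> 0))"
  have G: "form g d G \<and> (\<forall>z\<in>P. G z \<noteq> 0)"
    unfolding G_def using ex_nonvanishing_form[OF assms] by (rule someI_ex)
  moreover have "form_divisor g d F P = ratio F G" for F
    by (simp add: form_divisor_def ratio_def[abs_def] G_def Let_def)
  ultimately show ?thesis using that by blast
qed

text \<open>The transition functions are the quotients of the auxiliary forms in the denominators of the local equations.\<close>

lemma cartier_form_divisor:
  assumes F: "form g d F" and nz: "eventually (\<lambda>R. \<forall>z\<in>R. F z \<noteq> 0) (generic g S)"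
  shows "cartier g S (form_divisor g d F)"
  unfolding cartier_iff
proof (intro ballI conjI)
  fix P assume P: "P \<in> S"
  obtain G where G: "form g d G" "\<forall>z\<in>P. G z \<noteq> 0" "\<And>F. form_divisor g d F P = ratio F G"
    using form_divisor_ratio[OF in_mproj[OF P], of d] by blast
  have evG: "eventually (\<lambda>R. \<forall>z\<in>R. G z \<noteq> 0) (generic g S)"
    using generic_form_nonzero[OF G(1) P G(2)] .
  show "nonzero_rational g S (form_divisor g d F P)"
    unfolding G(3)
    by (intro nonzero_rational_regular[OF P] regular_ratio[OF F G(1,2)] generic_nonzero_not_zero
       ratio_nonzero_generic[OF F G(1) nz evG])
  have "eventually (\<lambda>R. \<forall>z\<in>R. G z \<noteq> 0) (near g S P)"
    by (intro near_form_nonzero[of _ d] G in_mproj P)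
  then show "eventually (\<lambda>Q. \<exists>u. unit_at g S Q (\<lambda>R. form_divisor g d F P R / form_divisor g d F Q R) u) (near g S P)"
    using near_in[of S g P]
  proof eventually_elim
    case (elim Q)
    then have Q: "Q \<in> S" by simp
    obtain H where H: "form g d H" "\<forall>z\<in>Q. H z \<noteq> 0" "\<And>F. form_divisor g d F Q = ratio F H"
      using form_divisor_ratio[OF in_mproj[OF Q], of d] by blast
    have evH: "eventually (\<lambda>R. \<forall>z\<in>R. H z \<noteq> 0) (generic g S)"
      using generic_form_nonzero[OF H(1) Q H(2)] .
    have "unit_at g S Q (\<lambda>R. ratio F G R / ratio F H R) (ratio H G)"
      unfolding unit_at_def rat_eq_iff
    proof (intro conjI)
      show "regular_at g S Q (ratio H G)" using H G elim by (intro regular_ratio)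
      obtain z where z: "z \<in> Q" using mproj_nonempty[OF in_mproj[OF Q]] by blast
      show "ratio H G Q \<noteq> 0" using ratio_eval[OF H(1) G(1) in_mproj[OF Q] z] elim H z by auto
      show "eventually (\<lambda>R. ratio F G R / ratio F H R = ratio H G R) (generic g S)"
        using nz evG evH generic_in
      proof eventually_elim
        case (elim R)
        obtain z where z: "z \<in> R" using mproj_nonempty[OF in_mproj] elim by blast
        show ?case
          using elim z ratio_eval[OF H(1) G(1) in_mproj z] ratio_eval[OF F G(1) in_mproj z]
            ratio_eval[OF F H(1) in_mproj z] by simp
      qed
    qed
    then show ?case unfolding G(3) H(3) by blast
  qed
qed

text \<open>Linear equivalence implies numerical equivalence: the bundle of a principal divisor has the constant section 1, of order 0
  everywhere. This covers also the curves contained in the support of the divisor.\<close>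

lemma numerically_equivalent_principal:
  assumes eq: "\<And>P. P \<in> S \<Longrightarrow> eventually (\<lambda>R. D P R / D' P R = h R) (generic g S)"
    and nz: "eventually (\<lambda>R. h R \<noteq> 0) (generic g S)"
  shows "numerically_equivalent g S D D'"
  unfolding numerically_equivalent_def
proof (intro allI impI)
  fix C assume C: "curve (zariski g) C \<and> C \<subseteq> S"
  then have Cm: "C \<subseteq> mproj g" using subset by blast
  have one: "regular_at g C P (\<lambda>_. 1)" for P
    unfolding regular_at_def
    by (intro exI[of _ "\<lambda>_. 0"] exI[of _ "\<lambda>_. 1"]) (auto intro: form.const)
  have req: "rat_eq g C (\<lambda>_. 1) (\<lambda>_. 1)" if "P \<in> C" for P
    unfolding rat_eq_def using Cm that openin_mproj by blast
  have quot: "is_quotient_at g C P (\<lambda>_. 1) (\<lambda>_. 1) (\<lambda>_. 1)" if "P \<in> C" for P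
    unfolding is_quotient_at_def using one req[OF that] by (auto simp: rat_eq_def)
  have colen: "colength g C P (\<lambda>_. 1) 0" if "P \<in> C" for P
    unfolding colength_def
  proof (intro exI conjI allI impI)
    fix f assume f: "regular_at g C P f"
    show "\<exists>!c::nat \<Rightarrow> complex. (\<forall>i\<ge>0. c i = 0) \<and>
       (\<exists>h. regular_at g C P h \<and> rat_eq g C f (\<lambda>R. (\<Sum>i<0. c i * (\<lambda>_ _. 0) i R) + 1 * h R))"
    proof (intro ex1I[of _ "\<lambda>_. 0"] conjI exI)
      show "rat_eq g C f (\<lambda>R. (\<Sum>i<0. 0 * (\<lambda>_ _. 0) i R) + 1 * f R)"
        unfolding rat_eq_def using Cm that openin_mproj by auto
    qed (use f in auto)
  qed simp
  show "intersection_number g S (\<lambda>P R. D P R / D' P R) C 0"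
    unfolding intersection_number_def
  proof (intro exI conjI)
    show "rational_section g S C (\<lambda>P R. D P R / D' P R) (\<lambda>_ _. 1)"
      unfolding rational_section_def
    proof (intro ballI conjI exI)
      fix P assume P: "P \<in> C"
      then show "P \<in> mproj g" using Cm by blast
      show "nonzero_rational g C (\<lambda>_. 1)" unfolding nonzero_rational_def using quot P by blast
      show "openin (zariski g) (mproj g)" by (rule openin_mproj)
      fix Q assume Q: "Q \<in> mproj g \<inter> C"
      have "eventually (\<lambda>R. D P R / D' P R / (D Q R / D' Q R) = 1) (generic g S)"
      proof -
        have "P \<in> S" "Q \<in> S" using P Q C by auto
        from eq[OF this(1)] eq[OF this(2)] nz show ?thesis by eventually_elim simp
      qed
      then show "unit_at g S Q (\<lambda>R. D P R / D' P R / (D Q R / D' Q R)) (\<lambda>_. 1)"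
        by (auto simp: unit_at_def rat_eq_iff intro: regular_const)
      show "rat_eq g C (\<lambda>R. 1 / 1) (\<lambda>_. 1)" using req[OF P] by simp
    qed
    show "\<forall>P\<in>C. has_ord g C P (\<lambda>_. 1) ((\<lambda>_. 0) P)"
      unfolding has_ord_def using quot colen by force
  qed simp_all
qed

end

section \<open>Binary forms\<close>

abbreviation bform :: "nat \<Rightarrow> ((2 \<Rightarrow> complex) \<Rightarrow> complex) \<Rightarrow> bool" where
  "bform n \<equiv> form (\<lambda>_::2. ()) (\<lambda>_. n)"

text \<open>The nonzero vectors, that is, the coordinate vectors of the points of the projective line.\<close>

abbreviation nonz :: "(2 \<Rightarrow> complex) \<Rightarrow> bool" where
  "nonz u \<equiv> u 0 \<noteq> 0 \<or> u 1 \<noteq> 0"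

text \<open>The linear form with zero \<^term>\<open>u\<close>.\<close>

definition lin :: "(2 \<Rightarrow> complex) \<Rightarrow> (2 \<Rightarrow> complex) \<Rightarrow> complex" where
  "lin u x = x 0 * u 1 - x 1 * u 0"

lemma two_cases: "(j::2) = 0 \<or> j = 1"
  using exhaust_2[of j] by auto

lemma two_eqI: "f 0 = h 0 \<Longrightarrow> f 1 = h 1 \<Longrightarrow> f = (h :: 2 \<Rightarrow> 'a)"
  using two_cases by (metis ext)

lemma bform_var: "bform 1 (\<lambda>x. x j)"
  by (rule form_var') simp

lemma bform_mult: "bform n F \<Longrightarrow> bform m G \<Longrightarrow> bform (n + m) (\<lambda>x. F x * G x)"
  by (rule form_mult') auto

lemma bform_power: "bform n F \<Longrightarrow> bform (m * n) (\<lambda>x. F x ^ m)"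
  using form_power[of "\<lambda>_. ()" "\<lambda>_. n" F m] by simp

lemma bform_lin: "bform 1 (lin u)"
  unfolding lin_def[abs_def]
  using form_diff[OF form_cmult[OF bform_var[of 0], of "u 1"] form_cmult[OF bform_var[of 1], of "u 0"]]
  by (simp add: mult.commute)

lemma lin_self [simp]: "lin u u = 0"
  by (simp add: lin_def)

lemma lin_sym: "lin u w = 0 \<longleftrightarrow> lin w u = 0"
  by (auto simp: lin_def algebra_simps)

lemma lin_zero_scale:
  assumes "nonz u" "nonz w" "lin u w = 0"
  obtains c where "c \<noteq> 0" "w = (\<lambda>j. c * u j)"
proof -
  have eq: "w 0 * u 1 = w 1 * u 0" using assms(3) by (simp add: lin_def)
  show ?thesis
  proof (cases "u 0 = 0")
    case True
    then have "u 1 \<noteq> 0" "w 0 = 0" using assms eq by auto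
    then show ?thesis using True assms by (intro that[of "w 1 / u 1"] two_eqI) auto
  next
    case False
    then have w: "w = (\<lambda>j. (w 0 / u 0) * u j)" using eq by (intro two_eqI) (auto simp: field_simps)
    then have "w 0 / u 0 \<noteq> 0" using assms(2) by (metis mult_zero_left)
    then show ?thesis using w that by blast
  qed
qed

text \<open>The homogenization of degree \<^term>\<open>n\<close> of a univariate polynomial.\<close>

definition hom :: "nat \<Rightarrow> complex poly \<Rightarrow> complex \<Rightarrow> complex \<Rightarrow> complex" where
  "hom n A s t = (\<Sum>i\<le>n. coeff A i * s ^ (n - i) * t ^ i)"

lemma hom_scale:
  assumes "s \<noteq> 0" "degree A \<le> n"
  shows "hom n A s t = s ^ n * poly A (t / s)"
proof -
  have "poly A (t / s) = (\<Sum>i\<le>n. coeff A i * (t / s) ^ i)"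
    unfolding poly_altdef using assms(2) by (intro sum.mono_neutral_left) (auto simp: coeff_eq_0)
  then show ?thesis
    using assms(1) by (auto simp: hom_def sum_distrib_left power_divide power_diff intro!: sum.cong)
qed

lemma hom_one: "degree A \<le> n \<Longrightarrow> hom n A 1 t = poly A t"
  by (subst hom_scale) auto

lemma hom_zero: "hom n A 0 t = coeff A n * t ^ n"
proof -
  have "hom n A 0 t = (\<Sum>i\<le>n. if i = n then coeff A n * t ^ n else 0)"
    unfolding hom_def by (rule sum.cong) auto
  then show ?thesis by simp
qed

lemma hom_mult:
  assumes "degree A \<le> n" "degree B \<le> m"
  shows "hom (n + m) (A * B) s t = hom n A s t * hom m B s t"
proof (cases "s = 0")
  case False
  have "degree (A * B) \<le> n + m" using degree_mult_le[of A B] assms by linarith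
  then show ?thesis using False assms by (simp add: hom_scale power_add)
next
  case True
  have "coeff (A * B) (n + m) = coeff A n * coeff B m"
  proof (cases "degree A = n \<and> degree B = m")
    case True
    then show ?thesis using coeff_mult_degree_sum[of A B] by auto
  next
    case False
    then have "degree A < n \<or> degree B < m" using assms by auto
    moreover have "degree (A * B) < n + m" using False degree_mult_le[of A B] assms by linarith
    ultimately show ?thesis by (auto simp: coeff_eq_0)
  qed
  then show ?thesis using True by (simp add: hom_zero power_add)
qed

text \<open>On the plane spanned by \<^term>\<open>u\<close> and \<^term>\<open>v\<close>, a binary form is the homogenization of a polynomial. The two points at
  \<open>s = 0\<close> and \<open>t = 0\<close> may be chosen freely, so no point of the projective line needs to be treated as infinite.\<close>

lemma bform_hom:
  assumes "form (\<lambda>_::2. ()) d F"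
  shows "\<exists>A. degree A \<le> d () \<and> (\<forall>s t. F (\<lambda>j. s * u j + t * v j) = hom (d ()) A s t)"
  using assms
proof induction
  case (const c)
  show ?case by (rule exI[of _ "[:c:]"]) (simp add: hom_def)
next
  case (var k)
  show ?case
    by (rule exI[of _ "[:u k, v k:]"]) (simp add: hom_def atMost_Suc mult.commute add.commute)
next
  case (add d F G)
  then obtain A B where "degree A \<le> d ()" "\<forall>s t. F (\<lambda>j. s * u j + t * v j) = hom (d ()) A s t"
    "degree B \<le> d ()" "\<forall>s t. G (\<lambda>j. s * u j + t * v j) = hom (d ()) B s t" by blast
  then show ?case
    by (intro exI[of _ "A + B"]) (auto simp: degree_add_le hom_def sum.distrib algebra_simps)
next
  case (mult d F e G)
  then obtain A B where *: "degree A \<le> d ()" "\<forall>s t. F (\<lambda>j. s * u j + t * v j) = hom (d ()) A s t"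
    "degree B \<le> e ()" "\<forall>s t. G (\<lambda>j. s * u j + t * v j) = hom (e ()) B s t" by blast
  then show ?case using degree_mult_le[of A B]
    by (intro exI[of _ "A * B"]) (auto simp: hom_mult)
qed

lemma bform_of_hom:
  assumes "bform 1 \<alpha>" "bform 1 \<beta>"
  shows "bform n (\<lambda>x. hom n A (\<alpha> x) (\<beta> x))"
  unfolding hom_def
proof (intro form_sum)
  fix i assume "i \<in> {..n}"
  then have n: "(n - i) * 1 + i * 1 = n" by simp
  have "bform ((n - i) * 1 + i * 1) (\<lambda>x. coeff A i * \<alpha> x ^ (n - i) * \<beta> x ^ i)"
    by (intro bform_mult form_cmult bform_power assms)
  then show "bform n (\<lambda>x. coeff A i * \<alpha> x ^ (n - i) * \<beta> x ^ i)" unfolding n .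
qed auto

lemma bform_0_const:
  assumes "bform 0 F" shows "F x = F y"
proof -
  obtain A where "\<And>s t. F (\<lambda>j. s * x j + t * y j) = hom 0 A s t" using bform_hom[OF assms, of x y] by blast
  from this[of 1 0] this[of 0 1] show ?thesis by (simp add: hom_def)
qed

text \<open>In coordinates with \<^term>\<open>u\<close> at \<open>t = 0\<close>, the form is the homogenization of a polynomial without constant term.\<close>

lemma bform_factor:
  assumes F: "bform (Suc n) F" and u: "nonz u" "F u = 0"
  shows "\<exists>G. bform n G \<and> (\<forall>x. F x = lin u x * G x)"
proof -
  obtain v where v: "lin u v = 1"
  proof (cases "u 0 = 0")
    case True
    then show ?thesis using u(1) that[of "\<lambda>j. if j = 0 then 1 / u 1 else 0"] by (simp add: lin_def)
  next
    case False
    then show ?thesis using that[of "\<lambda>j. if j = 0 then 0 else - 1 / u 0"] by (simp add: lin_def)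
  qed
  obtain A where A: "degree A \<le> Suc n" "\<And>s t. F (\<lambda>j. s * u j + t * v j) = hom (Suc n) A s t"
    using bform_hom[OF F, of u v] by blast
  \<comment> \<open>coordinates of \<open>x\<close> in the basis \<open>u\<close>, \<open>v\<close>\<close>
  have x: "x = (\<lambda>j. (- lin v x) * u j + lin u x * v j)" for x
    by (rule two_eqI; use v in \<open>simp add: lin_def\<close>; algebra)
  have Fx: "F x = hom (Suc n) A (- lin v x) (lin u x)" for x
    using A(2)[of "- lin v x" "lin u x"] x[of x] by simp
  have "poly A 0 = 0" using A(2)[of 1 0] u(2) A(1) by (simp add: hom_one)
  then have "coeff A 0 = 0" by (simp add: poly_0_coeff_0)
  then obtain B where B: "A = pCons 0 B" by (metis coeff_pCons_0 pCons_cases)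
  define G where "G = (\<lambda>x. hom n B (- lin v x) (lin u x))"
  have "hom (Suc n) A s t = t * hom n B s t" for s t
    unfolding hom_def B by (subst sum.atMost_Suc_shift) (simp add: sum_distrib_left algebra_simps)
  then have "F x = lin u x * G x" for x by (simp add: Fx G_def)
  moreover have "bform n G"
    unfolding G_def by (intro bform_of_hom form_minus bform_lin)
  ultimately show ?thesis by blast
qed

text \<open>Either the dehomogenized polynomial has a root, or it is constant and the form vanishes at infinity.\<close>

lemma bform_ex_zero:
  assumes F: "bform (Suc n) F"
  shows "\<exists>u. nonz u \<and> F u = 0"
proof -
  define e0 e1 :: "2 \<Rightarrow> complex" where "e0 = (\<lambda>j. if j = 0 then 1 else 0)" and "e1 = (\<lambda>j. if j = 0 then 0 else 1)"
  obtain A where A: "degree A \<le> Suc n" "\<And>s t. F (\<lambda>j. s * e0 j + t * e1 j) = hom (Suc n) A s t"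
    using bform_hom[OF F, of e0 e1] by blast
  show ?thesis
  proof (cases "degree A = 0")
    case True
    then have "F (\<lambda>j. 0 * e0 j + 1 * e1 j) = 0" unfolding A(2) by (simp add: hom_zero coeff_eq_0)
    then show ?thesis by (intro exI[of _ "\<lambda>j. 0 * e0 j + 1 * e1 j"]) (simp add: e1_def)
  next
    case False
    then have "\<not> constant (poly A)" by (simp add: constant_degree)
    then obtain \<tau> where "poly A \<tau> = 0" using fundamental_theorem_of_algebra by blast
    then have "F (\<lambda>j. 1 * e0 j + \<tau> * e1 j) = 0" unfolding A(2) using A(1) by (simp add: hom_one)
    then show ?thesis by (intro exI[of _ "\<lambda>j. 1 * e0 j + \<tau> * e1 j"]) (simp add: e0_def e1_def)
  qed
qed

lemma bform_factorization:
  assumes "bform n F" "F x0 \<noteq> 0"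
  shows "\<exists>c us. c \<noteq> 0 \<and> length us = n \<and> (\<forall>u\<in>set us. nonz u) \<and> (\<forall>x. F x = c * (\<Prod>u\<leftarrow>us. lin u x))"
  using assms
proof (induction n arbitrary: F)
  case 0
  then show ?case using bform_0_const[OF 0(1)] by (intro exI[of _ "F x0"] exI[of _ "[]"]) auto
next
  case (Suc n)
  obtain u where u: "nonz u" "F u = 0" using bform_ex_zero[OF Suc.prems(1)] by blast
  obtain G where G: "bform n G" "\<And>x. F x = lin u x * G x" using bform_factor[OF Suc.prems(1) u] by blast
  have "G x0 \<noteq> 0" using Suc.prems G by auto
  then obtain c us where "c \<noteq> 0" "length us = n" "\<forall>u\<in>set us. nonz u" "\<forall>x. G x = c * (\<Prod>u\<leftarrow>us. lin u x)"
    using Suc.IH[OF G(1)] by blast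
  then show ?case using u G by (intro exI[of _ c] exI[of _ "u # us"]) auto
qed

lemma form_eq_if_generically_eq:
  assumes "form g d F" "form g d G" "form g e Q" "Q x0 \<noteq> 0" "\<And>x. Q x \<noteq> 0 \<Longrightarrow> F x = G x"
  shows "F x = G x"
proof (rule ccontr)
  assume "F x \<noteq> G x"
  then have "F x - G x \<noteq> 0" by simp
  then obtain v where "F v - G v \<noteq> 0" "Q v \<noteq> 0"
    using form_common_nonzero[OF form_diff[OF assms(1,2)] assms(3), of x x0] assms(4) by blast
  then show False using assms(5) by auto
qed

text \<open>\<^term>\<open>F\<close> vanishes at \<^term>\<open>u\<close> to order exactly \<^term>\<open>m\<close>.\<close>

definition vanishes :: "(2 \<Rightarrow> complex) \<Rightarrow> ((2 \<Rightarrow> complex) \<Rightarrow> complex) \<Rightarrow> nat \<Rightarrow> bool" where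
  "vanishes u F m \<longleftrightarrow> (\<exists>k F'. bform k F' \<and> F' u \<noteq> 0 \<and> (\<forall>x. F x = lin u x ^ m * F' x))"

lemma lin_nonzero: "nonz u \<Longrightarrow> \<exists>x. lin u x \<noteq> 0"
  by (auto simp: lin_def intro: exI[of _ "\<lambda>j. if j = 0 then 1 else 0"] exI[of _ "\<lambda>j. if j = 0 then 0 else 1"])

lemma bform_cancel_lin:
  assumes F: "bform n F" and G: "bform n G" and u: "nonz u" and eq: "\<And>x. lin u x * F x = lin u x * G x"
  shows "F x = G x"
proof -
  obtain x0 where x0: "lin u x0 \<noteq> 0" using lin_nonzero[OF u] by blast
  show ?thesis
    by (rule form_eq_if_generically_eq[where F = F and G = G and Q = "lin u" and ?x0.0 = x0, OF F G bform_lin x0])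
      (use eq in auto)
qed

lemma vanishes_unique:
  assumes "nonz u" "vanishes u F m" "vanishes u F n"
  shows "m = n"
proof -
  have False if le: "m < n" and v1: "vanishes u F m" and v2: "vanishes u F n" for m n
  proof -
    obtain k F' where F': "bform k F'" "F' u \<noteq> 0" "\<And>x. F x = lin u x ^ m * F' x"
      using v1 unfolding vanishes_def by blast
    obtain l F'' where F'': "bform l F''" "F'' u \<noteq> 0" "\<And>x. F x = lin u x ^ n * F'' x"
      using v2 unfolding vanishes_def by blast
    have eq: "F' x = lin u x ^ (n - m) * F'' x" if "lin u x \<noteq> 0" for x
    proof -
      have "lin u x ^ m * F' x = lin u x ^ m * (lin u x ^ (n - m) * F'' x)"
        using F'(3) F''(3) le by (metis le_add_diff_inverse less_imp_le mult.assoc power_add)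
      then show ?thesis using that by simp
    qed
    obtain x0 where x0: "lin u x0 \<noteq> 0" using lin_nonzero assms by blast
    \<comment> \<open>The difference is not 0 at \<open>u\<close>, so it is not 0 at some point of a line through \<open>u\<close> where \<open>lin u\<close> is not 0.\<close>
    have "\<exists>v. (F' v - lin u v ^ (n - m) * F'' v) \<noteq> 0 \<and> lin u v \<noteq> 0"
    proof -
      define c where "c = (\<lambda>k. [:u k, x0 k - u k:])"
      obtain A where A: "\<And>\<tau>. F' (\<lambda>k. poly (c k) \<tau>) = poly A \<tau>" using form_poly_curve[OF F'(1), of c] by auto
      obtain B where B: "\<And>\<tau>. F'' (\<lambda>k. poly (c k) \<tau>) = poly B \<tau>" using form_poly_curve[OF F''(1), of c] by auto
      obtain L where L: "\<And>\<tau>. lin u (\<lambda>k. poly (c k) \<tau>) = poly L \<tau>" using form_poly_curve[OF bform_lin, of u c] by auto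
      have 0: "(\<lambda>k. poly (c k) 0) = u" and 1: "(\<lambda>k. poly (c k) 1) = x0" by (auto simp: c_def)
      have L0: "poly L 0 = 0" and L1: "poly L 1 \<noteq> 0" using L[of 0] L[of 1] x0 0 1 by auto
      let ?K = "A - L ^ (n - m) * B"
      have "poly ?K 0 \<noteq> 0" using A[of 0] F'(2) le L0 0 by (simp add: zero_power)
      moreover have "L \<noteq> 0" using L1 by auto
      ultimately have "?K * L \<noteq> 0" by auto
      then have "finite {\<tau>. poly (?K * L) \<tau> = 0}" by (rule poly_roots_finite)
      then obtain \<tau> where "poly (?K * L) \<tau> \<noteq> 0"
        using infinite_UNIV_char_0[where ?'a = complex] by (metis (mono_tags) ex_new_if_finite mem_Collect_eq)
      then have "poly ?K \<tau> \<noteq> 0" "poly L \<tau> \<noteq> 0" by auto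
      then show ?thesis using A B L by (intro exI[of _ "\<lambda>k. poly (c k) \<tau>"]) auto
    qed
    then show False using eq by auto
  qed
  then show ?thesis using assms by (metis linorder_neqE_nat)
qed

lemma vanishes_0: "bform n F \<Longrightarrow> F u \<noteq> 0 \<Longrightarrow> vanishes u F 0"
  by (auto simp: vanishes_def)

lemma vanishes_mult: "vanishes u F m \<Longrightarrow> vanishes u G n \<Longrightarrow> vanishes u (\<lambda>x. F x * G x) (m + n)"
proof -
  assume "vanishes u F m" "vanishes u G n"
  then obtain k F' l G' where "bform k F'" "F' u \<noteq> 0" "\<forall>x. F x = lin u x ^ m * F' x"
    "bform l G'" "G' u \<noteq> 0" "\<forall>x. G x = lin u x ^ n * G' x" by (auto simp: vanishes_def)
  then show ?thesis unfolding vanishes_def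
    by (intro exI[of _ "k + l"] exI[of _ "\<lambda>x. F' x * G' x"]) (auto simp: power_add intro: bform_mult)
qed

lemma vanishes_lin_prod:
  assumes u: "nonz u" and us: "\<forall>w\<in>set us. nonz w" and c: "c \<noteq> 0"
  shows "vanishes u (\<lambda>x. c * (\<Prod>w\<leftarrow>us. lin w x)) (length (filter (\<lambda>w. lin w u = 0) us))"
  using us
proof (induction us)
  case Nil
  show ?case using vanishes_0[of 0 "\<lambda>_. c"] c form.const[of "\<lambda>_. ()" c] by simp
next
  case (Cons w us)
  have "vanishes u (lin w) (if lin w u = 0 then 1 else 0)"
  proof (cases "lin w u = 0")
    case True
    then obtain e where "e \<noteq> 0" "w = (\<lambda>j. e * u j)"
      using lin_zero_scale[OF u, of w] Cons.prems lin_sym by auto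
    then have "\<forall>x. lin w x = lin u x ^ 1 * e" by (simp add: lin_def algebra_simps)
    then have "vanishes u (lin w) 1"
      unfolding vanishes_def using form.const[of "\<lambda>_. ()" e] \<open>e \<noteq> 0\<close>
      by (intro exI[of _ 0] exI[of _ "\<lambda>_. e"]) auto
    then show ?thesis using True by simp
  qed (use vanishes_0[OF bform_lin] in auto)
  from vanishes_mult[OF this Cons.IH] Cons.prems
  show ?case by (auto simp: mult.left_commute split: if_splits)
qed

definition vord :: "(2 \<Rightarrow> complex) \<Rightarrow> ((2 \<Rightarrow> complex) \<Rightarrow> complex) \<Rightarrow> nat" where
  "vord u F = (SOME m. vanishes u F m)"

lemma vordI: "nonz u \<Longrightarrow> vanishes u F m \<Longrightarrow> vord u F = m"
  unfolding vord_def by (metis someI vanishes_unique)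

lemma vanishes_vord:
  assumes "nonz u" "bform n F" "F x0 \<noteq> 0"
  shows "vanishes u F (vord u F)"
proof -
  obtain c us where *: "c \<noteq> 0" "\<forall>u\<in>set us. nonz u" "\<forall>x. F x = c * (\<Prod>u\<leftarrow>us. lin u x)"
    using bform_factorization[OF assms(2,3)] by blast
  have F: "F = (\<lambda>x. c * (\<Prod>u\<leftarrow>us. lin u x))" using *(3) by auto
  have "vanishes u F (length (filter (\<lambda>w. lin w u = 0) us))"
    unfolding F by (rule vanishes_lin_prod[OF assms(1) *(2,1)])
  then show ?thesis using vordI[OF assms(1)] by metis
qed

lemma vord_mult:
  assumes "nonz u" "bform n F" "F x0 \<noteq> 0" "bform m G" "G y0 \<noteq> 0"
  shows "vord u (\<lambda>x. F x * G x) = vord u F + vord u G"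
  by (rule vordI[OF assms(1) vanishes_mult[OF vanishes_vord[OF assms(1-3)] vanishes_vord[OF assms(1,4,5)]]])

lemma vord_0: "nonz u \<Longrightarrow> bform n F \<Longrightarrow> F u \<noteq> 0 \<Longrightarrow> vord u F = 0"
  by (intro vordI vanishes_0)

text \<open>By the factorization into linear forms, \<^term>\<open>vord u F\<close> counts the linear factors with zero \<^term>\<open>u\<close>. The set
  \<^term>\<open>U\<close> consists of one coordinate vector for each point of a set of points which contains all zeros.\<close>

lemma sum_vord:
  assumes F: "bform n F" "F x0 \<noteq> 0"
    and U: "finite U" "\<And>u. u \<in> U \<Longrightarrow> nonz u"
      "\<And>u w. u \<in> U \<Longrightarrow> w \<in> U \<Longrightarrow> lin u w = 0 \<Longrightarrow> u = w"
      "\<And>w. nonz w \<Longrightarrow> F w = 0 \<Longrightarrow> \<exists>u\<in>U. lin u w = 0"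
  shows "(\<Sum>u\<in>U. vord u F) = n"
proof -
  obtain c us where *: "c \<noteq> 0" "length us = n" "\<forall>u\<in>set us. nonz u" "\<forall>x. F x = c * (\<Prod>u\<leftarrow>us. lin u x)"
    using bform_factorization[OF assms(1,2)] by blast
  have Feq: "F = (\<lambda>x. c * (\<Prod>u\<leftarrow>us. lin u x))" using *(4) by auto
  have "vord u F = length (filter (\<lambda>w. lin w u = 0) us)" if "u \<in> U" for u
    unfolding Feq using vordI[OF U(2)[OF that] vanishes_lin_prod[OF U(2)[OF that] *(3,1)]] .
  then have "(\<Sum>u\<in>U. vord u F) = (\<Sum>u\<in>U. length (filter (\<lambda>w. lin w u = 0) us))" by simp
  also have "\<dots> = length us"
  proof -
    have zero: "F w = 0" if "w \<in> set us" for w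
      using that by (auto simp: Feq prod_list_zero_iff intro: image_eqI[of _ _ w])
    have one: "(\<Sum>u\<in>U. if lin w u = 0 then 1 else 0 :: nat) = 1" if wm: "w \<in> set us" for w
    proof -
      have w: "nonz w" using *(3) wm by auto
      then obtain u where u: "u \<in> U" "lin u w = 0" using U(4)[OF w zero[OF wm]] lin_sym by metis
      have uniq: "u' = u" if u': "u' \<in> U" "lin w u' = 0" for u'
      proof -
        obtain a where "a \<noteq> 0" "u' = (\<lambda>j. a * w j)" using lin_zero_scale[OF w U(2)[OF u'(1)] u'(2)] by blast
        then have "lin u' u = 0" using u(2) by (simp add: lin_def algebra_simps)
        then show ?thesis using U(3)[OF u'(1) u(1)] by blast
      qed
      have "(\<Sum>u\<in>U. if lin w u = 0 then 1 else 0 :: nat) = (\<Sum>v\<in>U. if v = u then 1 else 0)"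
      proof (rule sum.cong[OF refl])
        fix v assume v: "v \<in> U"
        have "lin w u = 0" by (rule iffD1[OF lin_sym u(2)])
        show "(if lin w v = 0 then 1 else 0 :: nat) = (if v = u then 1 else 0)"
        proof (cases "v = u")
          case True
          then show ?thesis using \<open>lin w u = 0\<close> by simp
        next
          case False
          then have "lin w v \<noteq> 0" using uniq[OF v] by blast
          then show ?thesis using False by simp
        qed
      qed
      then show ?thesis using u U(1) by simp
    qed
    have "(\<Sum>u\<in>U. length (filter (\<lambda>w. lin w u = 0) vs)) = length vs" if "set vs \<subseteq> set us" for vs
      using that
    proof (induction vs)
      case (Cons w vs)
      have "(\<Sum>u\<in>U. length (filter (\<lambda>w. lin w u = 0) (w # vs))) =
        (\<Sum>u\<in>U. (if lin w u = 0 then 1 else 0) + length (filter (\<lambda>w. lin w u = 0) vs))"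
        by (intro sum.cong) auto
      then show ?case using Cons one[of w] by (simp add: sum.distrib)
    qed simp
    then show ?thesis by blast
  qed
  finally show ?thesis using *(2) by simp
qed

lemma bform_factor':
  assumes "bform n F" "nonz u" "F u = 0" "bform 1 \<mu>"
  shows "\<exists>G. bform n G \<and> (\<forall>x. F x * \<mu> x = lin u x * G x)"
proof (cases n)
  case 0
  then have "F x = 0" for x using bform_0_const[of F x u] assms by simp
  then show ?thesis using form_zero[OF assms(1)] by (intro exI[of _ "\<lambda>_. 0"]) simp
next
  case (Suc m)
  then obtain G where "bform m G" "\<forall>x. F x = lin u x * G x" using bform_factor[of m F u] assms by blast
  then show ?thesis using bform_mult[of m G 1 \<mu>] assms(4) Suc by (intro exI[of _ "\<lambda>x. G x * \<mu> x"]) auto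
qed

text \<open>The Taylor expansion of \<open>A / B\<close> in the parameter \<open>lin u / \<mu>\<close>, with remainder: subtracting its value at \<^term>\<open>u\<close> makes
  a function divisible by the parameter.\<close>

lemma bform_expansion:
  assumes A: "bform n A" and B: "bform n B" "B u \<noteq> 0" and u: "nonz u" and \<mu>: "bform 1 \<mu>" "\<mu> u \<noteq> 0"
  shows "\<exists>c A'. bform n A' \<and> (\<forall>x. \<mu> x \<noteq> 0 \<longrightarrow> B x \<noteq> 0 \<longrightarrow>
     A x / B x = (\<Sum>i<m. c i * (lin u x / \<mu> x) ^ i) + (lin u x / \<mu> x) ^ m * (A' x / B x))"
proof (induction m)
  case 0
  show ?case using A by (intro exI[of _ "\<lambda>_. 0"] exI[of _ A]) simp
next
  case (Suc m)
  then obtain c A' where A': "bform n A'" and eq: "\<And>x. \<mu> x \<noteq> 0 \<Longrightarrow> B x \<noteq> 0 \<Longrightarrow>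
     A x / B x = (\<Sum>i<m. c i * (lin u x / \<mu> x) ^ i) + (lin u x / \<mu> x) ^ m * (A' x / B x)" by blast
  define e where "e = A' u / B u"
  have "bform n (\<lambda>x. A' x - e * B x)" by (intro form_diff form_cmult A' B)
  moreover have "A' u - e * B u = 0" using B by (simp add: e_def)
  ultimately obtain G where G: "bform n G" "\<And>x. (A' x - e * B x) * \<mu> x = lin u x * G x"
    using bform_factor'[of n "\<lambda>x. A' x - e * B x" u \<mu>] u \<mu> by blast
  show ?case
  proof (intro exI[of _ "c(m := e)"] exI[of _ G] conjI allI impI G(1))
    fix x assume x: "\<mu> x \<noteq> 0" "B x \<noteq> 0"
    have "A' x / B x = e + lin u x / \<mu> x * (G x / B x)" using G(2)[of x] x by (simp add: field_simps)
    then show "A x / B x = (\<Sum>i<Suc m. (c(m := e)) i * (lin u x / \<mu> x) ^ i) + (lin u x / \<mu> x) ^ Suc m * (G x / B x)"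
      unfolding eq[OF x] by (simp add: algebra_simps)
  qed
qed

section \<open>Orders of rational functions on rational curves\<close>

text \<open>By Gaussian elimination: each step removes one equation and one unknown.\<close>

lemma underdetermined_system:
  fixes M :: "'a \<Rightarrow> nat \<Rightarrow> 'c::field"
  assumes "finite I" "card I > k"
  shows "\<exists>c. (\<exists>i\<in>I. c i \<noteq> 0) \<and> (\<forall>j<k. (\<Sum>i\<in>I. c i * M i j) = 0)"
  using assms
proof (induction k arbitrary: I M)
  case 0
  then obtain i where "i \<in> I" by fastforce
  then show ?case by (intro exI[of _ "\<lambda>_. 1"]) auto
next
  case (Suc k)
  show ?case
  proof (cases "\<forall>i\<in>I. M i k = 0")
    case True
    obtain c where "\<exists>i\<in>I. c i \<noteq> 0" "\<forall>j<k. (\<Sum>i\<in>I. c i * M i j) = 0"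
      using Suc.IH[of I M] Suc.prems by auto
    then show ?thesis using True by (intro exI[of _ c]) (auto simp: less_Suc_eq)
  next
    case False
    then obtain p where p: "p \<in> I" "M p k \<noteq> 0" by blast
    define J where "J = I - {p}"
    have J: "finite J" "card J > k" "p \<notin> J" "I = insert p J" using Suc.prems p by (auto simp: J_def)
    obtain c where c: "\<exists>i\<in>J. c i \<noteq> 0" "\<And>j. j < k \<Longrightarrow> (\<Sum>i\<in>J. c i * (M i j - M i k / M p k * M p j)) = 0"
      using Suc.IH[OF J(1,2), of "\<lambda>i j. M i j - M i k / M p k * M p j"] by blast
    \<comment> \<open>chosen to satisfy the last equation\<close>
    define s where "s = - (\<Sum>i\<in>J. c i * (M i k / M p k))"
    have sum: "(\<Sum>i\<in>I. (c(p := s)) i * M i j) = (\<Sum>i\<in>J. c i * (M i j - M i k / M p k * M p j))" for j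
    proof -
      have "(\<Sum>i\<in>I. (c(p := s)) i * M i j) = s * M p j + (\<Sum>i\<in>J. (c(p := s)) i * M i j)"
        using J by simp
      also have "(\<Sum>i\<in>J. (c(p := s)) i * M i j) = (\<Sum>i\<in>J. c i * M i j)"
        using J(3) by (intro sum.cong) auto
      also have "s * M p j = - (\<Sum>i\<in>J. c i * (M i k / M p k * M p j))"
        by (simp add: s_def sum_distrib_right mult.assoc)
      also have "- (\<Sum>i\<in>J. c i * (M i k / M p k * M p j)) + (\<Sum>i\<in>J. c i * M i j) =
          (\<Sum>i\<in>J. c i * (M i j - M i k / M p k * M p j))"
        by (simp add: right_diff_distrib sum_subtractf)
      finally show ?thesis .
    qed
    show ?thesis
    proof (intro exI[of _ "c(p := s)"] conjI allI impI)
      show "\<exists>i\<in>I. (c(p := s)) i \<noteq> 0" using c(1) J by auto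
      fix j assume "j < Suc k"
      then show "(\<Sum>i\<in>I. (c(p := s)) i * M i j) = 0"
        unfolding sum using c(2) p(2) by (cases "j = k") auto
    qed
  qed
qed

lemma ex1_unique: "\<exists>!x. Q x \<Longrightarrow> Q x \<Longrightarrow> Q y \<Longrightarrow> x = y"
  by blast

context irreducible_subset
begin

text \<open>The elements of one basis are combinations of the elements of the other one. If there are more of them, then they are
  linearly dependent, and 0 has two expansions.\<close>

lemma colength_unique:
  assumes P: "P \<in> S" and "colength g S P a k" "colength g S P a l"
  shows "k = l"
proof -
  let ?Q = "\<lambda>e n f (c::nat \<Rightarrow> complex). (\<forall>i\<ge>n. c i = 0) \<and>
          (\<exists>h. regular_at g S P h \<and> rat_eq g S f (\<lambda>R. (\<Sum>i<n. c i * e i R) + a R * h R))"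
  have False if ck: "colength g S P a k" and cl: "colength g S P a l" and less: "k < l" for k l
  proof -
    obtain e where e: "(\<forall>i<k. regular_at g S P (e i)) \<and> (\<forall>f. regular_at g S P f \<longrightarrow> (\<exists>!c. ?Q e k f c))"
      using ck[unfolded colength_def] ..
    obtain e' where e0: "(\<forall>i<l. regular_at g S P (e' i)) \<and> (\<forall>f. regular_at g S P f \<longrightarrow> (\<exists>!c. ?Q e' l f c))"
      using cl[unfolded colength_def] ..
    have e': "regular_at g S P (e' i)" if "i < l" for i using e0 that by blast
    have "\<exists>c h. i < l \<longrightarrow> regular_at g S P h \<and> rat_eq g S (e' i) (\<lambda>R. (\<Sum>j<k. c j * e j R) + a R * h R)" for i
    proof (cases "i < l")
      case True
      obtain c where "?Q e k (e' i) c" using e[THEN conjunct2, rule_format, OF e'[OF True]] by (rule ex1E)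
      then obtain h where "regular_at g S P h \<and> rat_eq g S (e' i) (\<lambda>R. (\<Sum>j<k. c j * e j R) + a R * h R)"
        by (elim conjE exE) (rule that, rule conjI)
      then show ?thesis by (intro exI impI)
    qed simp
    then have ex: "\<forall>i. \<exists>c h. i < l \<longrightarrow> regular_at g S P h \<and> rat_eq g S (e' i) (\<lambda>R. (\<Sum>j<k. c j * e j R) + a R * h R)" ..
    obtain M where "\<forall>i. \<exists>h. i < l \<longrightarrow> regular_at g S P h \<and> rat_eq g S (e' i) (\<lambda>R. (\<Sum>j<k. M i j * e j R) + a R * h R)"
      using choice[OF ex] ..
    from choice[OF this] obtain h where
      Mh0: "\<forall>i. i < l \<longrightarrow> regular_at g S P (h i) \<and> rat_eq g S (e' i) (\<lambda>R. (\<Sum>j<k. M i j * e j R) + a R * h i R)" ..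
    then have Mh: "regular_at g S P (h i)" "rat_eq g S (e' i) (\<lambda>R. (\<Sum>j<k. M i j * e j R) + a R * h i R)"
      if "i < l" for i using that by simp_all
    obtain c where c: "\<exists>i\<in>{..<l}. c i \<noteq> 0" "\<And>j. j < k \<Longrightarrow> (\<Sum>i<l. c i * M i j) = 0"
      using underdetermined_system[of "{..<l}" k M] less by auto
    define d where "d = (\<lambda>i. if i < l then c i else 0)"
    define h' where "h' = (\<lambda>R. \<Sum>i<l. - c i * h i R)"
    have h': "regular_at g S P h'"
      unfolding h'_def by (intro regular_sum regular_mult regular_const Mh) auto
    have "eventually (\<lambda>R. \<forall>i\<in>{..<l}. e' i R = (\<Sum>j<k. M i j * e j R) + a R * h i R) (generic g S)"
      using Mh(2) by (intro eventually_ball_finite) (auto simp: rat_eq_iff)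
    then have "eventually (\<lambda>R. 0 = (\<Sum>i<l. d i * e' i R) + a R * h' R) (generic g S)"
    proof eventually_elim
      case (elim R)
      have "(\<Sum>i<l. d i * e' i R) = (\<Sum>i<l. c i * ((\<Sum>j<k. M i j * e j R) + a R * h i R))"
        using elim by (intro sum.cong) (auto simp: d_def)
      also have "\<dots> = (\<Sum>i<l. \<Sum>j<k. c i * M i j * e j R) + (\<Sum>i<l. c i * (a R * h i R))"
        by (simp add: distrib_left sum.distrib sum_distrib_left mult.assoc)
      also have "(\<Sum>i<l. \<Sum>j<k. c i * M i j * e j R) = (\<Sum>j<k. (\<Sum>i<l. c i * M i j) * e j R)"
        by (subst sum.swap) (simp add: sum_distrib_right)
      also have "\<dots> = 0" using c(2) by simp
      also have "(\<Sum>i<l. c i * (a R * h i R)) = - (a R * h' R)"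
        by (simp add: h'_def sum_negf sum_distrib_left mult.left_commute)
      finally show ?case by simp
    qed
    then have 1: "rat_eq g S (\<lambda>_. 0) (\<lambda>R. (\<Sum>i<l. d i * e' i R) + a R * h' R)" by (simp add: rat_eq_iff)
    have 2: "rat_eq g S (\<lambda>_. 0) (\<lambda>R. (\<Sum>i<l. (\<lambda>_. 0) i * e' i R) + a R * 0)" by (simp add: rat_eq_iff)
    have "\<exists>!c. ?Q e' l (\<lambda>_. 0) c" using e0[THEN conjunct2, rule_format, OF regular_const[of P 0]] .
    moreover have "?Q e' l (\<lambda>_. 0) d"
      by (intro conjI exI[of _ h'] h' 1) (simp add: d_def)
    moreover have "?Q e' l (\<lambda>_. 0) (\<lambda>_. 0)"
      by (intro conjI exI[of _ "\<lambda>_. 0"] regular_const 2) simp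
    ultimately have "d = (\<lambda>_. 0)" by (rule ex1_unique[where Q = "?Q e' l (\<lambda>_. 0)"])
    then show False using c(1) unfolding d_def fun_eq_iff by (metis lessThan_iff)
  qed
  then show ?thesis using assms by (metis linorder_neqE_nat)
qed

end

text \<open>The common nonvanishing point is a nonzero vector; this has to be ensured separately for forms of degree 0.\<close>

lemma bform_common_nonzero:
  assumes "bform n F" "bform m G" "nonz x" "F x \<noteq> 0" "G y \<noteq> 0"
  shows "\<exists>v. nonz v \<and> F v \<noteq> 0 \<and> G v \<noteq> 0"
proof -
  obtain j where j: "x j \<noteq> 0" using assms(3) by blast
  obtain v where "F v * v j \<noteq> 0" "G v \<noteq> 0"
    using form_common_nonzero[OF bform_mult[OF assms(1) bform_var[of j]] assms(2), of x y] assms j by auto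
  then show ?thesis using two_cases[of j] by auto
qed

lemma bform_degree_unique:
  assumes "bform n F" "bform m F" "F x \<noteq> 0" shows "n = m"
proof -
  have "F (\<lambda>k. 2 * x k) = 2 ^ n * F x" "F (\<lambda>k. 2 * x k) = 2 ^ m * F x"
    using form_scale[OF assms(1), of "\<lambda>_. 2" x] form_scale[OF assms(2), of "\<lambda>_. 2" x]
    by (simp_all add: UNIV_unit)
  then have "(2::complex) ^ n = 2 ^ m" using assms(3) by simp
  then have "(2::nat) ^ n = 2 ^ m" by (metis of_nat_eq_iff of_nat_numeral of_nat_power)
  then show ?thesis by simp
qed

text \<open>The image of a morphism from the projective line which is given by binary forms \<^term>\<open>\<phi>\<close> and is a section of the
  projection to the factor \<^term>\<open>b0\<close>, which is a projective line with coordinates \<^term>\<open>\<iota>\<close>. By the projection, every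
  quotient of binary forms of the same degree is a rational function on the curve.\<close>

locale section_curve =
  fixes g :: "'k \<Rightarrow> 'b::finite" and \<phi> :: "'k \<Rightarrow> (2 \<Rightarrow> complex) \<Rightarrow> complex"
    and \<delta> :: "'b \<Rightarrow> nat" and \<iota> :: "2 \<Rightarrow> 'k" and b0 :: 'b
  assumes \<phi>_form: "\<And>k. bform (\<delta> (g k)) (\<phi> k)"
    and \<phi>_coords: "\<And>x. nonz x \<Longrightarrow> coords g (\<lambda>k. \<phi> k x)"
    and \<iota>: "\<And>j. g (\<iota> j) = b0" "\<And>j x. \<phi> (\<iota> j) x = x j" "\<And>k. g k = b0 \<Longrightarrow> k \<in> range \<iota>"
begin

definition \<gamma> :: "(2 \<Rightarrow> complex) \<Rightarrow> ('k \<Rightarrow> complex) set" where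
  "\<gamma> x = mpoint g (\<lambda>k. \<phi> k x)"

definition C :: "('k \<Rightarrow> complex) set set" where
  "C = {\<gamma> x | x. nonz x}"

lemma \<gamma>_mproj: "nonz x \<Longrightarrow> \<gamma> x \<in> mproj g"
  unfolding \<gamma>_def by (intro mpoint_in_mproj \<phi>_coords)

lemma \<gamma>_mem: "(\<lambda>k. \<phi> k x) \<in> \<gamma> x"
  by (simp add: \<gamma>_def)

lemma \<gamma>_C: "nonz x \<Longrightarrow> \<gamma> x \<in> C"
  by (auto simp: C_def)

lemma \<gamma>_eq_iff:
  assumes "nonz x" "nonz w" shows "\<gamma> x = \<gamma> w \<longleftrightarrow> lin x w = 0"
proof
  assume "\<gamma> x = \<gamma> w"
  then have "(\<lambda>k. \<phi> k x) \<in> mpoint g (\<lambda>k. \<phi> k w)" by (metis \<gamma>_def mpoint_refl)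
  from mpoint_proportional_rev[OF this, of "\<iota> 0" "\<iota> 1"] show "lin x w = 0"
    by (simp add: \<iota> lin_def mult.commute)
next
  assume "lin x w = 0"
  then obtain c where c: "c \<noteq> 0" "w = (\<lambda>j. c * x j)" using lin_zero_scale[OF assms] by blast
  have "(\<lambda>k. \<phi> k w) \<in> mpoint g (\<lambda>k. \<phi> k x)"
  proof (rule mpointI[of "\<lambda>b. c ^ \<delta> b"])
    show "(\<lambda>k. \<phi> k w) = (\<lambda>k. c ^ \<delta> (g k) * \<phi> k x)"
      using form_scale[OF \<phi>_form, of _ "\<lambda>_. c" x] by (simp add: c(2) UNIV_unit)
  qed (use c in auto)
  then show "\<gamma> x = \<gamma> w" unfolding \<gamma>_def by (metis mpoint_eqI)
qed

lemma pull_form: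
  "form g d F \<Longrightarrow> bform (\<Sum>b\<in>UNIV. d b * \<delta> b) (\<lambda>x. F (\<lambda>k. \<phi> k x))"
  using form_subst[of g d F "\<lambda>_. ()" "\<lambda>b _. \<delta> b" \<phi>] \<phi>_form by simp

text \<open>Every binary form extends to a form on the ambient space, in the coordinates of the factor \<^term>\<open>b0\<close>.\<close>

lemma push_form: "bform n A \<Longrightarrow> form g (\<lambda>b. n * (if b = b0 then 1 else 0)) (\<lambda>z. A (\<lambda>j. z (\<iota> j)))"
  using form_subst[of "\<lambda>_. ()" "\<lambda>_. n" A g "\<lambda>_ b. if b = b0 then 1 else 0" "\<lambda>j z. z (\<iota> j)"]
    form.var[of g "\<iota> _"] \<iota>(1) by (simp add: UNIV_unit)

lemma C_open_iff:
  assumes "openin (zariski g) U" "nonz x" "\<gamma> x \<in> U"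
  shows "\<exists>n Q. bform n Q \<and> Q x \<noteq> 0 \<and> (\<forall>w. nonz w \<longrightarrow> Q w \<noteq> 0 \<longrightarrow> \<gamma> w \<in> U)"
proof -
  obtain d F where F: "form g d F" "\<gamma> x \<in> nonvanishing g F" "nonvanishing g F \<subseteq> U"
    using openin_zariski_basic[OF assms(1,3)] by blast
  show ?thesis
  proof (intro exI conjI allI impI)
    show "bform (\<Sum>b\<in>UNIV. d b * \<delta> b) (\<lambda>x. F (\<lambda>k. \<phi> k x))" by (rule pull_form[OF F(1)])
    show "F (\<lambda>k. \<phi> k x) \<noteq> 0" using F(2) \<gamma>_mem by (auto simp: nonvanishing_def)
    fix w assume "nonz w" "F (\<lambda>k. \<phi> k w) \<noteq> 0"
    then have "\<gamma> w \<in> nonvanishing g F" using nonvanishing_iff(1)[OF F(1) \<gamma>_mproj \<gamma>_mem] by blast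
    then show "\<gamma> w \<in> U" using F(3) by blast
  qed
qed

sublocale irreducible_subset g C
proof
  show "C \<subseteq> mproj g" using \<gamma>_mproj by (auto simp: C_def)
  show "C \<noteq> {}" using \<gamma>_C[of "\<lambda>_. 1"] by auto
next
  fix U V assume U: "openin (zariski g) U" "U \<inter> C \<noteq> {}" and V: "openin (zariski g) V" "V \<inter> C \<noteq> {}"
  obtain x y where x: "nonz x" "\<gamma> x \<in> U" and y: "nonz y" "\<gamma> y \<in> V" using U V by (auto simp: C_def)
  obtain n Q where Q: "bform n Q" "Q x \<noteq> 0" "\<And>w. nonz w \<Longrightarrow> Q w \<noteq> 0 \<Longrightarrow> \<gamma> w \<in> U"
    using C_open_iff[OF U(1) x] by blast
  obtain m K where K: "bform m K" "K y \<noteq> 0" "\<And>w. nonz w \<Longrightarrow> K w \<noteq> 0 \<Longrightarrow> \<gamma> w \<in> V"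
    using C_open_iff[OF V(1) y] by blast
  obtain v where "nonz v" "Q v \<noteq> 0" "K v \<noteq> 0"
    using bform_common_nonzero[OF Q(1) K(1) x(1) Q(2) K(2)] by blast
  then show "U \<inter> V \<inter> C \<noteq> {}" using Q(3) K(3) \<gamma>_C by blast
qed

definition rf :: "((2 \<Rightarrow> complex) \<Rightarrow> complex) \<Rightarrow> ((2 \<Rightarrow> complex) \<Rightarrow> complex) \<Rightarrow> ('k \<Rightarrow> complex) set \<Rightarrow> complex" where
  "rf A B = ratio (\<lambda>z. A (\<lambda>j. z (\<iota> j))) (\<lambda>z. B (\<lambda>j. z (\<iota> j)))"

lemma rf_eval: "bform n A \<Longrightarrow> bform n B \<Longrightarrow> nonz x \<Longrightarrow> rf A B (\<gamma> x) = A x / B x"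
  unfolding rf_def using ratio_eval[OF push_form push_form \<gamma>_mproj \<gamma>_mem] by (simp add: \<iota>)

lemma generic_iff:
  "eventually Pr (generic g C) \<longleftrightarrow>
    (\<exists>n Q x. bform n Q \<and> nonz x \<and> Q x \<noteq> 0 \<and> (\<forall>w. nonz w \<longrightarrow> Q w \<noteq> 0 \<longrightarrow> Pr (\<gamma> w)))"
proof
  assume "eventually Pr (generic g C)"
  then obtain U where U: "openin (zariski g) U" "U \<inter> C \<noteq> {}" "\<forall>R\<in>U \<inter> C. Pr R"
    by (auto simp: eventually_generic)
  then obtain x where x: "nonz x" "\<gamma> x \<in> U" by (auto simp: C_def)
  obtain n Q where Q: "bform n Q" "Q x \<noteq> 0" "\<And>w. nonz w \<Longrightarrow> Q w \<noteq> 0 \<Longrightarrow> \<gamma> w \<in> U"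
    using C_open_iff[OF U(1) x] by blast
  then show "\<exists>n Q x. bform n Q \<and> nonz x \<and> Q x \<noteq> 0 \<and> (\<forall>w. nonz w \<longrightarrow> Q w \<noteq> 0 \<longrightarrow> Pr (\<gamma> w))"
    using x U(3) \<gamma>_C by blast
next
  assume "\<exists>n Q x. bform n Q \<and> nonz x \<and> Q x \<noteq> 0 \<and> (\<forall>w. nonz w \<longrightarrow> Q w \<noteq> 0 \<longrightarrow> Pr (\<gamma> w))"
  then obtain n Q x where Q: "bform n Q" "nonz x" "Q x \<noteq> 0" "\<And>w. nonz w \<Longrightarrow> Q w \<noteq> 0 \<Longrightarrow> Pr (\<gamma> w)"
    by blast
  let ?F = "\<lambda>z. Q (\<lambda>j. z (\<iota> j))"
  have iff: "\<gamma> w \<in> nonvanishing g ?F \<longleftrightarrow> Q w \<noteq> 0" if "nonz w" for w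
    using nonvanishing_iff(1)[OF push_form[OF Q(1)] \<gamma>_mproj[OF that] \<gamma>_mem] by (simp add: \<iota>)
  have "\<gamma> x \<in> nonvanishing g ?F \<inter> C" using iff[OF Q(2)] Q \<gamma>_C by blast
  moreover have "\<forall>R\<in>nonvanishing g ?F \<inter> C. Pr R" using iff Q(4) by (auto simp: C_def)
  ultimately show "eventually Pr (generic g C)"
    unfolding eventually_generic using openin_nonvanishing[OF push_form[OF Q(1)]] by blast
qed

text \<open>A point lies on the curve if and only if its coordinates are proportional, in each factor, to the values of \<^term>\<open>\<phi>\<close> at
  its projection to the factor \<^term>\<open>b0\<close>.\<close>

lemma closedin_C: "closedin (zariski g) C"
proof -
  let ?I = "{(k, l). g k = g l}"
  let ?F = "\<lambda>(k, l) z. z k * \<phi> l (\<lambda>j. z (\<iota> j)) - z l * \<phi> k (\<lambda>j. z (\<iota> j))"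
  let ?d = "\<lambda>(k, l). \<lambda>b. (if b = g k then 1 else 0) + \<delta> (g k) * (if b = b0 then 1 else 0)"
  have "closedin (zariski g) {Q \<in> mproj g. \<forall>i\<in>?I. \<forall>z\<in>Q. ?F i z = 0}"
  proof (rule closedin_vanishing)
    fix i assume "i \<in> ?I"
    then obtain k l where i: "i = (k, l)" "g k = g l" by auto
    have 1: "form g (?d (k, l)) (\<lambda>z. z k * \<phi> l (\<lambda>j. z (\<iota> j)))"
      by (rule form_mult'[OF form.var push_form[OF \<phi>_form]]) (simp add: i(2))
    have 2: "form g (?d (k, l)) (\<lambda>z. z l * \<phi> k (\<lambda>j. z (\<iota> j)))"
      by (rule form_mult'[OF form.var push_form[OF \<phi>_form]]) (simp add: i(2))
    show "form g (?d i) (?F i)" unfolding i(1) using form_diff[OF 1 2] by simp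
  qed
  also have "{Q \<in> mproj g. \<forall>i\<in>?I. \<forall>z\<in>Q. ?F i z = 0} = C"
  proof (intro equalityI subsetI)
    fix P assume "P \<in> {Q \<in> mproj g. \<forall>i\<in>?I. \<forall>z\<in>Q. ?F i z = 0}"
    then have P: "P \<in> mproj g" and eq: "\<And>k l z. g k = g l \<Longrightarrow> z \<in> P \<Longrightarrow> z k * \<phi> l (\<lambda>j. z (\<iota> j)) = z l * \<phi> k (\<lambda>j. z (\<iota> j))"
      by auto
    obtain z where z: "z \<in> P" using mproj_nonempty[OF P] by blast
    have cz: "coords g z" using mproj_coords[OF P z] .
    define x where "x = (\<lambda>j. z (\<iota> j))"
    obtain k where "g k = b0" "z k \<noteq> 0" using cz by (auto simp: coords_def)
    then obtain j where "x j \<noteq> 0" using \<iota>(3) by (auto simp: x_def)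
    then have x: "nonz x" using two_cases[of j] by auto
    have "z \<in> mpoint g (\<lambda>k. \<phi> k x)"
      using eq[OF _ z] by (intro mpoint_proportional cz \<phi>_coords x) (simp add: x_def)
    then have "P = \<gamma> x" unfolding \<gamma>_def using mproj_rep[OF P z] mpoint_eqI by metis
    then show "P \<in> C" using \<gamma>_C[OF x] by simp
  next
    fix P assume "P \<in> C"
    then obtain x where x: "nonz x" "P = \<gamma> x" by (auto simp: C_def)
    have zero: "?F i (\<lambda>k. \<phi> k x) = 0" for i by (cases i) (simp add: \<iota>)
    have "?F i z = 0" if "i \<in> ?I" "z \<in> P" for i z
    proof -
      obtain k l where i: "i = (k, l)" "g k = g l" using \<open>i \<in> ?I\<close> by auto
      have 1: "form g (?d (k, l)) (\<lambda>z. z k * \<phi> l (\<lambda>j. z (\<iota> j)))"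
        by (rule form_mult'[OF form.var push_form[OF \<phi>_form]]) (simp add: i(2))
      have 2: "form g (?d (k, l)) (\<lambda>z. z l * \<phi> k (\<lambda>j. z (\<iota> j)))"
        by (rule form_mult'[OF form.var push_form[OF \<phi>_form]]) (simp add: i(2))
      show ?thesis
        using form_zero_mpoint_iff[OF form_diff[OF 1 2], of z "\<lambda>k. \<phi> k x"] that x by (simp add: i(1) \<gamma>_def \<iota>)
    qed
    then show "P \<in> {Q \<in> mproj g. \<forall>i\<in>?I. \<forall>z\<in>Q. ?F i z = 0}" using \<gamma>_mproj x by blast
  qed
  finally show ?thesis .
qed

text \<open>A form which vanishes on the subset, but not on all of the curve, restricts to a nonzero binary form, which has only
  finitely many zeros.\<close>

lemma finite_closed_subset:
  assumes "closedin (zariski g) Z" "Z \<subset> C"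
  shows "finite Z"
proof -
  obtain x where x: "nonz x" "\<gamma> x \<notin> Z" using assms(2) by (auto simp: C_def)
  have U: "openin (zariski g) (mproj g - Z)" using assms(1) by (simp add: closedin_def)
  obtain n Q where Q: "bform n Q" "Q x \<noteq> 0" "\<And>w. nonz w \<Longrightarrow> Q w \<noteq> 0 \<Longrightarrow> \<gamma> w \<notin> Z"
    using C_open_iff[OF U x(1)] \<gamma>_mproj x by blast
  obtain c us where us: "c \<noteq> 0" "\<forall>u\<in>set us. nonz u" "\<forall>x. Q x = c * (\<Prod>u\<leftarrow>us. lin u x)"
    using bform_factorization[OF Q(1,2)] by blast
  have "Z \<subseteq> \<gamma> ` set us"
  proof
    fix P assume P: "P \<in> Z"
    then obtain w where w: "nonz w" "P = \<gamma> w" using assms(2) by (auto simp: C_def)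
    then have "Q w = 0" using Q(3) P by blast
    then obtain u where u: "u \<in> set us" "lin u w = 0" using us by (auto simp: prod_list_zero_iff)
    then have "nonz u" using us by blast
    then have "P = \<gamma> u" using w u \<gamma>_eq_iff[of u w] by blast
    then show "P \<in> \<gamma> ` set us" using u by blast
  qed
  then show ?thesis by (rule finite_subset) simp
qed

lemma curve_C: "curve (zariski g) C"
  unfolding curve_def irreducible_closed_def
proof (intro conjI allI impI)
  show "closedin (zariski g) C" by (rule closedin_C)
  show "C \<noteq> {}" by (rule nonempty)
next
  fix A B assume *: "closedin (zariski g) A \<and> closedin (zariski g) B \<and> C \<subseteq> A \<union> B"
  then have "openin (zariski g) (mproj g - A)" "openin (zariski g) (mproj g - B)" by (auto simp: closedin_def)
  from opens_meet[OF this] show "C \<subseteq> A \<or> C \<subseteq> B" using * subset by blast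
next
  fix P
  let ?x = "\<lambda>j::2. if j = 0 then 1 else 0 :: complex" and ?y = "\<lambda>j::2. if j = 0 then 0 else 1 :: complex"
  have "\<gamma> ?x \<noteq> \<gamma> ?y" "\<gamma> ?x \<in> C" "\<gamma> ?y \<in> C"
    using \<gamma>_eq_iff[of ?x ?y] \<gamma>_C[of ?x] \<gamma>_C[of ?y] by (auto simp: lin_def)
  then show "C \<noteq> {P}" by auto
next
  fix Z assume Z: "(closedin (zariski g) Z \<and> Z \<noteq> {} \<and>
    (\<forall>A B. closedin (zariski g) A \<and> closedin (zariski g) B \<and> Z \<subseteq> A \<union> B \<longrightarrow> Z \<subseteq> A \<or> Z \<subseteq> B)) \<and> Z \<subset> C"
  then have fin: "finite Z" using finite_closed_subset by blast
  obtain P where P: "P \<in> Z" using Z by blast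
  have pts: "closedin (zariski g) {Q}" if "Q \<in> Z" for Q using Z that in_mproj by (intro closedin_point) auto
  have "closedin (zariski g) (\<Union>Q\<in>Z - {P}. {Q})" using fin pts by (intro closedin_Union) auto
  moreover have "(\<Union>Q\<in>Z - {P}. {Q}) = Z - {P}" by auto
  ultimately have "closedin (zariski g) (Z - {P})" by simp
  then have "Z \<subseteq> {P} \<or> Z \<subseteq> Z - {P}" using Z pts[OF P] by blast
  then show "\<exists>P. Z = {P}" using P by blast
qed

lemma regular_on_C:
  assumes "regular_at g C (\<gamma> u) f" "nonz u"
  shows "\<exists>n A B. bform n A \<and> bform n B \<and> B u \<noteq> 0 \<and> (\<forall>x. nonz x \<longrightarrow> B x \<noteq> 0 \<longrightarrow> f (\<gamma> x) = A x / B x)"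
proof -
  obtain d G H where *: "form g d G" "form g d H" "\<forall>z\<in>\<gamma> u. H z \<noteq> 0"
    "\<forall>R\<in>C. \<forall>z\<in>R. H z \<noteq> 0 \<longrightarrow> f R = G z / H z"
    using assms(1) unfolding regular_at_def by blast
  show ?thesis
    by (intro exI conjI, rule pull_form[OF *(1)], rule pull_form[OF *(2)])
      (use *(3,4) \<gamma>_mem \<gamma>_C in auto)
qed

lemma regular_rf:
  assumes "bform n A" "bform n B" "B u \<noteq> 0" "nonz u"
  shows "regular_at g C (\<gamma> u) (rf A B)"
  unfolding rf_def
proof (rule regular_ratio[OF push_form[OF assms(1)] push_form[OF assms(2)]])
  show "\<forall>z\<in>\<gamma> u. B (\<lambda>j. z (\<iota> j)) \<noteq> 0"
    using nonvanishing_iff(2)[OF push_form[OF assms(2)] \<gamma>_mproj[OF assms(4)] \<gamma>_mem] assms(3) by (simp add: \<iota>)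
qed

lemma generic_form: "bform n Q \<Longrightarrow> nonz x \<Longrightarrow> Q x \<noteq> 0 \<Longrightarrow> (\<And>w. nonz w \<Longrightarrow> Q w \<noteq> 0 \<Longrightarrow> Pr (\<gamma> w)) \<Longrightarrow>
   eventually Pr (generic g C)"
  unfolding generic_iff by blast

text \<open>The powers of the parameter \<open>lin u / \<mu>\<close> below the \<^term>\<open>m\<close>-th one are linearly independent modulo the \<^term>\<open>m\<close>-th one:
  evaluation at the point gives the lowest coefficient, after which the parameter can be cancelled.\<close>

lemma parameter_independent:
  assumes u: "nonz u" and \<mu>: "bform 1 \<mu>" "\<mu> u \<noteq> 0"
    and "regular_at g C (\<gamma> u) h"
    and "eventually (\<lambda>R. (\<Sum>i<m. d i * rf (lin u) \<mu> R ^ i) = rf (lin u) \<mu> R ^ m * h R) (generic g C)"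
  shows "\<forall>i<m. d i = 0"
  using assms(5)
proof (induction m arbitrary: d)
  case (Suc m)
  let ?\<tau> = "rf (lin u) \<mu>"
  have \<tau>: "regular_at g C (\<gamma> u) ?\<tau>" using regular_rf[OF bform_lin \<mu>(1) _ u] \<mu>(2) by blast
  have \<tau>0: "?\<tau> (\<gamma> u) = 0" using rf_eval[OF bform_lin \<mu>(1) u] by simp
  have eq: "eventually (\<lambda>R. d 0 + ?\<tau> R * (\<Sum>i<m. d (Suc i) * ?\<tau> R ^ i) = ?\<tau> R ^ Suc m * h R) (generic g C)"
    using Suc.prems by (simp add: sum.lessThan_Suc_shift sum_distrib_left mult.left_commute del: sum.lessThan_Suc)
  have "d 0 + ?\<tau> (\<gamma> u) * (\<Sum>i<m. d (Suc i) * ?\<tau> (\<gamma> u) ^ i) = ?\<tau> (\<gamma> u) ^ Suc m * h (\<gamma> u)"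
    by (rule regular_eq_at[OF _ _ \<gamma>_C[OF u] eq])
      (intro regular_add regular_mult regular_const regular_sum regular_power \<tau> assms(4) finite_lessThan)+
  then have d0: "d 0 = 0" using \<tau>0 by simp
  obtain x0 where x0: "lin u x0 \<noteq> 0" using lin_nonzero[OF u] by blast
  then have nx0: "nonz x0" by (auto simp: lin_def)
  obtain v where v: "nonz v" "lin u v \<noteq> 0" "\<mu> v \<noteq> 0"
    using bform_common_nonzero[of 1 "lin u" 1 \<mu> x0 u] bform_lin \<mu> nx0 x0 by blast
  have "eventually (\<lambda>R. ?\<tau> R \<noteq> 0) (generic g C)"
    by (rule generic_form[OF bform_mult[OF bform_lin \<mu>(1)] v(1)])
      (use v rf_eval[OF bform_lin \<mu>(1)] in auto)
  then have "eventually (\<lambda>R. (\<Sum>i<m. d (Suc i) * ?\<tau> R ^ i) = ?\<tau> R ^ m * h R) (generic g C)"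
    using eq by eventually_elim (simp add: d0)
  from Suc.IH[OF this] d0 show ?case by (auto simp: less_Suc_eq_0_disj)
qed simp

text \<open>Up to a unit, \<^term>\<open>a\<close> is the power with exponent \<^term>\<open>vord u A\<close> of the parameter, and the lower powers of the parameter
  are a basis of the quotient of the local ring.\<close>

lemma colength_vord:
  assumes u: "nonz u" and A: "bform n A" "A x0 \<noteq> 0" and B: "bform n B" "B u \<noteq> 0"
    and a: "\<And>x. nonz x \<Longrightarrow> B x \<noteq> 0 \<Longrightarrow> a (\<gamma> x) = A x / B x"
  shows "colength g C (\<gamma> u) a (vord u A)"
proof -
  define m where "m = vord u A"
  obtain k A' where A': "bform k A'" "A' u \<noteq> 0" "\<And>x. A x = lin u x ^ m * A' x"
    using vanishes_vord[OF u A] unfolding vanishes_def m_def by blast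
  have "bform (m * 1 + k) A"
    using bform_mult[OF bform_power[OF bform_lin[of u], of m] A'(1)] A'(3) ext[of A, OF A'(3)] by simp
  then have km: "m + k = n" using bform_degree_unique[OF A(1) _ A(2)] by simp
  obtain j where j: "u j \<noteq> 0" using u by blast
  define \<mu> where "\<mu> = (\<lambda>x::2 \<Rightarrow> complex. x j)"
  have \<mu>: "bform 1 \<mu>" "\<mu> u \<noteq> 0" using j bform_var by (auto simp: \<mu>_def)
  define \<tau> where "\<tau> = rf (lin u) \<mu>"
  have \<tau>: "regular_at g C (\<gamma> u) \<tau>" unfolding \<tau>_def using regular_rf[OF bform_lin \<mu>(1) _ u] \<mu>(2) by blast
  have \<tau>x: "\<tau> (\<gamma> x) = lin u x / \<mu> x" if "nonz x" for x
    unfolding \<tau>_def using rf_eval[OF bform_lin \<mu>(1) that] .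
  \<comment> \<open>the unit: \<open>A / B\<close> is the \<open>m\<close>-th power of \<open>lin u / \<mu>\<close> times \<open>?W / B\<close>\<close>
  let ?W = "\<lambda>x. \<mu> x ^ m * A' x"
  have W: "bform n ?W" using bform_mult[OF bform_power[OF \<mu>(1), of m] A'(1)] km by simp
  define w where "w = rf ?W B"
  have w: "regular_at g C (\<gamma> u) w" "w (\<gamma> u) \<noteq> 0"
    using regular_rf[OF W B u] rf_eval[OF W B(1) u] \<mu> A'(2) B(2) by (auto simp: w_def)
  have aw: "a (\<gamma> x) = \<tau> (\<gamma> x) ^ m * w (\<gamma> x)" if "nonz x" "B x \<noteq> 0" "\<mu> x \<noteq> 0" for x
    using a[OF that(1,2)] \<tau>x[OF that(1)] rf_eval[OF W B(1) that(1)] that(3)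
    by (simp add: w_def A'(3) power_divide)
  have w0: "w (\<gamma> x) \<noteq> 0" if "nonz x" "B x \<noteq> 0" "\<mu> x \<noteq> 0" "A' x \<noteq> 0" for x
    using rf_eval[OF W B(1) that(1)] that by (simp add: w_def)
  let ?Q0 = "\<lambda>x. B x * \<mu> x * A' x"
  have Q0: "bform (n + 1 + k) ?Q0" by (intro bform_mult B(1) \<mu>(1) A'(1))
  have Q0u: "?Q0 u \<noteq> 0" using \<mu> A' B by simp
  have aw_ev: "eventually (\<lambda>R. a R = \<tau> R ^ m * w R \<and> w R \<noteq> 0) (generic g C)"
    by (rule generic_form[OF Q0 u Q0u]) (use aw w0 in auto)
  show ?thesis
    unfolding colength_def m_def[symmetric]
  proof (intro exI[of _ "\<lambda>i R. \<tau> R ^ i"] conjI allI impI)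
    show "regular_at g C (\<gamma> u) (\<lambda>R. \<tau> R ^ i)" for i by (rule regular_power[OF \<tau>])
    fix f assume f: "regular_at g C (\<gamma> u) f"
    obtain n1 A1 B1 where 1: "bform n1 A1" "bform n1 B1" "B1 u \<noteq> 0"
      "\<And>x. nonz x \<Longrightarrow> B1 x \<noteq> 0 \<Longrightarrow> f (\<gamma> x) = A1 x / B1 x"
      using regular_on_C[OF f u] by blast
    obtain c A2 where 2: "bform n1 A2" "\<And>x. \<mu> x \<noteq> 0 \<Longrightarrow> B1 x \<noteq> 0 \<Longrightarrow>
       A1 x / B1 x = (\<Sum>i<m. c i * (lin u x / \<mu> x) ^ i) + (lin u x / \<mu> x) ^ m * (A2 x / B1 x)"
      using bform_expansion[OF 1(1,2,3) u \<mu>, of m] by blast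
    define h where "h = (\<lambda>R. rf A2 B1 R * (1 / w R))"
    have h: "regular_at g C (\<gamma> u) h"
      unfolding h_def by (intro regular_mult regular_inverse regular_rf[OF 2(1) 1(2,3) u] w \<gamma>_C u)
    define c' where "c' = (\<lambda>i. if i < m then c i else 0)"
    have "eventually (\<lambda>R. f R = (\<Sum>i<m. c' i * \<tau> R ^ i) + a R * h R) (generic g C)"
    proof (rule generic_form[OF bform_mult[OF Q0 1(2)] u])
      show "?Q0 u * B1 u \<noteq> 0" using Q0u 1 by simp
      fix x assume x: "nonz x" "?Q0 x * B1 x \<noteq> 0"
      then have nz: "B x \<noteq> 0" "\<mu> x \<noteq> 0" "A' x \<noteq> 0" "B1 x \<noteq> 0" by auto
      have "a (\<gamma> x) * h (\<gamma> x) = \<tau> (\<gamma> x) ^ m * (A2 x / B1 x)"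
        using aw[OF x(1) nz(1,2)] w0[OF x(1) nz(1,2,3)] rf_eval[OF 2(1) 1(2) x(1)] by (simp add: h_def)
      moreover have "f (\<gamma> x) = (\<Sum>i<m. c i * \<tau> (\<gamma> x) ^ i) + \<tau> (\<gamma> x) ^ m * (A2 x / B1 x)"
        using 1(4)[OF x(1) nz(4)] 2(2)[OF nz(2,4)] \<tau>x[OF x(1)] by simp
      ultimately show "f (\<gamma> x) = (\<Sum>i<m. c' i * \<tau> (\<gamma> x) ^ i) + a (\<gamma> x) * h (\<gamma> x)"
        by (simp add: c'_def)
    qed
    then have ex: "rat_eq g C f (\<lambda>R. (\<Sum>i<m. c' i * \<tau> R ^ i) + a R * h R)" by (simp add: rat_eq_iff)
    show "\<exists>!c. (\<forall>i\<ge>m. c i = 0) \<and> (\<exists>h. regular_at g C (\<gamma> u) h \<and>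
        rat_eq g C f (\<lambda>R. (\<Sum>i<m. c i * \<tau> R ^ i) + a R * h R))"
    proof (rule ex1I[of _ c'])
      show "(\<forall>i\<ge>m. c' i = 0) \<and> (\<exists>h. regular_at g C (\<gamma> u) h \<and>
        rat_eq g C f (\<lambda>R. (\<Sum>i<m. c' i * \<tau> R ^ i) + a R * h R))" using h ex by (auto simp: c'_def)
      fix e assume e: "(\<forall>i\<ge>m. e i = 0) \<and> (\<exists>h. regular_at g C (\<gamma> u) h \<and>
        rat_eq g C f (\<lambda>R. (\<Sum>i<m. e i * \<tau> R ^ i) + a R * h R))"
      then obtain h' where h': "regular_at g C (\<gamma> u) h'"
        "eventually (\<lambda>R. f R = (\<Sum>i<m. e i * \<tau> R ^ i) + a R * h' R) (generic g C)" by (auto simp: rat_eq_iff)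
      have "eventually (\<lambda>R. (\<Sum>i<m. (e i - c' i) * \<tau> R ^ i) = \<tau> R ^ m * (w R * (h R + (-1) * h' R))) (generic g C)"
        using h'(2) ex[unfolded rat_eq_iff] aw_ev
      proof eventually_elim
        case (elim R)
        have "(\<Sum>i<m. (e i - c' i) * \<tau> R ^ i) = (\<Sum>i<m. e i * \<tau> R ^ i) - (\<Sum>i<m. c' i * \<tau> R ^ i)"
          by (simp add: left_diff_distrib sum_subtractf)
        also have "\<dots> = a R * h R - a R * h' R" using elim by (simp add: algebra_simps)
        finally show ?case using elim by (simp add: algebra_simps)
      qed
      moreover have "regular_at g C (\<gamma> u) (\<lambda>R. w R * (h R + (-1) * h' R))"
        by (intro regular_mult regular_add regular_const w h h')
      ultimately have "\<forall>i<m. e i - c' i = 0"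
        unfolding \<tau>_def by (intro parameter_independent[OF u \<mu>])
      then show "e = c'" using e by (auto simp: fun_eq_iff c'_def)
    qed
  qed
qed

lemma rational_on_C:
  assumes "nonzero_rational g C f"
  shows "\<exists>n A B x. bform n A \<and> bform n B \<and> nonz x \<and> A x \<noteq> 0 \<and> B x \<noteq> 0 \<and>
    eventually (\<lambda>R. f R = rf A B R) (generic g C)"
proof -
  obtain d F G where q: "form g d F" "form g d G"
    "eventually (\<lambda>R. \<forall>z\<in>R. F z \<noteq> 0 \<and> G z \<noteq> 0 \<and> f R = F z / G z) (generic g C)"
    using assms by (auto simp: nonzero_rational_iff quotient_of_def)
  obtain n Q x where Q: "bform n Q" "nonz x" "Q x \<noteq> 0"
    "\<And>w. nonz w \<Longrightarrow> Q w \<noteq> 0 \<Longrightarrow> (\<forall>z\<in>\<gamma> w. F z \<noteq> 0 \<and> G z \<noteq> 0 \<and> f (\<gamma> w) = F z / G z)"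
    using q(3)[unfolded generic_iff] by blast
  let ?A = "\<lambda>x. F (\<lambda>k. \<phi> k x)" and ?B = "\<lambda>x. G (\<lambda>k. \<phi> k x)"
  note AB = pull_form[OF q(1)] pull_form[OF q(2)]
  have *: "?A w \<noteq> 0 \<and> ?B w \<noteq> 0 \<and> f (\<gamma> w) = ?A w / ?B w" if "nonz w" "Q w \<noteq> 0" for w
    using Q(4)[OF that] \<gamma>_mem by blast
  have "eventually (\<lambda>R. f R = rf ?A ?B R) (generic g C)"
    by (rule generic_form[OF Q(1-3)]) (use * rf_eval[OF AB] in auto)
  then show ?thesis using AB *[OF Q(2,3)] Q(2) by blast
qed

lemma rf_eq_imp_cross:
  assumes A: "bform n A" "bform n B" "B x0 \<noteq> 0" and A': "bform n' A'" "bform n' B'" "B' y0 \<noteq> 0"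
    and nz: "nonz x0" "nonz y0"
    and eq: "eventually (\<lambda>R. rf A B R = rf A' B' R) (generic g C)"
  shows "A x * B' x = A' x * B x"
proof -
  obtain l Q q where Q: "bform l Q" "nonz q" "Q q \<noteq> 0" "\<And>w. nonz w \<Longrightarrow> Q w \<noteq> 0 \<Longrightarrow> rf A B (\<gamma> w) = rf A' B' (\<gamma> w)"
    using eq unfolding generic_iff by blast
  obtain v where v: "nonz v" "B v \<noteq> 0" "B' v \<noteq> 0" using bform_common_nonzero[OF A(2) A'(2) nz(1) A(3) A'(3)] by blast
  have "bform (n + n') (\<lambda>x. B x * B' x)" by (intro bform_mult A A')
  moreover have "B v * B' v \<noteq> 0" using v by simp
  ultimately obtain v' where v': "nonz v'" "B v' * B' v' \<noteq> 0" "Q v' \<noteq> 0"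
    using bform_common_nonzero[of "n + n'" "\<lambda>x. B x * B' x" l Q v q] Q v by blast
  obtain j where j: "v' j \<noteq> 0" using v'(1) by blast
  show ?thesis
  proof (rule form_eq_if_generically_eq[where F = "\<lambda>x. A x * B' x" and G = "\<lambda>x. A' x * B x" and x = x
        and g = "\<lambda>_. ()" and d = "\<lambda>_. n + n'" and e = "\<lambda>_. ((n + n') + l) + 1"
        and Q = "\<lambda>x. ((B x * B' x) * Q x) * x j" and ?x0.0 = v'])
    show "bform (n + n') (\<lambda>x. A x * B' x)" by (intro bform_mult A A')
    show "bform (n + n') (\<lambda>x. A' x * B x)" using bform_mult[OF A'(1) A(2)] by (simp add: add.commute)
    show "bform (((n + n') + l) + 1) (\<lambda>x. ((B x * B' x) * Q x) * x j)" by (intro bform_mult A A' Q bform_var)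
    show "((B v' * B' v') * Q v') * v' j \<noteq> 0" using v' j by simp
    fix w assume w: "((B w * B' w) * Q w) * w j \<noteq> 0"
    then have "nonz w" using two_cases[of j] by auto
    then have "A w / B w = A' w / B' w" using Q(4)[of w] w rf_eval[OF A(1,2)] rf_eval[OF A'(1,2)] by simp
    then show "A w * B' w = A' w * B w" using w by (simp add: field_simps)
  qed
qed

lemma has_ord_vord:
  assumes u: "nonz u" and ord: "has_ord g C (\<gamma> u) f m"
    and A: "bform n A" "bform n B" "nonz x0" "A x0 \<noteq> 0" "B x0 \<noteq> 0"
    and f: "eventually (\<lambda>R. f R = rf A B R) (generic g C)"
  shows "m = int (vord u A) - int (vord u B)"
proof -
  obtain a b k l where q: "is_quotient_at g C (\<gamma> u) f a b" and
    kl: "colength g C (\<gamma> u) a k" "colength g C (\<gamma> u) b l" and m: "m = int k - int l"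
    using ord unfolding has_ord_def by blast
  have ra: "regular_at g C (\<gamma> u) a" and rb: "regular_at g C (\<gamma> u) b"
    using q by (auto simp: is_quotient_at_def)
  have ev: "eventually (\<lambda>R. a R \<noteq> 0 \<and> b R \<noteq> 0 \<and> f R = a R / b R) (generic g C)"
    by (rule is_quotient_atD[OF q \<gamma>_C[OF u]])
  obtain n1 A1 B1 where 1: "bform n1 A1" "bform n1 B1" "B1 u \<noteq> 0"
      "\<And>x. nonz x \<Longrightarrow> B1 x \<noteq> 0 \<Longrightarrow> a (\<gamma> x) = A1 x / B1 x"
    using regular_on_C[OF ra u] by blast
  obtain n2 A2 B2 where 2: "bform n2 A2" "bform n2 B2" "B2 u \<noteq> 0"
      "\<And>x. nonz x \<Longrightarrow> B2 x \<noteq> 0 \<Longrightarrow> b (\<gamma> x) = A2 x / B2 x"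
    using regular_on_C[OF rb u] by blast
  have eva: "eventually (\<lambda>R. a R = rf A1 B1 R) (generic g C)"
    by (rule generic_form[OF 1(2) u 1(3)]) (use 1(4) rf_eval[OF 1(1,2)] in auto)
  have evb: "eventually (\<lambda>R. b R = rf A2 B2 R) (generic g C)"
    by (rule generic_form[OF 2(2) u 2(3)]) (use 2(4) rf_eval[OF 2(1,2)] in auto)
  have "eventually (\<lambda>R. rf A1 B1 R \<noteq> 0 \<and> rf A2 B2 R \<noteq> 0 \<and> rf A B R = rf A1 B1 R / rf A2 B2 R) (generic g C)"
    using ev eva evb f by eventually_elim simp
  then obtain l' Q q where Q: "bform l' Q" "nonz q" "Q q \<noteq> 0" "\<And>w. nonz w \<Longrightarrow> Q w \<noteq> 0 \<Longrightarrow>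
      rf A1 B1 (\<gamma> w) \<noteq> 0 \<and> rf A2 B2 (\<gamma> w) \<noteq> 0 \<and> rf A B (\<gamma> w) = rf A1 B1 (\<gamma> w) / rf A2 B2 (\<gamma> w)"
    unfolding generic_iff by blast
  have qq: "A1 q \<noteq> 0" "A2 q \<noteq> 0"
    using Q(4)[OF Q(2,3)] rf_eval[OF 1(1,2) Q(2)] rf_eval[OF 2(1,2) Q(2)] by auto
  have BA: "bform (n1 + n2) (\<lambda>x. B1 x * A2 x)" and AB: "bform (n1 + n2) (\<lambda>x. A1 x * B2 x)"
    by (intro bform_mult 1 2)+
  have BAq: "B1 q * A2 q \<noteq> 0"
    using qq Q(4)[OF Q(2,3)] rf_eval[OF 1(1,2) Q(2)] by auto
  have ABq: "A1 q * B2 q \<noteq> 0"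
    using qq Q(4)[OF Q(2,3)] rf_eval[OF 2(1,2) Q(2)] by auto
  have cross: "A x * (B1 x * A2 x) = (A1 x * B2 x) * B x" for x
  proof (rule rf_eq_imp_cross[OF A(1,2,5) AB BA BAq A(3) Q(2)])
    show "eventually (\<lambda>R. rf A B R = rf (\<lambda>x. A1 x * B2 x) (\<lambda>x. B1 x * A2 x) R) (generic g C)"
      by (rule generic_form[OF Q(1,2,3)])
        (use Q(4) rf_eval[OF 1(1,2)] rf_eval[OF 2(1,2)] rf_eval[OF AB BA] in auto)
  qed
  have k: "k = vord u A1" by (rule colength_unique[OF \<gamma>_C[OF u] kl(1) colength_vord[OF u 1(1) qq(1) 1(2,3,4)]])
  have l: "l = vord u A2" by (rule colength_unique[OF \<gamma>_C[OF u] kl(2) colength_vord[OF u 2(1) qq(2) 2(2,3,4)]])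
  have "vord u (\<lambda>x. A x * (B1 x * A2 x)) = vord u A + (vord u B1 + vord u A2)"
    using vord_mult[OF u A(1,4) BA BAq] vord_mult[OF u 1(2,3) 2(1) qq(2)] by simp
  moreover have "vord u (\<lambda>x. (A1 x * B2 x) * B x) = (vord u A1 + vord u B2) + vord u B"
    using vord_mult[OF u AB ABq A(2,5)] vord_mult[OF u 1(1) qq(1) 2(2,3)] by simp
  moreover have "vord u B1 = 0" "vord u B2 = 0" using vord_0[OF u] 1 2 by blast+
  ultimately show ?thesis using cross by (simp add: m k l)
qed

text \<open>The order of a rational function, as a relation, computed with binary forms. It is multiplicative by the
  multiplicativity of \<^term>\<open>vord\<close>, without recourse to colengths.\<close>

definition ord_at :: "(2 \<Rightarrow> complex) \<Rightarrow> (('k \<Rightarrow> complex) set \<Rightarrow> complex) \<Rightarrow> int \<Rightarrow> bool" where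
  "ord_at u f m \<longleftrightarrow> (\<exists>n A B x. bform n A \<and> bform n B \<and> nonz x \<and> A x \<noteq> 0 \<and> B x \<noteq> 0 \<and>
     eventually (\<lambda>R. f R = rf A B R) (generic g C) \<and> m = int (vord u A) - int (vord u B))"

lemma ord_at_has_ord:
  assumes "nonz u" "has_ord g C (\<gamma> u) f k" "ord_at u f m"
  shows "k = m"
proof -
  obtain n A B x where *: "bform n A" "bform n B" "nonz x" "A x \<noteq> 0" "B x \<noteq> 0"
     "eventually (\<lambda>R. f R = rf A B R) (generic g C)" "m = int (vord u A) - int (vord u B)"
    using assms(3) unfolding ord_at_def by blast
  show ?thesis using has_ord_vord[OF assms(1,2) *(1-6)] *(7) by simp
qed

lemma ord_at_cong:
  assumes "ord_at u f m" "eventually (\<lambda>R. f R = h R) (generic g C)"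
  shows "ord_at u h m"
proof -
  obtain n A B x where *: "bform n A" "bform n B" "nonz x" "A x \<noteq> 0" "B x \<noteq> 0"
     "eventually (\<lambda>R. f R = rf A B R) (generic g C)" "m = int (vord u A) - int (vord u B)"
    using assms(1) unfolding ord_at_def by blast
  have "eventually (\<lambda>R. h R = rf A B R) (generic g C)" using assms(2) *(6) by eventually_elim simp
  then show ?thesis using * unfolding ord_at_def by blast
qed

lemma ord_at_nonzero:
  assumes "ord_at u f m" shows "eventually (\<lambda>R. f R \<noteq> 0) (generic g C)"
proof -
  obtain n A B x where *: "bform n A" "bform n B" "nonz x" "A x \<noteq> 0" "B x \<noteq> 0"
     "eventually (\<lambda>R. f R = rf A B R) (generic g C)"
    using assms(1) unfolding ord_at_def by blast
  have "eventually (\<lambda>R. rf A B R \<noteq> 0) (generic g C)"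
  proof (rule generic_form[OF bform_mult[OF *(1,2)] *(3)])
    show "A x * B x \<noteq> 0" using * by simp
    show "rf A B (\<gamma> w) \<noteq> 0" if "nonz w" "A w * B w \<noteq> 0" for w
      using rf_eval[OF *(1,2) that(1)] that(2) by simp
  qed
  then show ?thesis using *(6) by eventually_elim simp
qed

lemma ord_at_mult:
  assumes u: "nonz u" and "ord_at u f m" "ord_at u h k"
  shows "ord_at u (\<lambda>R. f R * h R) (m + k)"
proof -
  obtain n A B x where *: "bform n A" "bform n B" "nonz x" "A x \<noteq> 0" "B x \<noteq> 0"
     "eventually (\<lambda>R. f R = rf A B R) (generic g C)" "m = int (vord u A) - int (vord u B)"
    using assms(2) unfolding ord_at_def by blast
  obtain n' A' B' x' where **: "bform n' A'" "bform n' B'" "nonz x'" "A' x' \<noteq> 0" "B' x' \<noteq> 0"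
     "eventually (\<lambda>R. h R = rf A' B' R) (generic g C)" "k = int (vord u A') - int (vord u B')"
    using assms(3) unfolding ord_at_def by blast
  have AA: "bform (n + n') (\<lambda>x. A x * A' x)" "bform (n + n') (\<lambda>x. B x * B' x)"
    by (intro bform_mult * **)+
  have "(\<lambda>x. A x * B x) x \<noteq> 0" "(\<lambda>x. A' x * B' x) x' \<noteq> 0" using * ** by auto
  then obtain v where v: "nonz v" "A v * B v \<noteq> 0" "A' v * B' v \<noteq> 0"
    using bform_common_nonzero[OF bform_mult[OF *(1,2)] bform_mult[OF **(1,2)] *(3), of x'] by blast
  have "eventually (\<lambda>R. rf A B R * rf A' B' R = rf (\<lambda>x. A x * A' x) (\<lambda>x. B x * B' x) R) (generic g C)"
    by (rule generic_form[OF *(2,3,5)]) (simp add: rf_eval[OF *(1,2)] rf_eval[OF **(1,2)] rf_eval[OF AA])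
  then have ev: "eventually (\<lambda>R. f R * h R = rf (\<lambda>x. A x * A' x) (\<lambda>x. B x * B' x) R) (generic g C)"
    using *(6) **(6) by eventually_elim simp
  have "m + k = int (vord u (\<lambda>x. A x * A' x)) - int (vord u (\<lambda>x. B x * B' x))"
    unfolding vord_mult[OF u *(1,4) **(1,4)] vord_mult[OF u *(2,5) **(2,5)] using *(7) **(7) by simp
  then show ?thesis unfolding ord_at_def using AA v ev
    by (intro exI[of _ "n + n'"] exI[of _ "\<lambda>x. A x * A' x"] exI[of _ "\<lambda>x. B x * B' x"] exI[of _ v]) simp
qed

lemma ord_at_inverse:
  assumes "ord_at u f m" shows "ord_at u (\<lambda>R. 1 / f R) (- m)"
proof -
  obtain n A B x where *: "bform n A" "bform n B" "nonz x" "A x \<noteq> 0" "B x \<noteq> 0"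
     "eventually (\<lambda>R. f R = rf A B R) (generic g C)" "m = int (vord u A) - int (vord u B)"
    using assms unfolding ord_at_def by blast
  have "eventually (\<lambda>R. 1 / rf A B R = rf B A R) (generic g C)"
    by (rule generic_form[OF *(2,3,5)]) (simp add: rf_eval[OF *(1,2)] rf_eval[OF *(2,1)])
  then have "eventually (\<lambda>R. 1 / f R = rf B A R) (generic g C)" using *(6) by eventually_elim simp
  then show ?thesis using * unfolding ord_at_def by force
qed

lemma ord_at_one: "nonz u \<Longrightarrow> ord_at u (\<lambda>_. 1) 0"
proof -
  assume u: "nonz u"
  have 1: "bform 0 (\<lambda>_. 1)" using form.const[of "\<lambda>_. ()" 1] .
  have "eventually (\<lambda>R. 1 = rf (\<lambda>_. 1) (\<lambda>_. 1) R) (generic g C)"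
    by (rule generic_form[OF 1 u]) (simp_all add: rf_eval[OF 1 1])
  then show ?thesis unfolding ord_at_def using 1 u
    by (intro exI[of _ 0] exI[of _ "\<lambda>_. 1"] exI[of _ u]) simp
qed

lemma ord_at_power: "nonz u \<Longrightarrow> ord_at u f m \<Longrightarrow> ord_at u (\<lambda>R. f R ^ n) (int n * m)"
proof (induction n)
  case (Suc n)
  then show ?case using ord_at_mult[of u f m "\<lambda>R. f R ^ n" "int n * m"] by (simp add: algebra_simps)
qed (simp add: ord_at_one)

lemma ord_at_power_int:
  assumes "nonz u" "ord_at u f m" shows "ord_at u (\<lambda>R. f R powi n) (n * m)"
proof (cases "n \<ge> 0")
  case True
  then show ?thesis using ord_at_power[OF assms, of "nat n"] by (simp add: power_int_def)
next
  case False
  then show ?thesis using ord_at_inverse[OF ord_at_power[OF assms, of "nat (- n)"]]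
    by (simp add: power_int_def power_one_over inverse_eq_divide)
qed

lemma ord_at_prod:
  "finite I \<Longrightarrow> nonz u \<Longrightarrow> (\<And>i. i \<in> I \<Longrightarrow> ord_at u (f i) (m i)) \<Longrightarrow>
    ord_at u (\<lambda>R. \<Prod>i\<in>I. f i R) (\<Sum>i\<in>I. m i)"
proof (induction I rule: finite_induct)
  case (insert i I)
  then show ?case using ord_at_mult[of u "f i" "m i"] by simp
qed (simp add: ord_at_one)

lemma ord_at_regular:
  assumes u: "nonz u" and f: "regular_at g C (\<gamma> u) f" and nz: "eventually (\<lambda>R. f R \<noteq> 0) (generic g C)"
  shows "\<exists>m\<ge>0. ord_at u f m" "f (\<gamma> u) \<noteq> 0 \<Longrightarrow> ord_at u f 0"
proof -
  obtain n A B where AB: "bform n A" "bform n B" "B u \<noteq> 0" "\<And>x. nonz x \<Longrightarrow> B x \<noteq> 0 \<Longrightarrow> f (\<gamma> x) = A x / B x"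
    using regular_on_C[OF f u] by blast
  have ev: "eventually (\<lambda>R. f R = rf A B R) (generic g C)"
    by (rule generic_form[OF AB(2) u AB(3)]) (simp add: AB(4) rf_eval[OF AB(1,2)])
  have "eventually (\<lambda>R. rf A B R \<noteq> 0) (generic g C)" using nz ev by eventually_elim simp
  then obtain l Q q where "bform l Q" "nonz q" "Q q \<noteq> 0" "\<And>w. nonz w \<Longrightarrow> Q w \<noteq> 0 \<Longrightarrow> rf A B (\<gamma> w) \<noteq> 0"
    unfolding generic_iff by blast
  then have q: "nonz q" "A q \<noteq> 0" "B q \<noteq> 0" using rf_eval[OF AB(1,2)] by auto
  have ord: "ord_at u f (int (vord u A))"
    unfolding ord_at_def using AB q ev vord_0[OF u AB(2,3)]
    by (intro exI[of _ n] exI[of _ A] exI[of _ B] exI[of _ q]) simp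
  then show "\<exists>m\<ge>0. ord_at u f m" by (intro exI[of _ "int (vord u A)"]) simp
  assume "f (\<gamma> u) \<noteq> 0"
  then have "A u \<noteq> 0" using AB(4)[OF u AB(3)] by auto
  then show "ord_at u f 0" using ord vord_0[OF u AB(1)] by simp
qed

lemma ord_at_ratio:
  assumes u: "nonz u" and F: "form g d F" and G: "form g d G" "\<forall>z\<in>\<gamma> u. G z \<noteq> 0" and nz: "F (\<lambda>k. \<phi> k w) \<noteq> 0"
  shows "ord_at u (ratio F G) (int (vord u (\<lambda>x. F (\<lambda>k. \<phi> k x))))"
proof -
  let ?A = "\<lambda>x. F (\<lambda>k. \<phi> k x)" and ?B = "\<lambda>x. G (\<lambda>k. \<phi> k x)"
  note AB = pull_form[OF F] pull_form[OF G(1)]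
  have Bu: "?B u \<noteq> 0" using G(2) \<gamma>_mem by blast
  have ev: "eventually (\<lambda>R. ratio F G R = rf ?A ?B R) (generic g C)"
    by (rule generic_form[OF AB(2) u Bu]) (simp add: rf_eval[OF AB] ratio_eval[OF F G(1) \<gamma>_mproj \<gamma>_mem])
  obtain v where v: "nonz v" "?B v \<noteq> 0" "?A v \<noteq> 0" using bform_common_nonzero[OF AB(2,1) u Bu nz] by blast
  show ?thesis unfolding ord_at_def using AB v ev vord_0[OF u AB(2) Bu]
    by (intro exI[of _ "\<Sum>b\<in>UNIV. d b * \<delta> b"] exI[of _ ?A] exI[of _ ?B] exI[of _ v]) simp
qed

lemma ord_at_rational:
  assumes "nonzero_rational g C f" shows "\<exists>m. ord_at u f m"
  using rational_on_C[OF assms] unfolding ord_at_def by blast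

lemma ord_at_represented:
  assumes "ord_at u f m"
  shows "\<exists>n A B x. bform n A \<and> bform n B \<and> A x \<noteq> 0 \<and> B x \<noteq> 0 \<and>
     (\<forall>w. ord_at w f (int (vord w A) - int (vord w B)))"
  using assms unfolding ord_at_def by blast

text \<open>A choice of coordinates on the projective line for the points of the curve.\<close>

definition pt :: "('k \<Rightarrow> complex) set \<Rightarrow> (2 \<Rightarrow> complex)" where
  "pt P = (SOME u. nonz u \<and> \<gamma> u = P)"

lemma pt:
  assumes "P \<in> C" shows "nonz (pt P) \<and> \<gamma> (pt P) = P"
proof -
  have "\<exists>u. nonz u \<and> \<gamma> u = P" using assms by (auto simp: C_def)
  then show ?thesis unfolding pt_def by (rule someI_ex)
qed

lemma sum_vord_pt:
  assumes F: "bform n F" "F x0 \<noteq> 0" and Z: "finite Z" "Z \<subseteq> C" "\<And>P. P \<in> C \<Longrightarrow> F (pt P) = 0 \<Longrightarrow> P \<in> Z"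
  shows "(\<Sum>P\<in>Z. vord (pt P) F) = n"
proof -
  have inj: "inj_on pt Z" using pt Z(2) by (intro inj_onI) (metis subsetD)
  have "(\<Sum>P\<in>Z. vord (pt P) F) = (\<Sum>u\<in>pt ` Z. vord u F)" using sum.reindex[OF inj, of "\<lambda>u. vord u F"] by simp
  also have "\<dots> = n"
  proof (rule sum_vord[OF F])
    show "finite (pt ` Z)" using Z by simp
    show "nonz u" if "u \<in> pt ` Z" for u using that pt Z by blast
    show "u = w" if u: "u \<in> pt ` Z" and w: "w \<in> pt ` Z" and l: "lin u w = 0" for u w
    proof -
      obtain P P' where P: "P \<in> Z" "u = pt P" "P' \<in> Z" "w = pt P'" using u w by blast
      then have "\<gamma> u = P" "\<gamma> w = P'" "nonz u" "nonz w" using pt Z(2) by blast+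
      then show ?thesis using l \<gamma>_eq_iff P by metis
    qed
    show "\<exists>u\<in>pt ` Z. lin u w = 0" if w: "nonz w" "F w = 0" for w
    proof -
      have P: "nonz (pt (\<gamma> w))" "\<gamma> (pt (\<gamma> w)) = \<gamma> w" using pt \<gamma>_C[OF w(1)] by blast+
      then have l: "lin w (pt (\<gamma> w)) = 0" using \<gamma>_eq_iff[OF w(1) P(1)] by simp
      then obtain c where "c \<noteq> 0" "pt (\<gamma> w) = (\<lambda>j. c * w j)" using lin_zero_scale[OF w(1) P(1)] by blast
      then have "F (pt (\<gamma> w)) = 0" using form_scale[OF F(1), of "\<lambda>_. c" w] w(2) by simp
      then have "\<gamma> w \<in> Z" using Z(3)[OF \<gamma>_C[OF w(1)]] by blast
      then show ?thesis using l lin_sym by blast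
    qed
  qed
  finally show ?thesis .
qed

lemma finite_zeros:
  assumes F: "bform n F" "F x0 \<noteq> 0"
  shows "finite {P \<in> C. F (pt P) = 0}"
proof -
  obtain c us where us: "c \<noteq> 0" "\<forall>u\<in>set us. nonz u" "\<forall>x. F x = c * (\<Prod>u\<leftarrow>us. lin u x)"
    using bform_factorization[OF F] by blast
  have "{P \<in> C. F (pt P) = 0} \<subseteq> \<gamma> ` set us"
  proof
    fix P assume P: "P \<in> {P \<in> C. F (pt P) = 0}"
    then have w: "nonz (pt P)" "\<gamma> (pt P) = P" using pt by blast+
    obtain u where u: "u \<in> set us" "lin u (pt P) = 0" using P us by (auto simp: prod_list_zero_iff)
    then have "nonz u" using us by blast
    then have "P = \<gamma> u" using w u \<gamma>_eq_iff[of u "pt P"] by blast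
    then show "P \<in> \<gamma> ` set us" using u by blast
  qed
  then show ?thesis by (rule finite_subset) simp
qed

end

section \<open>The blowup and its exceptional divisors\<close>

lemma form_pullback_base:
  assumes "form yfac d F"
  shows "form afac (\<lambda>b. case b of Inl b' \<Rightarrow> d b' | Inr _ \<Rightarrow> 0) (\<lambda>z. F (z \<circ> Base))"
proof -
  have "form afac (\<lambda>b'. \<Sum>b\<in>UNIV. d b * (if b' = Inl b then 1 else 0)) (\<lambda>z. F (\<lambda>k. z (Base k)))"
    by (rule form_subst[OF assms, where \<phi> = "\<lambda>k z. z (Base k)"]) (rule form_var', simp)
  moreover have "(\<lambda>b'. \<Sum>b\<in>UNIV. d b * (if b' = Inl b then 1 else 0)) = (\<lambda>b. case b of Inl b' \<Rightarrow> d b' | Inr _ \<Rightarrow> 0)"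
    by (auto simp: fun_eq_iff if_distrib[of "\<lambda>x. _ * x"] split: sum.split cong: if_cong)
  ultimately show ?thesis unfolding comp_def by (rule form_degree_cong)
qed

lemma form_segre: "form yfac (\<lambda>_. 1) (\<lambda>z. segre z r)"
proof (cases r)
  case (Pair j k)
  have "form yfac (\<lambda>_. 1) (\<lambda>z. z (XVar j) * z (YVar k))"
    by (rule form_mult'[OF form.var form.var]) (metis (full_types) add.commute add.right_neutral factor.exhaust factor.distinct(1) yfac.simps)
  then show ?thesis by (simp add: segre_def Pair)
qed

lemma form_minor: "form yfac (\<lambda>_. 1) (\<lambda>z. minor a z r s)"
  unfolding minor_def using form_diff[OF form_cmult[OF form_segre[of r], of "segre a s"] form_cmult[OF form_segre[of s], of "segre a r"]]
  by (simp add: mult.commute)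

lemma coords_yfac_iff: "coords yfac z \<longleftrightarrow> (\<exists>j. z (XVar j) \<noteq> 0) \<and> (\<exists>k. z (YVar k) \<noteq> 0)"
proof
  assume *: "coords yfac z"
  then obtain v where "yfac v = FacP1" "z v \<noteq> 0" unfolding coords_def by blast
  then have x: "\<exists>j. z (XVar j) \<noteq> 0" by (cases v) auto
  obtain v where "yfac v = FacP3" "z v \<noteq> 0" using * unfolding coords_def by blast
  then have "\<exists>j. z (YVar j) \<noteq> 0" by (cases v) auto
  with x show "(\<exists>j. z (XVar j) \<noteq> 0) \<and> (\<exists>k. z (YVar k) \<noteq> 0)" by blast
next
  assume "(\<exists>j. z (XVar j) \<noteq> 0) \<and> (\<exists>k. z (YVar k) \<noteq> 0)"
  then obtain j k where jk: "z (XVar j) \<noteq> 0" "z (YVar k) \<noteq> 0" by blast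
  show "coords yfac z" unfolding coords_def
  proof
    fix b show "\<exists>v. yfac v = b \<and> z v \<noteq> 0"
    proof (cases b)
      case FacP1 then show ?thesis using jk by (intro exI[of _ "XVar j"]) simp
    next
      case FacP3 then show ?thesis using jk by (intro exI[of _ "YVar k"]) simp
    qed
  qed
qed

lemma coords_segre: "coords yfac z \<Longrightarrow> \<exists>r. segre z r \<noteq> 0"
  unfolding coords_yfac_iff segre_def by (metis (mono_tags, lifting) case_prod_conv mult_eq_0_iff)

lemma segre_coords: "segre z r \<noteq> 0 \<Longrightarrow> coords yfac z"
  by (cases r) (auto simp: coords_yfac_iff segre_def)

lemma minor_coords: "minor a z r s \<noteq> 0 \<Longrightarrow> coords yfac z"
  using segre_coords[of z r] segre_coords[of z s] unfolding minor_def by fastforce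

lemma segre_scale: "segre (\<lambda>v. c (yfac v) * z v) r = c FacP1 * c FacP3 * segre z r"
  by (cases r) (simp add: segre_def)

lemma minor_scale: "minor (\<lambda>v. c (yfac v) * a v) z r s = c FacP1 * c FacP3 * minor a z r s"
  by (simp add: minor_def segre_scale right_diff_distrib)

lemma minor_self: "z \<in> mpoint yfac a \<Longrightarrow> minor a z r s = 0"
  by (auto elim!: mpointE simp: minor_def segre_scale)

text \<open>If all minors vanish, the Segre coordinates of the two points are proportional.\<close>

lemma minors_zero_imp:
  assumes z: "coords yfac z" and a: "coords yfac a" and zero: "\<And>r s. minor a z r s = 0"
  shows "z \<in> mpoint yfac a"
proof -
  obtain s0 where s0: "segre a s0 \<noteq> 0" using coords_segre[OF a] by blast
  define t where "t = segre z s0 / segre a s0"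
  have seg: "segre z r = t * segre a r" for r
    using zero[of r s0] s0 by (simp add: minor_def t_def field_simps)
  have xy: "z (XVar j) * z (YVar k) = t * (a (XVar j) * a (YVar k))" for j k
    using seg[of "(j, k)"] by (simp add: segre_def)
  obtain j0 k0 where 0: "z (XVar j0) \<noteq> 0" "z (YVar k0) \<noteq> 0" using z by (auto simp: coords_yfac_iff)
  show ?thesis
  proof (rule mpoint_proportional[OF z a])
    fix k l assume kl: "yfac k = yfac l"
    show "z k * a l = z l * a k"
    proof (cases k)
      case k: (XVar j)
      then obtain j' where l: "l = XVar j'" using kl by (cases l) auto
      have "z (XVar j) * z (YVar k0) * a (XVar j') = z (XVar j') * z (YVar k0) * a (XVar j)"
        unfolding xy by simp
      then show ?thesis using 0 k l by simp
    next
      case k: (YVar j)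
      then obtain j' where l: "l = YVar j'" using kl by (cases l) auto
      have "z (XVar j0) * z (YVar j) * a (YVar j') = z (XVar j0) * z (YVar j') * a (YVar j)"
        unfolding xy by simp
      then show ?thesis using 0 k l by simp
    qed
  qed
qed

text \<open>Distinctness of the images in the projective line implies that the four points are distinct.\<close>

locale four_points =
  fixes a :: "4 \<Rightarrow> yvar \<Rightarrow> complex"
  assumes a_coords: "\<And>i. coords yfac (a i)"
    and x_distinct: "\<And>i j. i \<noteq> j \<Longrightarrow> a i (XVar 0) * a j (XVar 1) \<noteq> a i (XVar 1) * a j (XVar 0)"
begin

definition p :: "4 \<Rightarrow> ypoint" where "p i = mpoint yfac (a i)"

text \<open>The components of the rational map whose graph has the blowup as its closure, as functions of the base point.\<close>

definition gcoord :: "avar \<Rightarrow> (yvar \<Rightarrow> complex) \<Rightarrow> complex" where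
  "gcoord k z = case_avar z (\<lambda>i. minor (a i) z) k"

definition graph :: "(yvar \<Rightarrow> complex) \<Rightarrow> apoint" where
  "graph z = mpoint afac (\<lambda>k. gcoord k z)"

text \<open>The coordinate vectors of the points where the rational map is defined.\<close>

definition valid :: "(yvar \<Rightarrow> complex) \<Rightarrow> bool" where
  "valid z \<longleftrightarrow> coords yfac z \<and> (\<forall>i. z \<notin> p i)"

abbreviation S :: "apoint set" where "S \<equiv> blowup p"

lemma gcoord_simps [simp]: "gcoord (Base v) z = z v" "gcoord (Dir i r s) z = minor (a i) z r s"
  by (simp_all add: gcoord_def)

lemma gcoord_base: "(\<lambda>k. gcoord k z) \<circ> Base = z"
  by (simp add: comp_def)

lemma p_disjoint: "z \<in> p i \<Longrightarrow> z \<in> p j \<Longrightarrow> i = j"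
proof (rule ccontr)
  assume z: "z \<in> p i" "z \<in> p j" and "i \<noteq> j"
  have "z \<in> mpoint yfac (a i)" "mpoint yfac (a i) = mpoint yfac (a j)"
    using z mpoint_eqI[of z yfac "a i"] mpoint_eqI[of z yfac "a j"] unfolding p_def by simp_all
  then have "a i \<in> mpoint yfac (a j)" by (metis mpoint_refl)
  from mpoint_proportional_rev[OF this, of "XVar 0" "XVar 1"] x_distinct[OF \<open>i \<noteq> j\<close>]
  show False by simp
qed

lemma valid_minor: "valid z \<Longrightarrow> \<exists>r s. minor (a i) z r s \<noteq> 0"
  using minors_zero_imp[OF _ a_coords] unfolding valid_def p_def by blast

text \<open>A product of one nonvanishing minor for each of the points: where it does not vanish, the map is defined.\<close>

lemma valid_form:
  assumes "valid z"
  shows "\<exists>d V. form yfac d V \<and> V z \<noteq> 0 \<and> (\<forall>w. V w \<noteq> 0 \<longrightarrow> valid w)"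
proof -
  obtain r s where rs: "\<And>i. minor (a i) z (r i) (s i) \<noteq> 0" using valid_minor[OF assms] by metis
  let ?V = "\<lambda>z. \<Prod>i\<in>UNIV. minor (a i) z (r i) (s i)"
  have "form yfac (\<lambda>b. \<Sum>i\<in>(UNIV::4 set). 1) ?V" by (intro form_prod form_minor) auto
  moreover have "?V z \<noteq> 0" using rs by simp
  moreover have "valid w" if "?V w \<noteq> 0" for w
  proof -
    have nz: "minor (a i) w (r i) (s i) \<noteq> 0" for i using that by simp
    then have "w \<notin> p i" for i using minor_self[of w "a i"] unfolding p_def by blast
    then show ?thesis using minor_coords[OF nz] by (simp add: valid_def)
  qed
  ultimately show ?thesis by blast
qed

lemma valid_common:
  assumes "valid z" "form yfac d F" "F z1 \<noteq> 0" "form yfac e G" "G z2 \<noteq> 0"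
  shows "\<exists>w. valid w \<and> F w \<noteq> 0 \<and> G w \<noteq> 0"
proof -
  obtain d' V where V: "form yfac d' V" "V z \<noteq> 0" "\<And>w. V w \<noteq> 0 \<Longrightarrow> valid w" using valid_form[OF assms(1)] by blast
  obtain w where "F w \<noteq> 0" "G w \<noteq> 0" using form_common_nonzero[OF assms(2,4), of z1 z2] assms(3,5) by blast
  then have FG: "(\<lambda>w. F w * G w) w \<noteq> 0" by simp
  obtain w' where "F w' * G w' \<noteq> 0" "V w' \<noteq> 0"
    using form_common_nonzero[where F = "\<lambda>w. F w * G w" and G = V, OF form.mult[OF assms(2,4)] V(1) FG V(2)] by auto
  then show ?thesis using V(3) by auto
qed

lemma ex_valid: "\<exists>z. valid z"
proof -
  define i0 i1 :: 4 where "i0 = 0" and "i1 = 1"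
  have ne: "i0 \<noteq> i1" by (simp add: i0_def i1_def)
  define L where "L = (\<lambda>i z. z (XVar 0) * a i (XVar 1) - z (XVar 1) * a i (XVar 0))"
  have L: "form yfac (\<lambda>b. if b = FacP1 then 1 else 0) (L i)" for i
    unfolding L_def using form_diff[OF form_cmult[OF form_var', of _ yfac "XVar 0" "a i (XVar 1)"] form_cmult[OF form_var', of _ yfac "XVar 1" "a i (XVar 0)"]]
    by (simp add: mult.commute)
  have LP: "form yfac (\<lambda>b. \<Sum>i\<in>I. if b = FacP1 then 1 else 0) (\<lambda>z. \<Prod>i\<in>I. L i z)" if "finite I" for I
    by (rule form_prod[OF that L])
  have prod: "\<exists>z. (\<Prod>i\<in>I. L i z) \<noteq> 0" if "finite I" for I
    using that
  proof (induction I rule: finite_induct)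
    case (insert i I)
    then obtain z where z: "(\<Prod>i\<in>I. L i z) \<noteq> 0" by blast
    define j where "j = (if i = i0 then i1 else i0)"
    have "j \<noteq> i" using ne by (auto simp: j_def)
    then have "L i (a j) \<noteq> 0" using x_distinct[of j i] by (simp add: L_def)
    from form_common_nonzero[where F = "L i" and G = "\<lambda>z. \<Prod>i\<in>I. L i z", OF L LP[OF insert.hyps(1)] this z]
    show ?case using insert.hyps by auto
  qed simp
  then obtain z where z: "(\<Prod>i\<in>UNIV. L i z) \<noteq> 0" using finite by blast
  obtain k where k: "a 0 (YVar k) \<noteq> 0" using a_coords[of 0] by (auto simp: coords_yfac_iff)
  obtain w where w: "(\<Prod>i\<in>UNIV. L i w) \<noteq> 0" "w (YVar k) \<noteq> 0"
    using form_common_nonzero[where F = "\<lambda>z. \<Prod>i\<in>UNIV. L i z" and G = "\<lambda>z. z (YVar k)"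
        and z = z and w = "a 0", OF LP[of UNIV, OF finite] form.var[of yfac "YVar k"] z k] by blast
  have Lw: "L i w \<noteq> 0" for i using w by simp
  have "w \<notin> p i" for i
  proof
    assume "w \<in> p i"
    from mpoint_proportional_rev[OF this[unfolded p_def], of "XVar 0" "XVar 1"] Lw[of i] show False by (simp add: L_def)
  qed
  moreover have "w (XVar 0) \<noteq> 0 \<or> w (XVar 1) \<noteq> 0" using Lw[of 0] by (auto simp: L_def)
  then have "coords yfac w" using w(2) unfolding coords_yfac_iff by blast
  ultimately show ?thesis by (auto simp: valid_def)
qed

lemma gcoord_coords:
  assumes "valid z" shows "coords afac (\<lambda>k. gcoord k z)"
  unfolding coords_def
proof
  fix b show "\<exists>k. afac k = b \<and> gcoord k z \<noteq> 0"
  proof (cases b)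
    case (Inl c)
    then obtain v where "yfac v = c" "z v \<noteq> 0" using assms unfolding valid_def coords_def by blast
    then show ?thesis using Inl by (intro exI[of _ "Base v"]) simp
  next
    case (Inr i)
    then obtain r s where "minor (a i) z r s \<noteq> 0" using valid_minor[OF assms] by blast
    then show ?thesis using Inr by (intro exI[of _ "Dir i r s"]) simp
  qed
qed

lemma graph_mproj: "valid z \<Longrightarrow> graph z \<in> mproj afac"
  unfolding graph_def by (intro mpoint_in_mproj gcoord_coords)

lemma form_gcoord:
  assumes "form afac d F" shows "\<exists>e. form yfac e (\<lambda>z. F (\<lambda>k. gcoord k z))"
proof -
  let ?\<delta> = "\<lambda>(b :: factor + 4) b'. case b of Inl c \<Rightarrow> (if b' = c then 1 else 0) | Inr i \<Rightarrow> (1 :: nat)"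
  have "form yfac (?\<delta> (afac k)) (gcoord k)" for k
  proof (cases k)
    case (Base v)
    have "form yfac (?\<delta> (afac (Base v))) (\<lambda>z. z v)" by (rule form_var') simp
    then show ?thesis by (simp add: Base gcoord_def[abs_def])
  next
    case (Dir i r s)
    then show ?thesis using form_minor[of "a i" r s] by (simp add: gcoord_def[abs_def])
  qed
  from form_subst[OF assms, of yfac ?\<delta> gcoord, OF this] show ?thesis by blast
qed

text \<open>The choice of the coordinates of the blown-up points only rescales the minors, so they can be fixed.\<close>

lemma blowup_eq: "S = zariski afac closure_of (graph ` {z. valid z})"
proof -
  have "{mpoint afac (case_avar z (\<lambda>i. minor (b i) z)) | z b.
        mpoint yfac z \<in> mproj yfac \<and> (\<forall>i. b i \<in> p i \<and> z \<notin> p i)} = graph ` {z. valid z}" (is "?L = ?R")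
  proof (intro equalityI subsetI)
    fix P assume "P \<in> ?L"
    then obtain z b where P: "P = mpoint afac (case_avar z (\<lambda>i. minor (b i) z))"
      and z: "mpoint yfac z \<in> mproj yfac" "\<And>i. b i \<in> p i" "\<And>i. z \<notin> p i" by blast
    have v: "valid z" using mproj_coords[OF z(1)] z(3) by (simp add: valid_def)
    have "\<exists>c. (\<forall>b. c b \<noteq> 0) \<and> b i = (\<lambda>v. c (yfac v) * a i v)" for i
      using z(2)[of i] by (auto simp: p_def mpoint_def)
    then obtain c where c: "\<And>i b. c i b \<noteq> 0" "\<And>i. b i = (\<lambda>v. c i (yfac v) * a i v)" by metis
    define e where "e = (\<lambda>b :: factor + 4. case b of Inl _ \<Rightarrow> 1 | Inr i \<Rightarrow> c i FacP1 * c i FacP3)"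
    have "case_avar z (\<lambda>i. minor (b i) z) = (\<lambda>k. e (afac k) * gcoord k z)"
    proof
      fix k show "case_avar z (\<lambda>i. minor (b i) z) k = e (afac k) * gcoord k z"
        unfolding c(2) by (cases k) (simp_all add: e_def minor_scale)
    qed
    moreover have "e b \<noteq> 0" for b using c by (auto simp: e_def split: sum.split)
    ultimately have "case_avar z (\<lambda>i. minor (b i) z) \<in> mpoint afac (\<lambda>k. gcoord k z)"
      by (intro mpointI[of e])
    then have "P = graph z" unfolding P graph_def by (rule mpoint_eqI)
    then show "P \<in> ?R" using v by blast
  next
    fix P assume "P \<in> ?R"
    then obtain z where z: "valid z" "P = graph z" by blast
    have "P = mpoint afac (case_avar z (\<lambda>i. minor (a i) z))"
      unfolding z graph_def gcoord_def ..
    then show "P \<in> ?L" using z mpoint_in_mproj[of yfac z]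
      by (auto simp: valid_def p_def intro!: exI[of _ z] exI[of _ a])
  qed
  then show ?thesis unfolding blowup_def by simp
qed

lemma S_mproj: "S \<subseteq> mproj afac"
  unfolding blowup_eq using closure_of_subset_topspace[of "zariski afac"] by simp

lemma graph_in_S: "valid z \<Longrightarrow> graph z \<in> S"
proof -
  have "graph ` {z. valid z} \<subseteq> S"
    unfolding blowup_eq using graph_mproj by (intro closure_of_subset) auto
  then show "valid z \<Longrightarrow> graph z \<in> S" by blast
qed

lemma S_open:
  assumes "openin (zariski afac) U" "P \<in> U" "P \<in> S"
  shows "\<exists>z. valid z \<and> graph z \<in> U"
  using assms unfolding blowup_eq in_closure_of by blast

lemma graph_mem: "(\<lambda>k. gcoord k z) \<in> graph z"
  by (simp add: graph_def)

lemma S_open_form: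
  assumes "openin (zariski afac) U" "valid z" "graph z \<in> U"
  shows "\<exists>d V. form yfac d V \<and> V z \<noteq> 0 \<and> (\<forall>w. valid w \<longrightarrow> V w \<noteq> 0 \<longrightarrow> graph w \<in> U)"
proof -
  obtain d F where F: "form afac d F" "graph z \<in> nonvanishing afac F" "nonvanishing afac F \<subseteq> U"
    using openin_zariski_basic[OF assms(1,3)] by blast
  obtain e where e: "form yfac e (\<lambda>z. F (\<lambda>k. gcoord k z))" using form_gcoord[OF F(1)] by blast
  have iff: "graph w \<in> nonvanishing afac F \<longleftrightarrow> F (\<lambda>k. gcoord k w) \<noteq> 0" if "valid w" for w
    by (rule nonvanishing_iff(1)[OF F(1) graph_mproj[OF that] graph_mem])
  show ?thesis using e iff F assms(2) by (intro exI[of _ e] exI[of _ "\<lambda>z. F (\<lambda>k. gcoord k z)"]) auto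
qed

sublocale irreducible_subset afac S
proof
  show "S \<subseteq> mproj afac" by (rule S_mproj)
  show "S \<noteq> {}" using graph_in_S ex_valid by blast
  fix U V assume U: "openin (zariski afac) U" "U \<inter> S \<noteq> {}" and V: "openin (zariski afac) V" "V \<inter> S \<noteq> {}"
  obtain z1 z2 where z: "valid z1" "graph z1 \<in> U" "valid z2" "graph z2 \<in> V"
    using S_open[OF U(1)] S_open[OF V(1)] U(2) V(2) by blast
  obtain d F where F: "form yfac d F" "F z1 \<noteq> 0" "\<And>w. valid w \<Longrightarrow> F w \<noteq> 0 \<Longrightarrow> graph w \<in> U"
    using S_open_form[OF U(1) z(1,2)] by blast
  obtain e G where G: "form yfac e G" "G z2 \<noteq> 0" "\<And>w. valid w \<Longrightarrow> G w \<noteq> 0 \<Longrightarrow> graph w \<in> V"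
    using S_open_form[OF V(1) z(3,4)] by blast
  obtain w where "valid w" "F w \<noteq> 0" "G w \<noteq> 0" using valid_common[OF z(1) F(1,2) G(1,2)] by blast
  then have "graph w \<in> U \<inter> V \<inter> S" using F G graph_in_S by blast
  then show "U \<inter> V \<inter> S \<noteq> {}" by blast
qed

text \<open>Polynomial relations which hold on the graph extend to its closure.\<close>

lemma S_relation:
  assumes F: "form afac d F" and zero: "\<And>z. valid z \<Longrightarrow> F (\<lambda>k. gcoord k z) = 0"
    and R: "R \<in> S" "z \<in> R"
  shows "F z = 0"
proof (rule ccontr)
  assume "F z \<noteq> 0"
  then have "R \<in> nonvanishing afac F" using nonvanishing_iff(1)[OF F in_mproj[OF R(1)] R(2)] by blast
  then obtain w where w: "valid w" "graph w \<in> nonvanishing afac F"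
    using S_open[OF openin_nonvanishing[OF F] _ R(1)] by blast
  then show False using zero graph_mem[of w] by (auto simp: nonvanishing_def)
qed

lemma dir_minor:
  assumes "R \<in> S" "z \<in> R"
  shows "z (Dir i r s) * minor (a i) (z \<circ> Base) r' s' = z (Dir i r' s') * minor (a i) (z \<circ> Base) r s"
proof -
  let ?d = "\<lambda>b. (if b = Inr i then 1 else 0) + (case b of Inl b' \<Rightarrow> 1 | Inr _ \<Rightarrow> 0)"
  have 1: "form afac ?d (\<lambda>z. z (Dir i r s) * minor (a i) (z \<circ> Base) r' s')" for r s r' s'
    by (rule form_mult'[OF form.var form_pullback_base[OF form_minor]]) simp
  have "z (Dir i r s) * minor (a i) (z \<circ> Base) r' s' - z (Dir i r' s') * minor (a i) (z \<circ> Base) r s = 0"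
    by (rule S_relation[OF form_diff[OF 1 1] _ assms]) (simp add: gcoord_base)
  then show ?thesis by simp
qed

lemma base_coords: "R \<in> S \<Longrightarrow> z \<in> R \<Longrightarrow> coords yfac (z \<circ> Base)"
proof -
  assume "R \<in> S" "z \<in> R"
  then have c: "coords afac z" using mproj_coords[OF in_mproj] by blast
  show ?thesis unfolding coords_def
  proof
    fix b
    obtain k where k: "afac k = Inl b" "z k \<noteq> 0" using c unfolding coords_def by blast
    then obtain v where "k = Base v" by (cases k) auto
    then show "\<exists>k. yfac k = b \<and> (z \<circ> Base) k \<noteq> 0" using k by (intro exI[of _ v]) simp
  qed
qed

lemma dir_nonzero: "R \<in> S \<Longrightarrow> z \<in> R \<Longrightarrow> \<exists>r s. z (Dir i r s) \<noteq> 0"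
proof -
  assume "R \<in> S" "z \<in> R"
  then have c: "coords afac z" using mproj_coords[OF in_mproj] by blast
  obtain k where k: "afac k = Inr i" "z k \<noteq> 0" using c unfolding coords_def by blast
  then show ?thesis by (cases k) auto
qed

lemma generic_base_nonzero:
  assumes "form yfac d F" "F z0 \<noteq> 0"
  shows "eventually (\<lambda>R. \<forall>z\<in>R. F (z \<circ> Base) \<noteq> 0) (generic afac S)"
proof (rule near_nonzero_imp_generic[OF form_pullback_base[OF assms(1)]])
  obtain z where "valid z" using ex_valid by blast
  then obtain w where w: "valid w" "F w \<noteq> 0" using valid_common[OF _ assms assms] by blast
  have "F ((\<lambda>k. gcoord k w) \<circ> Base) \<noteq> 0" using w by (simp add: gcoord_base)
  then show "\<not> (\<forall>P\<in>S. \<forall>z\<in>P. F (z \<circ> Base) = 0)" using graph_in_S[OF w(1)] graph_mem by blast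
qed

text \<open>\<^term>\<open>F\<close> is on the blowup equal to \<open>Q / Dir i r0 s0\<close> times the minor with indices \<^term>\<open>r0\<close> and \<^term>\<open>s0\<close>. This holds for all
  elements of the ideal generated by the minors; \<^term>\<open>e\<close> is the degree of \<^term>\<open>F\<close> minus the one of a minor.\<close>

definition divisible :: "4 \<Rightarrow> 2 \<times> 4 \<Rightarrow> 2 \<times> 4 \<Rightarrow> (factor \<Rightarrow> nat) \<Rightarrow> ((yvar \<Rightarrow> complex) \<Rightarrow> complex) \<Rightarrow> bool" where
  "divisible i r0 s0 e F \<longleftrightarrow> (\<exists>Q. form afac (\<lambda>b. case b of Inl b' \<Rightarrow> e b' | Inr j \<Rightarrow> if j = i then 1 else 0) Q \<and>
     (\<forall>R\<in>S. \<forall>z\<in>R. F (z \<circ> Base) * z (Dir i r0 s0) = Q z * minor (a i) (z \<circ> Base) r0 s0))"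

lemma divisible_minor: "divisible i r0 s0 (\<lambda>_. 0) (\<lambda>z. minor (a i) z r s)"
  unfolding divisible_def
proof (intro exI conjI ballI)
  show "form afac (\<lambda>b. case b of Inl b' \<Rightarrow> 0 | Inr j \<Rightarrow> if j = i then 1 else 0) (\<lambda>z. z (Dir i r s))"
    by (rule form_var') (auto split: sum.split)
qed (use dir_minor[of _ _ i r s r0 s0] in \<open>auto simp: mult.commute\<close>)

lemma divisible_add:
  assumes "divisible i r0 s0 e F" "divisible i r0 s0 e G"
  shows "divisible i r0 s0 e (\<lambda>z. F z + G z)"
proof -
  obtain Q Q' where "form afac (\<lambda>b. case b of Inl b' \<Rightarrow> e b' | Inr j \<Rightarrow> if j = i then 1 else 0) Q"
     "\<forall>R\<in>S. \<forall>z\<in>R. F (z \<circ> Base) * z (Dir i r0 s0) = Q z * minor (a i) (z \<circ> Base) r0 s0"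
     "form afac (\<lambda>b. case b of Inl b' \<Rightarrow> e b' | Inr j \<Rightarrow> if j = i then 1 else 0) Q'"
     "\<forall>R\<in>S. \<forall>z\<in>R. G (z \<circ> Base) * z (Dir i r0 s0) = Q' z * minor (a i) (z \<circ> Base) r0 s0"
    using assms unfolding divisible_def by blast
  then show ?thesis unfolding divisible_def
    by (intro exI[of _ "\<lambda>z. Q z + Q' z"]) (auto intro: form.add simp: algebra_simps)
qed

lemma divisible_mult:
  assumes "divisible i r0 s0 e F" "form yfac d K" "\<And>b. e' b = e b + d b"
  shows "divisible i r0 s0 e' (\<lambda>z. F z * K z)"
proof -
  obtain Q where Q: "form afac (\<lambda>b. case b of Inl b' \<Rightarrow> e b' | Inr j \<Rightarrow> if j = i then 1 else 0) Q"
     "\<forall>R\<in>S. \<forall>z\<in>R. F (z \<circ> Base) * z (Dir i r0 s0) = Q z * minor (a i) (z \<circ> Base) r0 s0"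
    using assms unfolding divisible_def by blast
  show ?thesis unfolding divisible_def
  proof (intro exI[of _ "\<lambda>z. Q z * K (z \<circ> Base)"] conjI ballI)
    show "form afac (\<lambda>b. case b of Inl b' \<Rightarrow> e' b' | Inr j \<Rightarrow> if j = i then 1 else 0) (\<lambda>z. Q z * K (z \<circ> Base))"
      by (rule form_mult'[OF Q(1) form_pullback_base[OF assms(2)]]) (auto simp: assms(3) split: sum.split)
    fix R z assume "R \<in> S" "z \<in> R"
    then have "F (z \<circ> Base) * z (Dir i r0 s0) = Q z * minor (a i) (z \<circ> Base) r0 s0" using Q(2) by blast
    then show "F (z \<circ> Base) * K (z \<circ> Base) * z (Dir i r0 s0) = Q z * K (z \<circ> Base) * minor (a i) (z \<circ> Base) r0 s0"
      by (metis mult.assoc mult.commute)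
  qed
qed

lemma divisible_cong: "divisible i r0 s0 e F \<Longrightarrow> (\<And>z. F z = G z) \<Longrightarrow> divisible i r0 s0 e G"
  by (metis ext)

text \<open>Up to the factor \<open>x y\<close>, with \<open>x = XVar j0\<close> and \<open>y = YVar k0\<close>, every form is congruent modulo the minors to the multiple of
  a monomial in \<open>x\<close> and \<open>y\<close> which has the same value at the point. For a coordinate, the difference is a multiple of a minor,
  and the congruence is preserved by sums and products. In particular, locally the minors generate the ideal of the point.\<close>

lemma divisible_congruence:
  assumes G: "form yfac d G" and jk: "a i (XVar j0) \<noteq> 0" "a i (YVar k0) \<noteq> 0"
  shows "divisible i r0 s0 d (\<lambda>z. z (XVar j0) * z (YVar k0) *
     (a i (XVar j0) ^ d FacP1 * a i (YVar k0) ^ d FacP3 * G z - G (a i) * z (XVar j0) ^ d FacP1 * z (YVar k0) ^ d FacP3))"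
  using G
proof induction
  case (const c)
  have "divisible i r0 s0 (\<lambda>_. 0) (\<lambda>z. minor (a i) z r0 s0 * 0)"
    by (rule divisible_mult[OF divisible_minor form.const]) simp
  then show ?case by simp
next
  case (var v)
  show ?case
  proof (cases v)
    case (XVar j)
    have "divisible i r0 s0 (\<lambda>b. if b = yfac (XVar j) then 1 else 0)
       (\<lambda>z. minor (a i) z (j, k0) (j0, k0) * (1 / a i (YVar k0) * z (XVar j0)))"
      by (rule divisible_mult[OF divisible_minor form_cmult[OF form.var]]) simp
    then show ?thesis unfolding XVar
      by (rule divisible_cong) (use jk in \<open>simp_all add: minor_def segre_def field_simps\<close>)
  next
    case (YVar k)
    have "divisible i r0 s0 (\<lambda>b. if b = yfac (YVar k) then 1 else 0)
       (\<lambda>z. minor (a i) z (j0, k) (j0, k0) * (1 / a i (XVar j0) * z (YVar k0)))"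
      by (rule divisible_mult[OF divisible_minor form_cmult[OF form.var]]) simp
    then show ?thesis unfolding YVar
      by (rule divisible_cong) (use jk in \<open>simp_all add: minor_def segre_def field_simps\<close>)
  qed
next
  case (add d F G)
  from divisible_add[OF add.IH] show ?case
    by (rule divisible_cong) (simp add: algebra_simps)
next
  case (mult d F e G)
  have mono: "form yfac d (\<lambda>z. F (a i) * (z (XVar j0) ^ d FacP1 * z (YVar k0) ^ d FacP3))"
  proof (intro form_cmult)
    have "form yfac (\<lambda>b. d FacP1 * (if b = yfac (XVar j0) then 1 else 0) + d FacP3 * (if b = yfac (YVar k0) then 1 else 0))
      (\<lambda>z. z (XVar j0) ^ d FacP1 * z (YVar k0) ^ d FacP3)"
      by (intro form.mult form_power form.var)
    moreover have "(\<lambda>b. d FacP1 * (if b = yfac (XVar j0) then 1 else 0) + d FacP3 * (if b = yfac (YVar k0) then 1 else 0)) = d"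
    proof
      fix b show "d FacP1 * (if b = yfac (XVar j0) then 1 else 0) + d FacP3 * (if b = yfac (YVar k0) then 1 else 0) = d b"
        by (cases b) auto
    qed
    ultimately show "form yfac d (\<lambda>z. z (XVar j0) ^ d FacP1 * z (YVar k0) ^ d FacP3)" by simp
  qed
  have 1: "divisible i r0 s0 (\<lambda>b. d b + e b) (\<lambda>z. z (XVar j0) * z (YVar k0) *
     (a i (XVar j0) ^ d FacP1 * a i (YVar k0) ^ d FacP3 * F z - F (a i) * z (XVar j0) ^ d FacP1 * z (YVar k0) ^ d FacP3)
     * (a i (XVar j0) ^ e FacP1 * a i (YVar k0) ^ e FacP3 * G z))"
    by (rule divisible_mult[OF mult.IH(1) form_cmult[OF mult.hyps(2)]]) simp
  have 2: "divisible i r0 s0 (\<lambda>b. d b + e b) (\<lambda>z. z (XVar j0) * z (YVar k0) *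
     (a i (XVar j0) ^ e FacP1 * a i (YVar k0) ^ e FacP3 * G z - G (a i) * z (XVar j0) ^ e FacP1 * z (YVar k0) ^ e FacP3)
     * (F (a i) * (z (XVar j0) ^ d FacP1 * z (YVar k0) ^ d FacP3)))"
    by (rule divisible_mult[OF mult.IH(2) mono]) simp
  from divisible_add[OF 1 2] show ?case
    by (rule divisible_cong) (simp add: power_add algebra_simps)
qed

end

context four_points
begin

text \<open>The local equation of the exceptional divisor on the open set described by \<open>chart\<close> below.\<close>

definition local_eq :: "4 \<Rightarrow> 2 \<times> 4 \<Rightarrow> 2 \<times> 4 \<Rightarrow> 2 \<Rightarrow> 4 \<Rightarrow> apoint \<Rightarrow> complex" where
  "local_eq i r s j k = ratio (\<lambda>z. minor (a i) (z \<circ> Base) r s) (\<lambda>z. z (Base (XVar j)) * z (Base (YVar k)))"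

definition chart :: "apoint \<Rightarrow> 4 \<Rightarrow> 2 \<times> 4 \<Rightarrow> 2 \<times> 4 \<Rightarrow> 2 \<Rightarrow> 4 \<Rightarrow> bool" where
  "chart P i r s j k \<longleftrightarrow> P \<in> S \<and> (\<forall>z\<in>P. z (Dir i r s) \<noteq> 0 \<and> z (Base (XVar j)) \<noteq> 0 \<and> z (Base (YVar k)) \<noteq> 0)"

lemma form_xy: "form yfac (\<lambda>_. 1) (\<lambda>z. z (XVar j) * z (YVar k))"
  using form_segre[of "(j, k)"] by (simp add: segre_def)

lemma form_minor_base: "form afac (\<lambda>b. case b of Inl _ \<Rightarrow> 1 | Inr _ \<Rightarrow> 0) (\<lambda>z. minor (a i) (z \<circ> Base) r s)"
  using form_pullback_base[OF form_minor] .

lemma form_xy_base: "form afac (\<lambda>b. case b of Inl _ \<Rightarrow> 1 | Inr _ \<Rightarrow> 0) (\<lambda>z. z (Base (XVar j)) * z (Base (YVar k)))"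
  using form_pullback_base[OF form_xy[of j k]] by (simp add: comp_def)

lemma local_eq_eval:
  "R \<in> S \<Longrightarrow> z \<in> R \<Longrightarrow> local_eq i r s j k R = minor (a i) (z \<circ> Base) r s / (z (Base (XVar j)) * z (Base (YVar k)))"
  unfolding local_eq_def by (rule ratio_eval[OF form_minor_base form_xy_base in_mproj])

lemma chartI:
  assumes P: "P \<in> S" "z \<in> P" "z (Dir i r s) \<noteq> 0" "z (Base (XVar j)) \<noteq> 0" "z (Base (YVar k)) \<noteq> 0"
  shows "chart P i r s j k"
  unfolding chart_def
  using nonvanishing_iff(2)[OF form.var in_mproj[OF P(1)] P(2), of "Dir i r s"]
    nonvanishing_iff(2)[OF form.var in_mproj[OF P(1)] P(2), of "Base (XVar j)"]
    nonvanishing_iff(2)[OF form.var in_mproj[OF P(1)] P(2), of "Base (YVar k)"] assms by blast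

lemma ex_chart:
  assumes "P \<in> S" shows "\<exists>r s j k. chart P i r s j k"
proof -
  obtain z where z: "z \<in> P" using mproj_nonempty[OF in_mproj[OF assms]] by blast
  obtain r s where rs: "z (Dir i r s) \<noteq> 0" using dir_nonzero[OF assms z] by blast
  obtain j k where "z (Base (XVar j)) \<noteq> 0" "z (Base (YVar k)) \<noteq> 0"
    using base_coords[OF assms z] by (auto simp: coords_yfac_iff)
  then show ?thesis using chartI[OF assms z rs] by blast
qed

lemma chart_near:
  assumes "chart P i r s j k"
  shows "eventually (\<lambda>Q. chart Q i r s j k) (near afac S P)"
proof -
  have P: "P \<in> S" using assms by (simp add: chart_def)
  have "eventually (\<lambda>R. \<forall>z\<in>R. z (Dir i r s) \<noteq> 0) (near afac S P)"
    "eventually (\<lambda>R. \<forall>z\<in>R. z (Base (XVar j)) \<noteq> 0) (near afac S P)"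
    "eventually (\<lambda>R. \<forall>z\<in>R. z (Base (YVar k)) \<noteq> 0) (near afac S P)"
    using assms by (auto simp: chart_def intro!: near_form_nonzero[OF form.var in_mproj[OF P]])
  then show ?thesis using near_in[of S afac P]
    by eventually_elim (auto simp: chart_def)
qed

lemma local_eq_in_ideal:
  assumes "chart P i r s j k"
  shows "local_eq i r s j k \<in> pulled_back_ideal p i P"
  unfolding pulled_back_ideal_def
proof (intro CollectI exI conjI ballI impI)
  show "form yfac (\<lambda>_. 1) (\<lambda>z. minor (a i) z r s)" by (rule form_minor)
  show "form yfac (\<lambda>_. 1) (\<lambda>z. z (XVar j) * z (YVar k))" by (rule form_xy)
  show "minor (a i) b r s = 0" if "b \<in> p i" for b using that minor_self by (simp add: p_def)
  show "(z \<circ> Base) (XVar j) * (z \<circ> Base) (YVar k) \<noteq> 0" if "z \<in> P" for z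
    using assms that by (simp add: chart_def)
  show "local_eq i r s j k R = minor (a i) (z \<circ> Base) r s / ((z \<circ> Base) (XVar j) * (z \<circ> Base) (YVar k))"
    if "R \<in> S" "z \<in> R" for R z using local_eq_eval[OF that] by simp
qed

lemma ideal_regular:
  assumes "f \<in> pulled_back_ideal p i P"
  shows "regular_at afac S P f"
proof -
  obtain d G H where *: "form yfac d G" "form yfac d H" "\<forall>z\<in>P. H (z \<circ> Base) \<noteq> 0"
    "\<forall>R\<in>S. \<forall>z\<in>R. H (z \<circ> Base) \<noteq> 0 \<longrightarrow> f R = G (z \<circ> Base) / H (z \<circ> Base)"
    using assms unfolding pulled_back_ideal_def by blast
  show ?thesis unfolding regular_at_def
    by (intro exI conjI, rule form_pullback_base[OF *(1)], rule form_pullback_base[OF *(2)]) (use *(3,4) in auto)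
qed

lemma local_eq_nonzero:
  assumes "chart P i r s j k"
  shows "eventually (\<lambda>R. local_eq i r s j k R \<noteq> 0) (generic afac S)"
proof -
  have P: "P \<in> S" using assms by (simp add: chart_def)
  obtain z where z: "z \<in> P" using mproj_nonempty[OF in_mproj[OF P]] by blast
  show ?thesis unfolding local_eq_def
  proof (rule ratio_nonzero_generic[OF form_minor_base form_xy_base])
    show "eventually (\<lambda>R. \<forall>z\<in>R. minor (a i) (z \<circ> Base) r s \<noteq> 0) (generic afac S)"
    proof (rule near_nonzero_imp_generic[OF form_minor_base], rule notI)
      assume zero: "\<forall>P\<in>S. \<forall>z\<in>P. minor (a i) (z \<circ> Base) r s = 0"
      have "z (Dir i r s) = 0"
      proof (rule S_relation[OF form.var _ P z])
        fix w assume "valid w"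
        then have "minor (a i) ((\<lambda>k. gcoord k w) \<circ> Base) r s = 0" using zero graph_in_S graph_mem by blast
        then show "gcoord (Dir i r s) w = 0" by (simp add: gcoord_base)
      qed
      then show False using assms z by (simp add: chart_def)
    qed
    show "eventually (\<lambda>R. \<forall>z\<in>R. z (Base (XVar j)) * z (Base (YVar k)) \<noteq> 0) (generic afac S)"
      using assms by (intro generic_form_nonzero[OF form_xy_base P]) (auto simp: chart_def)
  qed
qed

text \<open>Away from the \<open>i\<close>-th point some minor does not vanish, and the vector of the minors is proportional to the
  coordinates \<open>Dir i\<close>.\<close>

lemma off_point_minor:
  assumes "chart P i r s j k" "z \<in> P" "z \<circ> Base \<notin> p i"
  shows "minor (a i) (z \<circ> Base) r s \<noteq> 0"
proof -
  have P: "P \<in> S" using assms by (simp add: chart_def)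
  obtain r' s' where rs: "minor (a i) (z \<circ> Base) r' s' \<noteq> 0"
    using minors_zero_imp[OF base_coords[OF P assms(2)] a_coords, of i] assms(3) unfolding p_def by blast
  have "z (Dir i r s) \<noteq> 0" using assms by (simp add: chart_def)
  then show ?thesis using dir_minor[OF P assms(2), of i r s r' s'] rs by auto
qed

lemma local_eq_off_point:
  assumes "chart P i r s j k" "z \<in> P" "z \<circ> Base \<notin> p i"
  shows "local_eq i r s j k P \<noteq> 0"
proof -
  have P: "P \<in> S" using assms by (simp add: chart_def)
  then show ?thesis
    using off_point_minor[OF assms] local_eq_eval[OF P assms(2)] assms(1,2) by (auto simp: chart_def)
qed

text \<open>Over the \<open>i\<close>-th point, the numerator of \<^term>\<open>h\<close> is divisible by \<open>divisible_congruence\<close>, in which the monomial has the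
  coefficient 0. At all other points, \<open>local_eq\<close> is a unit.\<close>

lemma local_eq_generates:
  assumes ch: "chart P i r s j k" and h: "h \<in> pulled_back_ideal p i P"
  shows "\<exists>u. regular_at afac S P u \<and> eventually (\<lambda>R. h R = u R * local_eq i r s j k R) (generic afac S)"
proof -
  have P: "P \<in> S" using ch by (simp add: chart_def)
  obtain z where z: "z \<in> P" using mproj_nonempty[OF in_mproj[OF P]] by blast
  have zc: "z (Dir i r s) \<noteq> 0" "z (Base (XVar j)) \<noteq> 0" "z (Base (YVar k)) \<noteq> 0"
    using ch z by (auto simp: chart_def)
  obtain d G H where *: "form yfac d G" "form yfac d H" "\<forall>b\<in>p i. G b = 0" "\<forall>z\<in>P. H (z \<circ> Base) \<noteq> 0"
    "\<forall>R\<in>S. \<forall>z\<in>R. H (z \<circ> Base) \<noteq> 0 \<longrightarrow> h R = G (z \<circ> Base) / H (z \<circ> Base)"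
    using h unfolding pulled_back_ideal_def by blast
  show ?thesis
  proof (cases "z \<circ> Base \<in> p i")
    case True
    have zb: "z \<circ> Base \<in> mpoint yfac (a i)" using True by (simp add: p_def)
    then obtain c where "z \<circ> Base = (\<lambda>v. c (yfac v) * a i v)" by (auto elim: mpointE)
    then have c: "z (Base v) = c (yfac v) * a i v" for v by (metis comp_apply)
    have jk: "a i (XVar j) \<noteq> 0" "a i (YVar k) \<noteq> 0" using zc(2,3) c by auto
    have "G (a i) = 0" using *(3) by (simp add: p_def)
    define e where "e = a i (XVar j) ^ d FacP1 * a i (YVar k) ^ d FacP3"
    have e: "e \<noteq> 0" using jk by (simp add: e_def)
    have "divisible i r s d (\<lambda>z. z (XVar j) * z (YVar k) * (e * G z))"
      using divisible_congruence[where i = i and ?r0.0 = r and ?s0.0 = s, OF *(1) jk] \<open>G (a i) = 0\<close> by (simp add: e_def)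
    then obtain Q where Q: "form afac (\<lambda>b. case b of Inl b' \<Rightarrow> d b' | Inr l \<Rightarrow> if l = i then 1 else 0) Q"
      "\<And>R z. R \<in> S \<Longrightarrow> z \<in> R \<Longrightarrow> (z \<circ> Base) (XVar j) * (z \<circ> Base) (YVar k) * (e * G (z \<circ> Base)) * z (Dir i r s) =
           Q z * minor (a i) (z \<circ> Base) r s"
      unfolding divisible_def by blast
    let ?K = "\<lambda>z. (e * H (z \<circ> Base)) * z (Dir i r s)"
    have K: "form afac (\<lambda>b. case b of Inl b' \<Rightarrow> d b' | Inr l \<Rightarrow> if l = i then 1 else 0) ?K"
      by (rule form_mult'[OF form_cmult[OF form_pullback_base[OF *(2)]] form.var]) (auto split: sum.split)
    have K0: "\<forall>z\<in>P. ?K z \<noteq> 0" using * ch e by (auto simp: chart_def)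
    have evK: "eventually (\<lambda>R. \<forall>z\<in>R. ?K z \<noteq> 0) (generic afac S)" by (rule generic_form_nonzero[OF K P K0])
    have evxy: "eventually (\<lambda>R. \<forall>z\<in>R. z (Base (XVar j)) * z (Base (YVar k)) \<noteq> 0) (generic afac S)"
      using ch by (intro generic_form_nonzero[OF form_xy_base P]) (auto simp: chart_def)
    have "eventually (\<lambda>R. h R = ratio Q ?K R * local_eq i r s j k R) (generic afac S)"
      using evK evxy generic_in
    proof eventually_elim
      case (elim R)
      obtain w where w: "w \<in> R" using mproj_nonempty[OF in_mproj] elim by blast
      let ?b = "w \<circ> Base"
      have nz: "H ?b \<noteq> 0" "w (Dir i r s) \<noteq> 0" "w (Base (XVar j)) \<noteq> 0" "w (Base (YVar k)) \<noteq> 0"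
        using elim w by auto
      have hR: "h R = G ?b / H ?b" using *(5) elim(3) w nz(1) by blast
      have QR: "ratio Q ?K R = Q w / ?K w" by (rule ratio_eval[OF Q(1) K in_mproj[OF elim(3)] w])
      have "Q w * minor (a i) ?b r s = w (Base (XVar j)) * w (Base (YVar k)) * (e * G ?b) * w (Dir i r s)"
        using Q(2)[OF elim(3) w] by simp
      then have "ratio Q ?K R * local_eq i r s j k R =
          (w (Base (XVar j)) * w (Base (YVar k)) * (e * G ?b) * w (Dir i r s)) / (?K w * (w (Base (XVar j)) * w (Base (YVar k))))"
        unfolding QR local_eq_eval[OF elim(3) w] by (simp only: times_divide_times_eq)
      also have "\<dots> = G ?b / H ?b" using nz e by (simp add: field_simps)
      finally show ?case using hR by simp
    qed
    then show ?thesis using regular_ratio[OF Q(1) K K0] by blast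
  next
    case False
    let ?e = "local_eq i r s j k"
    have e0: "?e P \<noteq> 0" by (rule local_eq_off_point[OF ch z False])
    have "regular_at afac S P (\<lambda>R. h R * (1 / ?e R))"
      by (intro regular_mult regular_inverse ideal_regular[OF h] ideal_regular[OF local_eq_in_ideal[OF ch]] e0 P)
    moreover have "eventually (\<lambda>R. h R = h R * (1 / ?e R) * ?e R) (generic afac S)"
      using local_eq_nonzero[OF ch] by eventually_elim simp
    ultimately show ?thesis by blast
  qed
qed

lemma E_div_spec:
  assumes "P \<in> S"
  shows "E_div p i P \<in> pulled_back_ideal p i P"
    "h \<in> pulled_back_ideal p i P \<Longrightarrow>
      \<exists>u. regular_at afac S P u \<and> eventually (\<lambda>R. h R = u R * E_div p i P R) (generic afac S)"
proof -
  let ?Q = "\<lambda>f. f \<in> pulled_back_ideal p i P \<and>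
     (\<forall>h \<in> pulled_back_ideal p i P. \<exists>u. regular_at afac S P u \<and> rat_eq afac S h (\<lambda>R. u R * f R))"
  obtain r s j k where ch: "chart P i r s j k" using ex_chart[OF assms] by blast
  have "?Q (local_eq i r s j k)"
    using local_eq_in_ideal[OF ch] local_eq_generates[OF ch] by (simp add: rat_eq_iff)
  then have "?Q (E_div p i P)" unfolding E_div_def by (rule someI[where P = ?Q])
  then show "E_div p i P \<in> pulled_back_ideal p i P"
    "h \<in> pulled_back_ideal p i P \<Longrightarrow>
      \<exists>u. regular_at afac S P u \<and> eventually (\<lambda>R. h R = u R * E_div p i P R) (generic afac S)"
    by (auto simp: rat_eq_iff)
qed

lemma E_div_regular: "P \<in> S \<Longrightarrow> regular_at afac S P (E_div p i P)"
  by (rule ideal_regular[OF E_div_spec(1)])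

text \<open>Two generators of the same principal ideal differ by a unit.\<close>

lemma E_div_unit:
  assumes ch: "chart P i r s j k"
  shows "\<exists>u. unit_at afac S P (\<lambda>R. E_div p i P R / local_eq i r s j k R) u"
proof -
  let ?e = "local_eq i r s j k" and ?E = "E_div p i P"
  have P: "P \<in> S" using ch by (simp add: chart_def)
  obtain u where u: "regular_at afac S P u" "eventually (\<lambda>R. ?E R = u R * ?e R) (generic afac S)"
    using local_eq_generates[OF ch E_div_spec(1)[OF P]] by blast
  obtain v where v: "regular_at afac S P v" "eventually (\<lambda>R. ?e R = v R * ?E R) (generic afac S)"
    using E_div_spec(2)[OF P local_eq_in_ideal[OF ch]] by blast
  have "eventually (\<lambda>R. v R * u R = 1) (generic afac S)"
    using u(2) v(2) local_eq_nonzero[OF ch] by eventually_elim (metis mult.assoc mult_cancel_right1 mult_1)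
  then have "v P * u P = 1"
    by (rule regular_eq_at[OF regular_mult[OF v(1) u(1)] regular_const P])
  then have "u P \<noteq> 0" by auto
  moreover have "eventually (\<lambda>R. ?E R / ?e R = u R) (generic afac S)"
    using u(2) local_eq_nonzero[OF ch] by eventually_elim simp
  ultimately show ?thesis using u(1) by (auto simp: unit_at_def rat_eq_iff)
qed

lemma E_div_near:
  assumes ch: "chart P i r s j k"
  shows "\<exists>u. regular_at afac S P u \<and> u P \<noteq> 0 \<and> eventually (\<lambda>R. E_div p i P R = u R * local_eq i r s j k R) (near afac S P)"
proof -
  have P: "P \<in> S" using ch by (simp add: chart_def)
  obtain u where u: "unit_at afac S P (\<lambda>R. E_div p i P R / local_eq i r s j k R) u" using E_div_unit[OF ch] by blast
  then have ru: "regular_at afac S P u" by (simp add: unit_at_def)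
  have "eventually (\<lambda>R. E_div p i P R = u R * local_eq i r s j k R) (generic afac S)"
    using u[unfolded unit_at_def rat_eq_iff, THEN conjunct2, THEN conjunct2] local_eq_nonzero[OF ch]
    by eventually_elim (simp add: divide_eq_eq)
  from regular_eq_near[OF E_div_regular[OF P] regular_mult[OF ru ideal_regular[OF local_eq_in_ideal[OF ch]]] P this]
  show ?thesis using u by (auto simp: unit_at_def)
qed

lemma E_div_nonzero: "P \<in> S \<Longrightarrow> eventually (\<lambda>R. E_div p i P R \<noteq> 0) (generic afac S)"
proof -
  assume P: "P \<in> S"
  obtain r s j k where ch: "chart P i r s j k" using ex_chart[OF P] by blast
  obtain u where u: "regular_at afac S P u" "u P \<noteq> 0"
    "eventually (\<lambda>R. E_div p i P R = u R * local_eq i r s j k R) (near afac S P)" using E_div_near[OF ch] by blast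
  show ?thesis
    using near_generic[OF P u(3)] near_generic[OF P regular_nonzero_near[OF u(1) P u(2)]] local_eq_nonzero[OF ch]
    by eventually_elim simp
qed

lemma E_div_off_point:
  assumes "P \<in> S" "z \<in> P" "z \<circ> Base \<notin> p i"
  shows "E_div p i P P \<noteq> 0"
proof -
  obtain r s j k where ch: "chart P i r s j k" using ex_chart[OF assms(1)] by blast
  obtain u where u: "u P \<noteq> 0"
    "eventually (\<lambda>R. E_div p i P R = u R * local_eq i r s j k R) (near afac S P)" using E_div_near[OF ch] by blast
  show ?thesis
    using near_self[OF assms(1) in_mproj[OF assms(1)] u(2)] u(1) local_eq_off_point[OF ch assms(2,3)] by simp
qed

lemma cartier_E: "cartier afac S (E_div p i)"
  unfolding cartier_iff
proof (intro ballI conjI)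
  fix P assume P: "P \<in> S"
  show "nonzero_rational afac S (E_div p i P)"
    by (rule nonzero_rational_regular[OF P E_div_regular[OF P] generic_nonzero_not_zero[OF E_div_nonzero[OF P]]])
  obtain r s j k where ch: "chart P i r s j k" using ex_chart[OF P] by blast
  obtain u where u: "unit_at afac S P (\<lambda>R. E_div p i P R / local_eq i r s j k R) u" using E_div_unit[OF ch] by blast
  show "eventually (\<lambda>Q. \<exists>u. unit_at afac S Q (\<lambda>R. E_div p i P R / E_div p i Q R) u) (near afac S P)"
    using chart_near[OF ch] unit_at_near[OF u P]
  proof eventually_elim
    case (elim Q)
    then have Q: "Q \<in> S" by (simp add: chart_def)
    obtain v where v: "unit_at afac S Q (\<lambda>R. E_div p i Q R / local_eq i r s j k R) v" using E_div_unit[OF elim(1)] by blast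
    have 1: "unit_at afac S Q (\<lambda>R. E_div p i P R / local_eq i r s j k R * (1 / (E_div p i Q R / local_eq i r s j k R))) (\<lambda>R. u R * (1 / v R))"
      by (rule unit_at_mult[OF elim(2) unit_at_inverse[OF v Q]])
    have 2: "eventually (\<lambda>R. E_div p i P R / local_eq i r s j k R * (1 / (E_div p i Q R / local_eq i r s j k R)) =
       E_div p i P R / E_div p i Q R) (generic afac S)"
      using local_eq_nonzero[OF ch] by eventually_elim simp
    show ?case by (rule exI, rule unit_at_cong[OF 1 2])
  qed
qed

lemma effective_E: "effective afac S (E_div p i)"
  unfolding effective_def
proof (intro conjI cartier_E ballI)
  fix P assume "P \<in> S"
  then show "\<exists>f. regular_at afac S P f \<and> rat_eq afac S (E_div p i P) f"
    using E_div_regular by (intro exI[of _ "E_div p i P"]) (auto simp: rat_eq_iff)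
qed


section \<open>The generators of the cone are effective\<close>

lemma E_class_realized:
  "\<exists>D. effective afac S D \<and> numerically_equivalent afac S D (combination p 0 0 (\<lambda>l. if l = i then 1 else 0))"
proof (intro exI[of _ "E_div p i"] conjI effective_E)
  have comb: "combination p 0 0 (\<lambda>l. if l = i then 1 else 0) P R = E_div p i P R" for P R
  proof -
    have "(\<Prod>l\<in>UNIV. E_div p l P R powi (if l = i then 1 else 0)) = (\<Prod>l\<in>UNIV. if l = i then E_div p l P R else 1)"
      by (rule prod.cong) auto
    then show ?thesis by (simp add: combination_def)
  qed
  show "numerically_equivalent afac S (E_div p i) (combination p 0 0 (\<lambda>l. if l = i then 1 else 0))"
  proof (rule numerically_equivalent_principal[where h = "\<lambda>_. 1"])
    fix P assume "P \<in> S"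
    show "eventually (\<lambda>R. E_div p i P R / combination p 0 0 (\<lambda>l. if l = i then 1 else 0) P R = 1) (generic afac S)"
      unfolding comb using E_div_nonzero[OF \<open>P \<in> S\<close>] by eventually_elim simp
  qed simp
qed

text \<open>The strict transform of a hyperplane: the equation \<^term>\<open>L\<close> is divisible by the product of the local equations of the exceptional
  divisors over the points with index in \<^term>\<open>T\<close>, because at each point of the blowup at most one of these is not a unit,
  and that one divides all functions which vanish at its point. For a coordinate \<^term>\<open>v\<close> of the same factor as \<^term>\<open>L\<close>, the
  function \<open>L / v\<close> gives the linear equivalence.\<close>

lemma hyperplane_realized:
  fixes v :: yvar and T :: "4 set"
  assumes L: "form yfac (\<lambda>b. if b = yfac v then 1 else 0) L" "L z0 \<noteq> 0" "\<And>i. i \<in> T \<Longrightarrow> L (a i) = 0"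
  defines "H \<equiv> form_divisor afac (\<lambda>b. if b = Inl (yfac v) then 1 else 0) (\<lambda>z. z (Base v))"
  shows "\<exists>D. effective afac S D \<and> numerically_equivalent afac S D
     (\<lambda>P R. H P R * (\<Prod>i\<in>UNIV. E_div p i P R powi (if i \<in> T then -1 else 0)))"
proof -
  define d :: "factor + 4 \<Rightarrow> nat" where "d = (\<lambda>b. if b = Inl (yfac v) then 1 else 0)"
  define LB where "LB = (\<lambda>z. L (z \<circ> Base))"
  have dform: "form afac d (\<lambda>z. F (z \<circ> Base))" if "form yfac (\<lambda>b. if b = yfac v then 1 else 0) F" for F
    by (rule form_degree_cong[OF form_pullback_base[OF that]]) (auto simp: d_def fun_eq_iff split: sum.split)
  have LBf: "form afac d LB" unfolding LB_def by (rule dform[OF L(1)])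
  have vf: "form yfac (\<lambda>b. if b = yfac v then 1 else 0) (\<lambda>z. z w)" if "yfac w = yfac v" for w
    by (rule form_var') (simp add: that)
  have Xf: "form afac d (\<lambda>z. z (Base w))" if "yfac w = yfac v" for w
    using dform[OF vf[OF that]] by simp
  have Lnz: "eventually (\<lambda>R. \<forall>z\<in>R. LB z \<noteq> 0) (generic afac S)"
    unfolding LB_def by (rule generic_base_nonzero[OF L(1,2)])
  have Xnz: "eventually (\<lambda>R. \<forall>z\<in>R. z (Base v) \<noteq> 0) (generic afac S)"
    using generic_base_nonzero[OF vf[OF refl], of "\<lambda>_. 1"] by simp
  define D where "D = (\<lambda>P R. form_divisor afac d LB P R * (1 / (\<Prod>i\<in>T. E_div p i P R)))"
  have cart: "cartier afac S D"
    unfolding D_def by (intro cartier_mult cartier_inverse cartier_prod cartier_E cartier_form_divisor[OF LBf Lnz] finite)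
  have evT: "eventually (\<lambda>R. \<forall>i\<in>T. E_div p i P R \<noteq> 0) (generic afac S)" if "P \<in> S" for P
    using E_div_nonzero[OF that] by (intro eventually_ball_finite) auto
  have "\<exists>f. regular_at afac S P f \<and> rat_eq afac S (D P) f" if P: "P \<in> S" for P
  proof -
    obtain G where G: "form afac d G" "\<forall>z\<in>P. G z \<noteq> 0" "\<And>F. form_divisor afac d F P = ratio F G"
      using form_divisor_ratio[OF in_mproj[OF P], of d] by blast
    obtain z where z: "z \<in> P" using mproj_nonempty[OF in_mproj[OF P]] by blast
    have rinv: "regular_at afac S P (\<lambda>R. \<Prod>i\<in>U. 1 / E_div p i P R)" if "\<And>i. i \<in> U \<Longrightarrow> z \<circ> Base \<notin> p i" for U
      using that by (intro regular_prod regular_inverse E_div_regular P E_div_off_point[OF P z] finite) auto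
    show ?thesis
    proof (cases "\<exists>i\<in>T. z \<circ> Base \<in> p i")
      case False
      have "regular_at afac S P (\<lambda>R. ratio LB G R * (\<Prod>i\<in>T. 1 / E_div p i P R))"
        using False by (intro regular_mult rinv regular_ratio[OF LBf G(1,2)]) auto
      moreover have "rat_eq afac S (D P) (\<lambda>R. ratio LB G R * (\<Prod>i\<in>T. 1 / E_div p i P R))"
        unfolding D_def G(3) rat_eq_iff by (simp add: prod_dividef)
      ultimately show ?thesis by blast
    next
      case True
      then obtain i where i: "i \<in> T" "z \<circ> Base \<in> p i" by blast
      have others: "z \<circ> Base \<notin> p l" if "l \<in> T - {i}" for l using p_disjoint[OF i(2)] that by blast
      obtain w where w: "yfac w = yfac v" "z (Base w) \<noteq> 0"
        using base_coords[OF P z] unfolding coords_def by (metis comp_apply)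
      have Wnz: "\<forall>z\<in>P. z (Base w) \<noteq> 0"
        using nonvanishing_iff(2)[OF form.var in_mproj[OF P] z] w(2) by blast
      define f where "f = ratio LB (\<lambda>z. z (Base w))"
      have "f \<in> pulled_back_ideal p i P"
        unfolding pulled_back_ideal_def
      proof (intro CollectI exI conjI ballI impI)
        show "form yfac (\<lambda>b. if b = yfac v then 1 else 0) L" by (rule L(1))
        show "form yfac (\<lambda>b. if b = yfac v then 1 else 0) (\<lambda>z. z w)" by (rule vf[OF w(1)])
        show "L b = 0" if "b \<in> p i" for b
          using form_zero_mpoint_iff[OF L(1) that[unfolded p_def]] L(3)[OF i(1)] by simp
        show "(z \<circ> Base) w \<noteq> 0" if "z \<in> P" for z using Wnz that by simp
        show "f R = L (z \<circ> Base) / (z \<circ> Base) w" if "R \<in> S" "z \<in> R" for R z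
          unfolding f_def using ratio_eval[OF LBf Xf[OF w(1)] in_mproj[OF that(1)] that(2)] by (simp add: LB_def)
      qed
      then obtain u where u: "regular_at afac S P u" "eventually (\<lambda>R. f R = u R * E_div p i P R) (generic afac S)"
        using E_div_spec(2)[OF P] by blast
      let ?f = "\<lambda>R. u R * ratio (\<lambda>z. z (Base w)) G R * (\<Prod>l\<in>T - {i}. 1 / E_div p l P R)"
      have "regular_at afac S P ?f"
        by (intro regular_mult rinv regular_ratio[OF Xf[OF w(1)] G(1,2)] u(1) others)
      moreover have "eventually (\<lambda>R. D P R = ?f R) (generic afac S)"
        using u(2) E_div_nonzero[OF P, of i] generic_form_nonzero[OF Xf[OF w(1)] P Wnz] generic_in
      proof eventually_elim
        case (elim R)
        obtain y where y: "y \<in> R" using mproj_nonempty[OF in_mproj] elim by blast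
        have R: "R \<in> mproj afac" using in_mproj elim by blast
        have "ratio LB G R = f R * ratio (\<lambda>z. z (Base w)) G R"
          using ratio_eval[OF LBf G(1) R y] ratio_eval[OF Xf[OF w(1)] G(1) R y] ratio_eval[OF LBf Xf[OF w(1)] R y] elim(3) y
          by (simp add: f_def)
        moreover have "(\<Prod>l\<in>T. E_div p l P R) = E_div p i P R * (\<Prod>l\<in>T - {i}. E_div p l P R)"
          using i by (simp add: prod.remove)
        ultimately show ?case using elim(1,2) by (simp add: D_def G(3) prod_dividef)
      qed
      ultimately show ?thesis by (auto simp: rat_eq_iff)
    qed
  qed
  then have eff: "effective afac S D" using cart by (simp add: effective_def)
  have "numerically_equivalent afac S D (\<lambda>P R. H P R * (\<Prod>i\<in>UNIV. E_div p i P R powi (if i \<in> T then -1 else 0)))"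
  proof (rule numerically_equivalent_principal[where h = "ratio LB (\<lambda>z. z (Base v))"])
    show "eventually (\<lambda>R. ratio LB (\<lambda>z. z (Base v)) R \<noteq> 0) (generic afac S)"
      by (rule ratio_nonzero_generic[OF LBf Xf[OF refl] Lnz Xnz])
    fix P assume P: "P \<in> S"
    obtain G where G: "form afac d G" "\<forall>z\<in>P. G z \<noteq> 0" "\<And>F. form_divisor afac d F P = ratio F G"
      using form_divisor_ratio[OF in_mproj[OF P], of d] by blast
    have HP: "H P = ratio (\<lambda>z. z (Base v)) G" unfolding H_def using G(3) by (simp add: d_def)
    show "eventually (\<lambda>R. D P R / (H P R * (\<Prod>i\<in>UNIV. E_div p i P R powi (if i \<in> T then -1 else 0))) =
       ratio LB (\<lambda>z. z (Base v)) R) (generic afac S)"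
      using evT[OF P] Lnz Xnz generic_form_nonzero[OF G(1) P G(2)] generic_in
    proof eventually_elim
      case (elim R)
      obtain y where y: "y \<in> R" using mproj_nonempty[OF in_mproj] elim by blast
      have R: "R \<in> mproj afac" using in_mproj elim by blast
      have "(\<Prod>i\<in>UNIV. E_div p i P R powi (if i \<in> T then -1 else 0)) = (\<Prod>i\<in>UNIV. if i \<in> T then 1 / E_div p i P R else 1)"
        by (rule prod.cong) (auto simp: power_int_minus divide_inverse)
      also have "\<dots> = (\<Prod>i\<in>T. 1 / E_div p i P R)" by (simp add: prod.If_cases)
      also have "\<dots> = 1 / (\<Prod>i\<in>T. E_div p i P R)" by (simp add: prod_dividef)
      finally have pr: "(\<Prod>i\<in>UNIV. E_div p i P R powi (if i \<in> T then -1 else 0)) = 1 / (\<Prod>i\<in>T. E_div p i P R)" .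
      have "(\<Prod>i\<in>T. E_div p i P R) \<noteq> 0" using elim(1) by (simp add: prod_zero_iff)
      then show ?case
        unfolding pr D_def G(3) HP
        using ratio_eval[OF LBf G(1) R y] ratio_eval[OF Xf[OF refl] G(1) R y] ratio_eval[OF LBf Xf[OF refl] R y] elim y
        by simp
    qed
  qed
  then show ?thesis using eff by blast
qed

end

section \<open>Curves in the blowup\<close>

context four_points
begin

text \<open>The image of the \<open>i\<close>-th point in the projective line.\<close>

definition xi :: "4 \<Rightarrow> 2 \<Rightarrow> complex" where "xi i j = a i (XVar j)"

lemma xi_nonz: "nonz (xi i)"
proof -
  obtain j where "a i (XVar j) \<noteq> 0" using a_coords[of i] by (auto simp: coords_yfac_iff)
  then show ?thesis using two_cases[of j] by (auto simp: xi_def)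
qed

text \<open>Where the local equation at one point \<open>P\<close> is regular, differs from the local equations at the neighbouring points by
  units, and does not vanish, the latter do not vanish either. This is a dense open condition.\<close>

lemma effective_general_point:
  assumes eff: "effective afac S D"
  shows "\<exists>d V z0. form yfac d V \<and> V z0 \<noteq> 0 \<and> (\<forall>z. valid z \<longrightarrow> V z \<noteq> 0 \<longrightarrow>
    (\<forall>f. regular_at afac S (graph z) f \<longrightarrow> rat_eq afac S (D (graph z)) f \<longrightarrow> f (graph z) \<noteq> 0))"
proof -
  obtain P where P: "P \<in> S" using nonempty by blast
  have cart: "cartier afac S D" using eff by (simp add: effective_def)
  obtain h where h: "regular_at afac S P h" "eventually (\<lambda>R. D P R = h R) (generic afac S)"
    using eff P unfolding effective_def rat_eq_iff by blast
  have "eventually (\<lambda>R. D P R \<noteq> 0) (generic afac S)"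
    using cart P nonzero_rational_nonzero unfolding cartier_iff by blast
  then have "eventually (\<lambda>R. h R \<noteq> 0) (generic afac S)" using h(2) by eventually_elim simp
  then obtain U2 where U2: "openin (zariski afac) U2" "U2 \<inter> S \<noteq> {}" "\<forall>R\<in>U2 \<inter> S. h R \<noteq> 0"
    unfolding eventually_generic by blast
  have "eventually (\<lambda>Q. \<exists>u. unit_at afac S Q (\<lambda>R. D P R / D Q R) u) (near afac S P)"
    using cart P unfolding cartier_iff by blast
  then have "eventually (\<lambda>Q. (\<exists>u. unit_at afac S Q (\<lambda>R. D P R / D Q R) u) \<and> regular_at afac S Q h) (near afac S P)"
    using regular_near[OF h(1) P] by eventually_elim simp
  then obtain U1 where U1: "openin (zariski afac) U1" "P \<in> U1"
    "\<forall>Q\<in>U1 \<inter> S. (\<exists>u. unit_at afac S Q (\<lambda>R. D P R / D Q R) u) \<and> regular_at afac S Q h"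
    unfolding eventually_near[OF in_mproj[OF P]] by blast
  have "U1 \<inter> U2 \<inter> S \<noteq> {}" using opens_meet[OF U1(1) U2(1)] U1(2) P U2(2) by blast
  moreover have U: "openin (zariski afac) (U1 \<inter> U2)" using U1 U2 by blast
  ultimately obtain z0 where z0: "valid z0" "graph z0 \<in> U1 \<inter> U2" using S_open[OF U] by blast
  obtain d V where V: "form yfac d V" "V z0 \<noteq> 0" "\<And>w. valid w \<Longrightarrow> V w \<noteq> 0 \<Longrightarrow> graph w \<in> U1 \<inter> U2"
    using S_open_form[OF U z0] by blast
  have "f (graph z) \<noteq> 0" if z: "valid z" "V z \<noteq> 0" and f: "regular_at afac S (graph z) f" "rat_eq afac S (D (graph z)) f" for z f
  proof -
    let ?Q = "graph z"
    have Q: "?Q \<in> S" "?Q \<in> U1" "?Q \<in> U2" using V(3)[OF z] graph_in_S[OF z(1)] by auto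
    obtain u where u: "unit_at afac S ?Q (\<lambda>R. D P R / D ?Q R) u" using U1(3) Q by blast
    have rh: "regular_at afac S ?Q h" using U1(3) Q by blast
    have "eventually (\<lambda>R. D ?Q R \<noteq> 0) (generic afac S)"
      using cart Q nonzero_rational_nonzero unfolding cartier_iff by blast
    then have "eventually (\<lambda>R. h R = u R * f R) (generic afac S)"
      using h(2) f(2)[unfolded rat_eq_iff] u[unfolded unit_at_def rat_eq_iff, THEN conjunct2, THEN conjunct2]
      by eventually_elim (simp add: divide_eq_eq)
    then have "h ?Q = u ?Q * f ?Q"
      using u f(1) Q by (intro regular_eq_at[OF rh regular_mult]) (auto simp: unit_at_def)
    then show ?thesis using U2(3) Q by auto
  qed
  then show ?thesis using V(1,2) by blast
qed

end

text \<open>A morphism \<^term>\<open>f\<close> of degree \<^term>\<open>e\<close> from the projective line to projective 3-space. The curve of interest is the strict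
  transform of its graph, whose points in the base have the coordinates \<open>bv x\<close>.\<close>

locale blowup_curve = four_points +
  fixes f :: "4 \<Rightarrow> (2 \<Rightarrow> complex) \<Rightarrow> complex" and e :: nat
  assumes f_form: "\<And>k. bform e (f k)" and f_nonzero: "\<And>x. nonz x \<Longrightarrow> \<exists>k. f k x \<noteq> 0"
begin

definition bv :: "(2 \<Rightarrow> complex) \<Rightarrow> yvar \<Rightarrow> complex" where
  "bv x v = (case v of XVar j \<Rightarrow> x j | YVar k \<Rightarrow> f k x)"

text \<open>The points on the graph: over \<open>xi i\<close>, the graph has only one point.\<close>

definition T :: "4 set" where "T = {i. bv (xi i) \<in> p i}"

definition mult :: "4 \<Rightarrow> nat" where "mult i = (if i \<in> T then 1 else 0)"

lemma bv_simps [simp]: "bv x (XVar j) = x j" "bv x (YVar k) = f k x"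
  by (simp_all add: bv_def)

lemma bv_coords: "nonz x \<Longrightarrow> coords yfac (bv x)"
  using f_nonzero[of x] by (auto simp: coords_yfac_iff)

lemma bv_in_p_imp:
  assumes "nonz x" "bv x \<in> p i" shows "lin (xi i) x = 0" "i \<in> T"
proof -
  have "bv x \<in> mpoint yfac (a i)" using assms(2) by (simp add: p_def)
  from mpoint_proportional_rev[OF this, of "XVar 0" "XVar 1"] show l: "lin (xi i) x = 0"
    by (simp add: lin_def xi_def)
  obtain c where c: "c \<noteq> 0" "x = (\<lambda>j. c * xi i j)" using lin_zero_scale[OF xi_nonz assms(1) l] by blast
  have fx: "f k x = c ^ e * f k (xi i)" for k
    using form_scale[OF f_form[of k], of "\<lambda>_. c" "xi i"] c(2) by (simp add: UNIV_unit)
  have "bv (xi i) \<in> mpoint yfac (bv x)"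
  proof (rule mpointI[of "\<lambda>b. if b = FacP1 then 1 / c else 1 / c ^ e"])
    show "bv (xi i) = (\<lambda>k. (if yfac k = FacP1 then 1 / c else 1 / c ^ e) * bv x k)"
    proof
      fix v show "bv (xi i) v = (if yfac v = FacP1 then 1 / c else 1 / c ^ e) * bv x v"
        using c(1) by (cases v) (simp_all add: fx, simp add: c(2))
    qed
  qed (use c in auto)
  moreover have "mpoint yfac (bv x) = p i" using assms(2) mpoint_eqI unfolding p_def by metis
  ultimately show "i \<in> T" by (simp add: T_def)
qed

lemma bform_minor: "bform (Suc e) (\<lambda>x. minor (a i) (bv x) r s)"
proof -
  have seg: "bform (Suc e) (\<lambda>x. segre (bv x) r)" for r
  proof (cases r)
    case (Pair j k)
    have "bform (1 + e) (\<lambda>x. x j * f k x)" by (intro bform_mult bform_var f_form)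
    then show ?thesis by (simp add: segre_def Pair)
  qed
  show ?thesis unfolding minor_def
    using form_diff[OF form_cmult[OF seg[of r], of "segre (a i) s"] form_cmult[OF seg[of s], of "segre (a i) r"]]
    by (simp add: mult.commute)
qed

text \<open>On the graph, the minors for a point with index in \<^term>\<open>T\<close> are divisible by \<^term>\<open>lin (xi i)\<close>. The quotients are the coordinates
  \<open>Dir i\<close> of the strict transform.\<close>

definition M :: "4 \<Rightarrow> 2 \<times> 4 \<Rightarrow> 2 \<times> 4 \<Rightarrow> (2 \<Rightarrow> complex) \<Rightarrow> complex" where
  "M i r s = (SOME G. bform (Suc e - mult i) G \<and> (\<forall>x. minor (a i) (bv x) r s = lin (xi i) x ^ mult i * G x))"

lemma M: "bform (Suc e - mult i) (M i r s)" "minor (a i) (bv x) r s = lin (xi i) x ^ mult i * M i r s x"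
proof -
  have "\<exists>G. bform (Suc e - mult i) G \<and> (\<forall>x. minor (a i) (bv x) r s = lin (xi i) x ^ mult i * G x)"
  proof (cases "i \<in> T")
    case True
    then have "minor (a i) (bv (xi i)) r s = 0" using minor_self by (simp add: T_def p_def)
    from bform_factor[OF bform_minor xi_nonz this] show ?thesis using True by (simp add: mult_def)
  next
    case False
    then show ?thesis using bform_minor[of i r s] by (intro exI[of _ "\<lambda>x. minor (a i) (bv x) r s"]) (simp add: mult_def)
  qed
  from someI_ex[OF this] show "bform (Suc e - mult i) (M i r s)" "minor (a i) (bv x) r s = lin (xi i) x ^ mult i * M i r s x"
    unfolding M_def by blast+
qed

text \<open>The graph is smooth and maps isomorphically to the projective line, so the minors vanish only to order 1 at a point which it
  contains: the minor with indices \<open>(0, k)\<close>, \<open>(1, k)\<close> is \<^term>\<open>lin (xi i)\<close> times \<open>f k\<close>, up to a constant.\<close>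

lemma M_nonzero:
  assumes x: "nonz x" shows "\<exists>r s. M i r s x \<noteq> 0"
proof (cases "\<forall>r s. minor (a i) (bv x) r s = 0")
  case False
  then show ?thesis using M(2) by (metis mult_zero_right)
next
  case True
  then have "bv x \<in> mpoint yfac (a i)" using minors_zero_imp[OF bv_coords[OF x] a_coords] by blast
  then have i: "i \<in> T" and bx: "\<And>k l. yfac k = yfac l \<Longrightarrow> bv x k * a i l = bv x l * a i k"
    using bv_in_p_imp[OF x] mpoint_proportional_rev by (simp_all add: p_def)
  obtain k where k: "f k x \<noteq> 0" using f_nonzero[OF x] by blast
  obtain l where l: "a i (YVar l) \<noteq> 0" using a_coords[of i] by (auto simp: coords_yfac_iff)
  have b: "a i (YVar k) \<noteq> 0" using bx[of "YVar k" "YVar l"] k l by auto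
  have eq: "lin (xi i) x * M i (0, k) (1, k) x = lin (xi i) x * (a i (YVar k) * f k x)" for x
    using M(2)[of i x "(0, k)" "(1, k)"] i
    by (simp add: mult_def minor_def segre_def lin_def xi_def algebra_simps)
  have "bform e (M i (0, k) (1, k))" using M(1)[of i] i by (simp add: mult_def)
  then have "M i (0, k) (1, k) x = a i (YVar k) * f k x"
    by (rule bform_cancel_lin[OF _ form_cmult[OF f_form] xi_nonz eq])
  then show ?thesis using b k by (metis mult_eq_0_iff)
qed

definition \<phi> :: "avar \<Rightarrow> (2 \<Rightarrow> complex) \<Rightarrow> complex" where
  "\<phi> k x = (case k of Base v \<Rightarrow> bv x v | Dir i r s \<Rightarrow> M i r s x)"

definition \<delta> :: "factor + 4 \<Rightarrow> nat" where
  "\<delta> b = (case b of Inl c \<Rightarrow> (if c = FacP1 then 1 else e) | Inr i \<Rightarrow> Suc e - mult i)"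

lemma \<phi>_simps [simp]: "\<phi> (Base v) x = bv x v" "\<phi> (Dir i r s) x = M i r s x"
  by (simp_all add: \<phi>_def)

lemma \<phi>_base: "(\<lambda>k. \<phi> k x) \<circ> Base = bv x"
  by (simp add: comp_def)

sublocale cv: section_curve afac \<phi> \<delta> "\<lambda>j. Base (XVar j)" "Inl FacP1"
proof
  fix k show "bform (\<delta> (afac k)) (\<phi> k)"
  proof (cases k)
    case (Base v)
    then show ?thesis using bform_var f_form by (cases v) (simp_all add: \<phi>_def[abs_def] \<delta>_def)
  next
    case (Dir i r s)
    then show ?thesis using M(1)[of i r s] by (simp add: \<phi>_def[abs_def] \<delta>_def)
  qed
next
  fix x assume x: "nonz x"
  show "coords afac (\<lambda>k. \<phi> k x)" unfolding coords_def
  proof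
    fix b show "\<exists>k. afac k = b \<and> \<phi> k x \<noteq> 0"
    proof (cases b)
      case (Inl c)
      then obtain v where "yfac v = c" "bv x v \<noteq> 0" using bv_coords[OF x] unfolding coords_def by blast
      then show ?thesis using Inl by (intro exI[of _ "Base v"]) simp
    next
      case (Inr i)
      then obtain r s where "M i r s x \<noteq> 0" using M_nonzero[OF x] by blast
      then show ?thesis using Inr by (intro exI[of _ "Dir i r s"]) simp
    qed
  qed
next
  fix k assume "afac k = Inl FacP1"
  then obtain v where "k = Base v" "yfac v = FacP1" by (cases k) auto
  then show "k \<in> range (\<lambda>j. Base (XVar j))" by (cases v) auto
qed simp_all

abbreviation C :: "apoint set" where "C \<equiv> cv.C"

lemma curve_point_valid:
  assumes x: "nonz x" and nz: "\<And>i. lin (xi i) x \<noteq> 0"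
  shows "valid (bv x)"
  using bv_coords[OF x] bv_in_p_imp(1)[OF x] nz by (auto simp: valid_def)

lemma curve_point_graph:
  assumes x: "nonz x" and nz: "\<And>i. lin (xi i) x \<noteq> 0"
  shows "cv.\<gamma> x = graph (bv x)"
proof -
  have "(\<lambda>k. gcoord k (bv x)) \<in> mpoint afac (\<lambda>k. \<phi> k x)"
  proof (rule mpointI[of "\<lambda>b. case b of Inl _ \<Rightarrow> 1 | Inr i \<Rightarrow> lin (xi i) x ^ mult i"])
    show "(\<lambda>k. gcoord k (bv x)) = (\<lambda>k. (case afac k of Inl _ \<Rightarrow> 1 | Inr i \<Rightarrow> lin (xi i) x ^ mult i) * \<phi> k x)"
    proof
      fix k show "gcoord k (bv x) = (case afac k of Inl _ \<Rightarrow> 1 | Inr i \<Rightarrow> lin (xi i) x ^ mult i) * \<phi> k x"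
        using M(2) by (cases k) simp_all
    qed
  qed (use nz in \<open>auto split: sum.split\<close>)
  then show ?thesis unfolding cv.\<gamma>_def graph_def by (metis mpoint_eqI)
qed

text \<open>All but finitely many points of the curve are on the graph of the rational map, and every neighbourhood of the others
  contains such points.\<close>

lemma C_subset_S: "C \<subseteq> S"
proof
  fix P assume "P \<in> C"
  then obtain x where x: "nonz x" "P = cv.\<gamma> x" by (auto simp: cv.C_def)
  let ?L = "\<lambda>x. \<Prod>i\<in>UNIV. lin (xi i) x"
  have L: "bform (\<Sum>i\<in>(UNIV::4 set). 1) ?L" by (rule form_prod[OF finite]) (rule bform_lin)
  have ex: "\<exists>y. (\<Prod>i\<in>I. lin (xi i) y) \<noteq> 0" if "finite I" for I
    using that
  proof (induction I rule: finite_induct)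
    case (insert i I)
    then obtain y where y: "(\<Prod>i\<in>I. lin (xi i) y) \<noteq> 0" by blast
    obtain x0 where x0: "lin (xi i) x0 \<noteq> 0" using lin_nonzero[OF xi_nonz[of i]] by blast
    have LI: "form (\<lambda>_. ()) (\<lambda>_. \<Sum>i\<in>I. 1) (\<lambda>y. \<Prod>i\<in>I. lin (xi i) y)"
      by (rule form_prod[OF insert.hyps(1)]) (rule bform_lin)
    from form_common_nonzero[where F = "lin (xi i)" and G = "\<lambda>y. \<Prod>i\<in>I. lin (xi i) y", OF bform_lin LI x0 y]
    show ?case using insert.hyps by auto
  qed simp
  then obtain y where y: "?L y \<noteq> 0" using finite by blast
  show "P \<in> S" unfolding blowup_eq in_closure_of topspace_zariski
  proof (intro conjI allI impI)
    show "P \<in> mproj afac" using cv.\<gamma>_mproj x by simp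
    fix U assume U: "P \<in> U \<and> openin (zariski afac) U"
    then obtain n Q where Q: "bform n Q" "Q x \<noteq> 0" "\<And>w. nonz w \<Longrightarrow> Q w \<noteq> 0 \<Longrightarrow> cv.\<gamma> w \<in> U"
      using cv.C_open_iff[of U x] x by blast
    obtain v where v: "nonz v" "Q v \<noteq> 0" "?L v \<noteq> 0"
      using bform_common_nonzero[where F = Q and G = ?L, OF Q(1) L x(1) Q(2) y] by blast
    then have nz: "lin (xi i) v \<noteq> 0" for i by simp
    have "graph (bv v) \<in> U" using Q(3)[OF v(1,2)] curve_point_graph[OF v(1) nz] by simp
    then show "\<exists>y. y \<in> graph ` {z. valid z} \<and> y \<in> U" using curve_point_valid[OF v(1) nz] by blast
  qed
qed

text \<open>Restricted to the curve, \<^term>\<open>local_eq i r s j k\<close> is the minor \<^term>\<open>lin (xi i) x ^ mult i * M i r s x\<close> divided by a nonvanishing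
  form, and the second factor does not vanish either, as it is the value of \<open>Dir i r s\<close>.\<close>

lemma ord_E:
  assumes u: "nonz u"
  shows "cv.ord_at u (E_div p i (cv.\<gamma> u)) (int (vord u (\<lambda>x. lin (xi i) x ^ mult i)))"
proof -
  let ?P = "cv.\<gamma> u"
  have P: "?P \<in> S" "?P \<in> C" using C_subset_S cv.\<gamma>_C[OF u] by auto
  obtain r s j k where ch: "chart ?P i r s j k" using ex_chart[OF P(1)] by blast
  obtain v where v: "regular_at afac S ?P v" "v ?P \<noteq> 0"
    "eventually (\<lambda>R. E_div p i ?P R = v R * local_eq i r s j k R) (near afac S ?P)" using E_div_near[OF ch] by blast
  have Mu: "M i r s u \<noteq> 0" and den: "\<forall>z\<in>?P. z (Base (XVar j)) * z (Base (YVar k)) \<noteq> 0"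
    using ch cv.\<gamma>_mem[of u] by (auto simp: chart_def)
  have vC: "regular_at afac C ?P v" using regular_at_mono[OF v(1) C_subset_S] .
  have "eventually (\<lambda>R. v R \<noteq> 0) (generic afac C)"
    by (rule cv.near_generic[OF P(2) cv.regular_nonzero_near[OF vC P(2) v(2)]])
  then have v0: "cv.ord_at u v 0" using cv.ord_at_regular(2)[OF u vC _ v(2)] by blast
  obtain x0 where x0: "lin (xi i) x0 \<noteq> 0" using lin_nonzero[OF xi_nonz[of i]] by blast
  have lm: "bform (mult i * 1) (\<lambda>x. lin (xi i) x ^ mult i)" by (rule bform_power[OF bform_lin])
  have lm0: "lin (xi i) x0 ^ mult i \<noteq> 0" using x0 by simp
  obtain w where w: "M i r s w \<noteq> 0" "lin (xi i) w ^ mult i \<noteq> 0"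
    using bform_common_nonzero[where G = "\<lambda>x. lin (xi i) x ^ mult i", OF M(1) lm u Mu lm0] by blast
  have "cv.ord_at u (local_eq i r s j k) (int (vord u (\<lambda>x. minor (a i) ((\<lambda>k. \<phi> k x) \<circ> Base) r s)))"
    unfolding local_eq_def
    by (rule cv.ord_at_ratio[where w = w, OF u form_minor_base form_xy_base den]) (use w M(2) in \<open>simp add: \<phi>_base\<close>)
  moreover have "vord u (\<lambda>x. minor (a i) ((\<lambda>k. \<phi> k x) \<circ> Base) r s) = vord u (\<lambda>x. lin (xi i) x ^ mult i)"
    unfolding \<phi>_base M(2) using vord_mult[OF u lm lm0 M(1) Mu] vord_0[OF u M(1) Mu] by simp
  ultimately have "cv.ord_at u (local_eq i r s j k) (int (vord u (\<lambda>x. lin (xi i) x ^ mult i)))" by simp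
  from cv.ord_at_mult[OF u v0 this]
  have "cv.ord_at u (\<lambda>R. v R * local_eq i r s j k R) (int (vord u (\<lambda>x. lin (xi i) x ^ mult i)))" by simp
  then show ?thesis
  proof (rule cv.ord_at_cong)
    show "eventually (\<lambda>R. v R * local_eq i r s j k R = E_div p i ?P R) (generic afac C)"
      using cv.near_generic[OF P(2) near_mono[OF C_subset_S v(3)]] by eventually_elim simp
  qed
qed

lemma form_base_var: "form afac (\<lambda>b. if b = Inl (yfac v) then 1 else 0) (\<lambda>z. z (Base v))"
  by (rule form_var') simp

lemma ord_H:
  assumes u: "nonz u" and w: "bv w v \<noteq> 0"
  defines "H \<equiv> form_divisor afac (\<lambda>b. if b = Inl (yfac v) then 1 else 0) (\<lambda>z. z (Base v))"
  shows "cv.ord_at u (H (cv.\<gamma> u)) (int (vord u (\<lambda>x. bv x v)))" "regular_at afac S (cv.\<gamma> u) (H (cv.\<gamma> u))"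
proof -
  have P: "cv.\<gamma> u \<in> S" using C_subset_S cv.\<gamma>_C[OF u] by auto
  obtain G where G: "form afac (\<lambda>b. if b = Inl (yfac v) then 1 else 0) G" "\<forall>z\<in>cv.\<gamma> u. G z \<noteq> 0"
    "\<And>F. form_divisor afac (\<lambda>b. if b = Inl (yfac v) then 1 else 0) F (cv.\<gamma> u) = ratio F G"
    using form_divisor_ratio[OF in_mproj[OF P], of "\<lambda>b. if b = Inl (yfac v) then 1 else 0"] by blast
  show "cv.ord_at u (H (cv.\<gamma> u)) (int (vord u (\<lambda>x. bv x v)))"
    unfolding H_def G(3) using cv.ord_at_ratio[where w = w, OF u form_base_var G(1,2)] w by simp
  show "regular_at afac S (cv.\<gamma> u) (H (cv.\<gamma> u))"
    unfolding H_def G(3) by (rule regular_ratio[OF form_base_var G(1,2)])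
qed

end

lemma power_int_split:
  fixes x :: complex
  assumes "x \<noteq> 0" shows "x powi n = x ^ nat n / x ^ nat (- n)"
  using assms by (auto simp: power_int_def divide_inverse power_inverse)

context four_points
begin

lemma coordinate_divisor_nonzero:
  assumes P: "P \<in> S"
  shows "eventually (\<lambda>R. form_divisor afac (\<lambda>b. if b = Inl (yfac v) then 1 else 0) (\<lambda>z. z (Base v)) P R \<noteq> 0) (generic afac S)"
proof -
  let ?d = "\<lambda>b. if b = Inl (yfac v) then 1 else 0"
  obtain G where G: "form afac ?d G" "\<forall>z\<in>P. G z \<noteq> 0" "\<And>F. form_divisor afac ?d F P = ratio F G"
    using form_divisor_ratio[OF in_mproj[OF P], of ?d] by blast
  have X: "form afac ?d (\<lambda>z. z (Base v))" by (rule form_var') simp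
  have "eventually (\<lambda>R. \<forall>z\<in>R. z (Base v) \<noteq> 0) (generic afac S)"
    using generic_base_nonzero[OF form.var[of yfac v], of "\<lambda>_. 1"] by simp
  then show ?thesis unfolding G(3)
    by (rule ratio_nonzero_generic[OF X G(1) _ generic_form_nonzero[OF G(1) P G(2)]])
qed

lemma H1_div_eq: "H1_div = form_divisor afac (\<lambda>b. if b = Inl (yfac (XVar 0)) then 1 else 0) (\<lambda>z. z (Base (XVar 0)))"
  by (simp add: H1_div_def)

lemma H2_div_eq: "H2_div = form_divisor afac (\<lambda>b. if b = Inl (yfac (YVar 0)) then 1 else 0) (\<lambda>z. z (Base (YVar 0)))"
  by (simp add: H2_div_def)

text \<open>With \<^term>\<open>nat\<close>, negative exponents become 0. The denominator of a combination is the numerator of the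
  opposite combination, and both are regular.\<close>

definition numer :: "int \<Rightarrow> int \<Rightarrow> (4 \<Rightarrow> int) \<Rightarrow> divisor" where
  "numer \<alpha> \<beta> c P R = H1_div P R ^ nat \<alpha> * H2_div P R ^ nat \<beta> * (\<Prod>i\<in>UNIV. E_div p i P R ^ nat (c i))"

definition basis_nonzero :: "apoint \<Rightarrow> apoint \<Rightarrow> bool" where
  "basis_nonzero P R \<longleftrightarrow> H1_div P R \<noteq> 0 \<and> H2_div P R \<noteq> 0 \<and> (\<forall>i. E_div p i P R \<noteq> 0)"

lemma basis_nonzero_generic: "P \<in> S \<Longrightarrow> eventually (basis_nonzero P) (generic afac S)"
proof -
  assume P: "P \<in> S"
  have "eventually (\<lambda>R. \<forall>i\<in>UNIV. E_div p i P R \<noteq> 0) (generic afac S)"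
    using E_div_nonzero[OF P] by (intro eventually_ball_finite) auto
  then show ?thesis
    using coordinate_divisor_nonzero[OF P, of "XVar 0", folded H1_div_eq]
      coordinate_divisor_nonzero[OF P, of "YVar 0", folded H2_div_eq]
    by eventually_elim (simp add: basis_nonzero_def)
qed

lemma combination_split:
  assumes "basis_nonzero P R"
  shows "combination p \<alpha> \<beta> c P R = numer \<alpha> \<beta> c P R / numer (- \<alpha>) (- \<beta>) (\<lambda>i. - c i) P R"
    "numer \<alpha> \<beta> c P R \<noteq> 0"
  using assms by (simp_all add: combination_def numer_def basis_nonzero_def power_int_split prod_dividef)

end

context blowup_curve
begin

text \<open>Numerical equivalence provides a section \<open>s\<close> of degree 0 of \<open>\<O>(D - D')\<close> on the curve, where \<open>D'\<close> is the combination. Regular local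
  equations \<open>h\<close> of \<open>D\<close>, divided by the local equations \<open>K\<close> of \<open>D'\<close>, give another section. The two have the same transition functions;
  so their quotient \<open>\<Psi>\<close> does not depend on the point and has total order 0. Hence the total order of \<open>h / K\<close> is 0 as
  well. The order of \<open>h\<close> is nonnegative, and the one of \<open>K\<close> is counted by the zeros of binary forms of degrees 1, \<^term>\<open>e\<close>
  and \<^term>\<open>mult i\<close>.\<close>

lemma degree_nonneg:
  assumes eff: "effective afac S D" and num: "numerically_equivalent afac S D (combination p \<alpha> \<beta> c)"
    and x0: "nonz x0" and general: "\<And>h. regular_at afac S (cv.\<gamma> x0) h \<Longrightarrow> rat_eq afac S (D (cv.\<gamma> x0)) h \<Longrightarrow> h (cv.\<gamma> x0) \<noteq> 0"
    and w: "f 0 w \<noteq> 0"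
  shows "0 \<le> \<alpha> + int e * \<beta> + (\<Sum>i\<in>UNIV. c i * int (mult i))"
proof -
  define K where "K = combination p \<alpha> \<beta> c"
  define \<sigma> where "\<sigma> = numer \<alpha> \<beta> c"
  define \<sigma>' where "\<sigma>' = numer (- \<alpha>) (- \<beta>) (\<lambda>i. - c i)"
  have CS: "P \<in> S" if "P \<in> C" for P using C_subset_S that by blast
  have K: "K P R = \<sigma> P R / \<sigma>' P R" "\<sigma> P R \<noteq> 0" "\<sigma>' P R \<noteq> 0" if "basis_nonzero P R" for P R
    unfolding K_def \<sigma>_def \<sigma>'_def using combination_split[OF that] by auto
  have ptP: "nonz (cv.pt P)" "cv.\<gamma> (cv.pt P) = P" if "P \<in> C" for P using cv.pt[OF that] by auto
  have w': "bv w (YVar 0) \<noteq> 0" "bv (\<lambda>_. 1) (XVar 0) \<noteq> 0" using w by simp_all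

  \<comment> \<open>The curve is contained in none of the supports of the basis divisors, so these restrict to it.\<close>
  have ordH1: "cv.ord_at (cv.pt P) (H1_div P) (int (vord (cv.pt P) (\<lambda>x. x 0)))" and regH1: "regular_at afac S P (H1_div P)" if "P \<in> C" for P
    using ord_H[OF ptP(1)[OF that] w'(2)] ptP(2)[OF that] unfolding H1_div_eq by simp_all
  have ordH2: "cv.ord_at (cv.pt P) (H2_div P) (int (vord (cv.pt P) (f 0)))" and regH2: "regular_at afac S P (H2_div P)" if "P \<in> C" for P
    using ord_H[OF ptP(1)[OF that] w'(1)] ptP(2)[OF that] unfolding H2_div_eq by simp_all
  have ordE: "cv.ord_at (cv.pt P) (E_div p i P) (int (vord (cv.pt P) (\<lambda>x. lin (xi i) x ^ mult i)))" if "P \<in> C" for P i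
    using ord_E[OF ptP(1)[OF that]] ptP(2)[OF that] by simp
  define k where "k P = \<alpha> * int (vord (cv.pt P) (\<lambda>x. x 0)) + \<beta> * int (vord (cv.pt P) (f 0)) +
      (\<Sum>i\<in>UNIV. c i * int (vord (cv.pt P) (\<lambda>x. lin (xi i) x ^ mult i)))" for P
  have ordK: "cv.ord_at (cv.pt P) (K P) (k P)" if P: "P \<in> C" for P
  proof -
    have "cv.ord_at (cv.pt P) (\<lambda>R. H1_div P R powi \<alpha> * H2_div P R powi \<beta> * (\<Prod>i\<in>UNIV. E_div p i P R powi c i)) (k P)"
      unfolding k_def
      by (intro cv.ord_at_mult cv.ord_at_power_int cv.ord_at_prod ptP(1)[OF P] ordH1[OF P] ordH2[OF P] ordE[OF P] finite)
    then show ?thesis by (simp add: K_def combination_def[abs_def])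
  qed
  have bnC: "eventually (basis_nonzero P) (generic afac C)" if P: "P \<in> C" for P
  proof -
    have "eventually (\<lambda>R. \<forall>i\<in>UNIV. E_div p i P R \<noteq> 0) (generic afac C)"
      using cv.ord_at_nonzero[OF ordE[OF P]] by (intro eventually_ball_finite) auto
    then show ?thesis
      using cv.ord_at_nonzero[OF ordH1[OF P]] cv.ord_at_nonzero[OF ordH2[OF P]]
      by eventually_elim (simp add: basis_nonzero_def)
  qed
  have reg\<sigma>: "regular_at afac S P (\<sigma> P)" "regular_at afac S P (\<sigma>' P)" if P: "P \<in> C" for P
    unfolding \<sigma>_def \<sigma>'_def numer_def[abs_def]
    by (intro regular_mult regular_power regular_prod regH1[OF P] regH2[OF P] E_div_regular CS[OF P] finite)+

  \<comment> \<open>Whether the local equation \<open>h P\<close> vanishes on the curve does not depend on \<open>P\<close>, because neighbouring ones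
    differ by units. It does not at the general point.\<close>
  have cart: "cartier afac S D" using eff by (simp add: effective_def)
  have "\<forall>P. \<exists>h. P \<in> S \<longrightarrow> regular_at afac S P h \<and> rat_eq afac S (D P) h"
    using eff unfolding effective_def by blast
  from choice[OF this] obtain h where
    h0: "\<forall>P. P \<in> S \<longrightarrow> regular_at afac S P (h P) \<and> rat_eq afac S (D P) (h P)" ..
  then have h: "regular_at afac S P (h P)" "eventually (\<lambda>R. D P R = h P R) (generic afac S)" if "P \<in> S" for P
    using that by (auto simp: rat_eq_iff)
  have Dnz: "eventually (\<lambda>R. D P R \<noteq> 0) (generic afac S)" if "P \<in> S" for P
    using cart that nonzero_rational_nonzero unfolding cartier_iff by blast
  have toC: "eventually Pr (generic afac C)" if "Q \<in> C" "eventually Pr (near afac S Q)" for Q Pr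
    using cv.near_generic[OF that(1) near_mono[OF C_subset_S that(2)]] .
  have trans: "eventually (\<lambda>Q. \<exists>u. eventually (\<lambda>R. h P R = u R * h Q R \<and> u R \<noteq> 0) (generic afac C)) (near afac C P)"
    if P: "P \<in> C" for P
  proof -
    have 1: "eventually (\<lambda>Q. \<exists>u. unit_at afac S Q (\<lambda>R. D P R / D Q R) u) (near afac S P)"
      using cart CS[OF P] unfolding cartier_iff by blast
    have 2: "eventually (\<lambda>Q. regular_at afac S Q (h P)) (near afac S P)"
      by (rule regular_near[OF h(1)[OF CS[OF P]] CS[OF P]])
    show ?thesis
        using near_mono[OF C_subset_S 1] near_mono[OF C_subset_S 2] near_in[of C afac P]
      proof eventually_elim
        case (elim Q)
        then have Q: "Q \<in> C" by simp
        obtain u where u: "unit_at afac S Q (\<lambda>R. D P R / D Q R) u" using elim by blast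
        have ru: "regular_at afac S Q u" "u Q \<noteq> 0" using u by (auto simp: unit_at_def)
        have "eventually (\<lambda>R. h P R = u R * h Q R) (generic afac S)"
          using h(2)[OF CS[OF P]] h(2)[OF CS[OF Q]] Dnz[OF CS[OF Q]]
            u[unfolded unit_at_def rat_eq_iff, THEN conjunct2, THEN conjunct2]
          by eventually_elim (simp add: divide_eq_eq)
        from regular_eq_near[OF elim(2) regular_mult[OF ru(1) h(1)[OF CS[OF Q]]] CS[OF Q] this]
        have "eventually (\<lambda>R. h P R = u R * h Q R \<and> u R \<noteq> 0) (near afac S Q)"
          using regular_nonzero_near[OF ru(1) CS[OF Q] ru(2)] by eventually_elim simp
        from toC[OF Q this] show ?case by blast
      qed
  qed
  define P0 where "P0 = cv.\<gamma> x0"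
  have P0: "P0 \<in> C" unfolding P0_def by (rule cv.\<gamma>_C[OF x0])
  have h00: "h P0 P0 \<noteq> 0"
    using general h0 CS[OF P0] unfolding P0_def by blast
  have hP0: "eventually (\<lambda>R. h P0 R \<noteq> 0) (generic afac C)"
    by (rule toC[OF P0 regular_nonzero_near[OF h(1)[OF CS[OF P0]] CS[OF P0] h00]])
  have hnz: "eventually (\<lambda>R. h P R \<noteq> 0) (generic afac C)" if P: "P \<in> C" for P
  proof -
    have "eventually (\<lambda>Q. (\<exists>u. eventually (\<lambda>R. h P R = u R * h Q R \<and> u R \<noteq> 0) (generic afac C)) \<and>
        (\<exists>u. eventually (\<lambda>R. h P0 R = u R * h Q R \<and> u R \<noteq> 0) (generic afac C))) (generic afac C)"
      using cv.near_generic[OF P trans[OF P]] cv.near_generic[OF P0 trans[OF P0]] by eventually_elim simp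
    from eventually_happens[OF this] obtain Q u v where
      u: "eventually (\<lambda>R. h P R = u R * h Q R \<and> u R \<noteq> 0) (generic afac C)" and
      v: "eventually (\<lambda>R. h P0 R = v R * h Q R \<and> v R \<noteq> 0) (generic afac C)"
      using cv.generic_neq_bot by blast
    show ?thesis using u v hP0 by eventually_elim auto
  qed

  \<comment> \<open>Quotient of the section \<open>s\<close> by the section \<open>h / K\<close>. As \<open>K\<close> need not be regular, the equality of the transition
    functions is restricted to the curve after multiplication with the denominators.\<close>
  have "intersection_number afac S (\<lambda>P R. D P R / K P R) C 0"
    using num cv.curve_C C_subset_S unfolding numerically_equivalent_def K_def by blast
  then obtain s ord where sec: "rational_section afac S C (\<lambda>P R. D P R / K P R) s"
    and ord: "\<And>P. P \<in> C \<Longrightarrow> has_ord afac C P (s P) (ord P)"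
    and fin: "finite {P\<in>C. ord P \<noteq> 0}" and sum0: "0 = (\<Sum>P \<in> {P\<in>C. ord P \<noteq> 0}. ord P)"
    unfolding intersection_number_def by blast
  have srat: "nonzero_rational afac C (s P)" if "P \<in> C" for P
    using sec that unfolding rational_section_def by blast
  define \<Psi> where "\<Psi> P R = s P R * K P R / h P R" for P R
  have glue: "eventually (\<lambda>Q. eventually (\<lambda>R. \<Psi> P R = \<Psi> Q R) (generic afac C)) (near afac C P)" if P: "P \<in> C" for P
  proof -
    have 1: "eventually (\<lambda>Q. \<exists>u. unit_at afac S Q (\<lambda>R. D P R / K P R / (D Q R / K Q R)) u \<and>
            rat_eq afac C (\<lambda>R. s P R / s Q R) u) (near afac C P)"
      using sec P unfolding rational_section_def eventually_near[OF cv.in_mproj[OF P]] by blast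
    have 2: "eventually (\<lambda>Q. regular_at afac S Q (h P)) (near afac C P)"
      by (rule near_mono[OF C_subset_S regular_near[OF h(1)[OF CS[OF P]] CS[OF P]]])
    have 3: "eventually (\<lambda>Q. regular_at afac S Q (\<sigma> P)) (near afac C P)"
      by (rule near_mono[OF C_subset_S regular_near[OF reg\<sigma>(1)[OF P] CS[OF P]]])
    have 4: "eventually (\<lambda>Q. regular_at afac S Q (\<sigma>' P)) (near afac C P)"
      by (rule near_mono[OF C_subset_S regular_near[OF reg\<sigma>(2)[OF P] CS[OF P]]])
    show ?thesis using 1 2 3 4 near_in[of C afac P]
    proof eventually_elim
      case (elim Q)
      then have Q: "Q \<in> C" by simp
      obtain u where u: "unit_at afac S Q (\<lambda>R. D P R / K P R / (D Q R / K Q R)) u" and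
        su: "eventually (\<lambda>R. s P R / s Q R = u R) (generic afac C)" using elim(1) by (auto simp: cv.rat_eq_iff)
      have ru: "regular_at afac S Q u" using u by (simp add: unit_at_def)
      have eq: "eventually (\<lambda>R. h P R * \<sigma>' P R * \<sigma> Q R = u R * h Q R * \<sigma>' Q R * \<sigma> P R) (generic afac S)"
        using h(2)[OF CS[OF P]] h(2)[OF CS[OF Q]] Dnz[OF CS[OF Q]] basis_nonzero_generic[OF CS[OF P]] basis_nonzero_generic[OF CS[OF Q]]
            u[unfolded unit_at_def rat_eq_iff, THEN conjunct2, THEN conjunct2]
      proof eventually_elim
        case (elim R)
        have "h P R * \<sigma>' P R / \<sigma> P R / (h Q R * \<sigma>' Q R / \<sigma> Q R) = u R"
          using elim K(1)[OF elim(4)] K(1)[OF elim(5)] by simp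
        then show ?case using K(2,3)[OF elim(4)] K(2,3)[OF elim(5)] elim(2,3) by (simp add: field_simps)
      qed
      have "eventually (\<lambda>R. h P R * \<sigma>' P R * \<sigma> Q R = u R * h Q R * \<sigma>' Q R * \<sigma> P R) (near afac S Q)"
        by (rule regular_eq_near[OF _ _ CS[OF Q] eq])
          (intro regular_mult elim(2,3,4) ru h(1)[OF CS[OF Q]] reg\<sigma>[OF Q])+
      from toC[OF Q this] su hnz[OF P] hnz[OF Q] bnC[OF P] bnC[OF Q] cv.nonzero_rational_nonzero[OF srat[OF Q]]
      show ?case
      proof eventually_elim
        case (elim R)
        have s: "s P R = u R * s Q R" using elim by (simp add: divide_eq_eq)
        show ?case
          unfolding \<Psi>_def s K(1)[OF elim(5)] K(1)[OF elim(6)]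
          using elim(1,3,4) K(2,3)[OF elim(5)] K(2,3)[OF elim(6)] by (simp add: field_simps)
      qed
    qed
  qed
  have const: "eventually (\<lambda>R. \<Psi> P0 R = \<Psi> P R) (generic afac C)" if P: "P \<in> C" for P
  proof -
    have "eventually (\<lambda>Q. eventually (\<lambda>R. \<Psi> P R = \<Psi> Q R) (generic afac C) \<and> eventually (\<lambda>R. \<Psi> P0 R = \<Psi> Q R) (generic afac C)) (generic afac C)"
      using cv.near_generic[OF P glue[OF P]] cv.near_generic[OF P0 glue[OF P0]] by eventually_elim simp
    from eventually_happens[OF this] obtain Q where
      "eventually (\<lambda>R. \<Psi> P R = \<Psi> Q R) (generic afac C)" "eventually (\<lambda>R. \<Psi> P0 R = \<Psi> Q R) (generic afac C)"
      using cv.generic_neq_bot by blast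
    then show ?thesis by eventually_elim simp
  qed
  have ordh: "\<exists>m\<ge>0. cv.ord_at (cv.pt P) (h P) m" if P: "P \<in> C" for P
  proof (rule cv.ord_at_regular(1)[OF ptP(1)[OF P] _ hnz[OF P]])
    show "regular_at afac C (cv.\<gamma> (cv.pt P)) (h P)"
      unfolding ptP(2)[OF P] by (rule regular_at_mono[OF h(1)[OF CS[OF P]] C_subset_S])
  qed
  have "\<exists>m. cv.ord_at (cv.pt P0) (\<Psi> P0) m"
  proof -
    obtain m where m: "cv.ord_at (cv.pt P0) (s P0) m" using cv.ord_at_rational[OF srat[OF P0]] by blast
    obtain m' where m': "cv.ord_at (cv.pt P0) (h P0) m'" using ordh[OF P0] by blast
    note pt0 = ptP(1)[OF P0]
    from cv.ord_at_mult[OF pt0 cv.ord_at_mult[OF pt0 m ordK[OF P0]] cv.ord_at_inverse[OF m']]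
    show ?thesis unfolding \<Psi>_def[abs_def] by (auto simp: divide_inverse)
  qed
  then obtain m0 where "cv.ord_at (cv.pt P0) (\<Psi> P0) m0" by blast
  from cv.ord_at_represented[OF this]
  obtain n A B x1 where A: "bform n A" "A x1 \<noteq> 0" and B: "bform n B" "B x1 \<noteq> 0"
     and ord\<Psi>: "\<And>w. cv.ord_at w (\<Psi> P0) (int (vord w A) - int (vord w B))"
    by blast
  have lower: "int (vord (cv.pt P) A) - int (vord (cv.pt P) B) - k P \<le> ord P" if P: "P \<in> C" for P
  proof -
    obtain m where m: "m \<ge> 0" "cv.ord_at (cv.pt P) (h P) m" using ordh[OF P] by blast
    note ptn = ptP(1)[OF P]
    let ?o = "int (vord (cv.pt P) A) - int (vord (cv.pt P) B) + m + - k P"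
    have "cv.ord_at (cv.pt P) (\<lambda>R. \<Psi> P0 R * h P R * (1 / K P R)) ?o"
      by (intro cv.ord_at_mult[OF ptn] cv.ord_at_inverse ord\<Psi> m(2) ordK[OF P])
    moreover have "eventually (\<lambda>R. \<Psi> P0 R * h P R * (1 / K P R) = s P R) (generic afac C)"
      using const[OF P] hnz[OF P] bnC[OF P]
    proof eventually_elim
      case (elim R)
      show ?case unfolding elim(1) using elim(2) K[OF elim(3)] by (simp add: \<Psi>_def)
    qed
    ultimately have "cv.ord_at (cv.pt P) (s P) ?o" by (rule cv.ord_at_cong)
    then have "ord P = ?o"
      using cv.ord_at_has_ord[OF ptn, of "s P" "ord P"] ord[OF P] ptP(2)[OF P] by simp
    then show ?thesis using m(1) by simp
  qed

  \<comment> \<open>\<open>Z\<close> contains all points which contribute to any of the total orders.\<close>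
  have X: "bform 1 (\<lambda>x. x 0)" "(\<lambda>_. 1 :: complex) 0 \<noteq> (0 :: complex)" using bform_var by simp_all
  have l: "bform (mult i) (\<lambda>x. lin (xi i) x ^ mult i)" for i using bform_power[OF bform_lin, of "mult i"] by simp
  have "\<exists>x. lin (xi i) x ^ mult i \<noteq> 0" for i using lin_nonzero[OF xi_nonz[of i]] by auto
  then obtain y where y: "\<And>i. lin (xi i) (y i) ^ mult i \<noteq> 0" by metis
  define Z where "Z = {P\<in>C. ord P \<noteq> 0} \<union> {P \<in> C. A (cv.pt P) = 0} \<union> {P \<in> C. B (cv.pt P) = 0} \<union>
    {P \<in> C. (\<lambda>x. x 0) (cv.pt P) = 0} \<union> {P \<in> C. f 0 (cv.pt P) = 0} \<union> (\<Union>i. {P \<in> C. lin (xi i) (cv.pt P) ^ mult i = 0})"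
  have Z: "finite Z" "Z \<subseteq> C"
    unfolding Z_def
    using fin cv.finite_zeros[OF A] cv.finite_zeros[OF B] cv.finite_zeros[OF X(1), of "\<lambda>_. 1"] cv.finite_zeros[OF f_form w] cv.finite_zeros[OF l y]
    by auto
  have sums: "(\<Sum>P\<in>Z. vord (cv.pt P) A) = n" "(\<Sum>P\<in>Z. vord (cv.pt P) B) = n"
    "(\<Sum>P\<in>Z. vord (cv.pt P) (\<lambda>x. x 0)) = 1" "(\<Sum>P\<in>Z. vord (cv.pt P) (f 0)) = e"
    "\<And>i. (\<Sum>P\<in>Z. vord (cv.pt P) (\<lambda>x. lin (xi i) x ^ mult i)) = mult i"
  proof -
    show "(\<Sum>P\<in>Z. vord (cv.pt P) A) = n" by (rule cv.sum_vord_pt[OF A Z]) (simp add: Z_def)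
    show "(\<Sum>P\<in>Z. vord (cv.pt P) B) = n" by (rule cv.sum_vord_pt[OF B Z]) (simp add: Z_def)
    show "(\<Sum>P\<in>Z. vord (cv.pt P) (\<lambda>x. x 0)) = 1"
      by (rule cv.sum_vord_pt[OF X Z]) (simp add: Z_def)
    show "(\<Sum>P\<in>Z. vord (cv.pt P) (f 0)) = e" by (rule cv.sum_vord_pt[OF f_form w Z]) (simp add: Z_def)
    show "(\<Sum>P\<in>Z. vord (cv.pt P) (\<lambda>x. lin (xi i) x ^ mult i)) = mult i" for i
      by (rule cv.sum_vord_pt[OF l y Z]) (auto simp: Z_def)
  qed
  have "(\<Sum>P\<in>Z. k P) = \<alpha> * int (\<Sum>P\<in>Z. vord (cv.pt P) (\<lambda>x. x 0)) + \<beta> * int (\<Sum>P\<in>Z. vord (cv.pt P) (f 0)) +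
     (\<Sum>i\<in>UNIV. c i * int (\<Sum>P\<in>Z. vord (cv.pt P) (\<lambda>x. lin (xi i) x ^ mult i)))"
    unfolding k_def by (simp add: sum.distrib sum_distrib_left sum.swap[of _ Z])
  then have sumk: "(\<Sum>P\<in>Z. k P) = \<alpha> + \<beta> * int e + (\<Sum>i\<in>UNIV. c i * int (mult i))" unfolding sums by simp
  have "(\<Sum>P\<in>Z. int (vord (cv.pt P) A) - int (vord (cv.pt P) B) - k P) \<le> (\<Sum>P\<in>Z. ord P)"
    using lower Z(2) by (intro sum_mono) blast
  also have "(\<Sum>P\<in>Z. ord P) = (\<Sum>P \<in> {P\<in>C. ord P \<noteq> 0}. ord P)"
    by (rule sum.mono_neutral_right) (use Z in \<open>auto simp: Z_def\<close>)
  finally have "(\<Sum>P\<in>Z. int (vord (cv.pt P) A) - int (vord (cv.pt P) B) - k P) \<le> 0" using sum0 by simp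
  moreover have "(\<Sum>P\<in>Z. int (vord (cv.pt P) A) - int (vord (cv.pt P) B) - k P) =
     int (\<Sum>P\<in>Z. vord (cv.pt P) A) - int (\<Sum>P\<in>Z. vord (cv.pt P) B) - (\<Sum>P\<in>Z. k P)"
    by (simp add: sum_subtractf)
  ultimately show ?thesis unfolding sums sumk by (simp add: mult.commute)
qed

end

section \<open>Curves through a general point\<close>

text \<open>The images of the four points in projective 3-space are a basis, up to scalars.\<close>

locale general_points = four_points +
  assumes det_nonzero: "det (\<chi> i k. a i (YVar k)) \<noteq> (0 :: complex)"
begin

definition Y :: "complex ^ 4 ^ 4" where "Y = (\<chi> i k. a i (YVar k))"

text \<open>The coordinates with respect to the basis given by the four points.\<close>

definition eta :: "4 \<Rightarrow> (yvar \<Rightarrow> complex) \<Rightarrow> complex" where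
  "eta l z = (\<Sum>k\<in>UNIV. matrix_inv Y $ k $ l * z (YVar k))"

lemma Y_inv: "Y ** matrix_inv Y = mat 1" "matrix_inv Y ** Y = mat 1"
proof -
  have "invertible Y" using det_nonzero by (simp add: invertible_det_nz Y_def)
  then have "Y ** matrix_inv Y = mat 1 \<and> matrix_inv Y ** Y = mat 1"
    unfolding invertible_def matrix_inv_def by (rule someI_ex)
  then show "Y ** matrix_inv Y = mat 1" "matrix_inv Y ** Y = mat 1" by blast+
qed

lemma eta_expansion: "z (YVar k) = (\<Sum>l\<in>UNIV. eta l z * a l (YVar k))"
proof -
  have "(\<Sum>l\<in>UNIV. eta l z * a l (YVar k)) = (\<Sum>l\<in>UNIV. \<Sum>k'\<in>UNIV. z (YVar k') * (matrix_inv Y $ k' $ l * Y $ l $ k))"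
    by (simp add: eta_def Y_def sum_distrib_left sum_distrib_right mult_ac)
  also have "\<dots> = (\<Sum>k'\<in>UNIV. z (YVar k') * (\<Sum>l\<in>UNIV. matrix_inv Y $ k' $ l * Y $ l $ k))"
    by (subst sum.swap) (simp add: sum_distrib_left)
  also have "\<dots> = (\<Sum>k'\<in>UNIV. z (YVar k') * (matrix_inv Y ** Y) $ k' $ k)"
    by (simp add: matrix_matrix_mult_def)
  also have "\<dots> = z (YVar k)" unfolding Y_inv by (simp add: mat_def if_distrib[of "\<lambda>x. _ * x"] cong: if_cong)
  finally show ?thesis by simp
qed

lemma eta_combination:
  assumes "\<And>k. z (YVar k) = (\<Sum>i\<in>UNIV. c i * a i (YVar k))"
  shows "eta l z = c l"
proof -
  have "eta l z = (\<Sum>k\<in>UNIV. \<Sum>i\<in>UNIV. c i * (Y $ i $ k * matrix_inv Y $ k $ l))"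
    by (simp add: eta_def assms Y_def sum_distrib_left sum_distrib_right mult_ac)
  also have "\<dots> = (\<Sum>i\<in>UNIV. c i * (\<Sum>k\<in>UNIV. Y $ i $ k * matrix_inv Y $ k $ l))"
    by (subst sum.swap) (simp add: sum_distrib_left)
  also have "\<dots> = (\<Sum>i\<in>UNIV. c i * (Y ** matrix_inv Y) $ i $ l)"
    by (simp add: matrix_matrix_mult_def)
  also have "\<dots> = c l" unfolding Y_inv by (simp add: mat_def if_distrib[of "\<lambda>x. _ * x"] cong: if_cong)
  finally show ?thesis .
qed

lemma eta_a: "eta l (a i) = (if l = i then 1 else 0)"
  by (rule eta_combination[of "a i" "\<lambda>l. if l = i then 1 else 0"])
    (simp add: if_distrib[of "\<lambda>x. x * _"] cong: if_cong)

lemma form_eta: "form yfac (\<lambda>b. if b = FacP3 then 1 else 0) (eta l)"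
  unfolding eta_def[abs_def] by (intro form_sum form_cmult form_var') auto

lemma xi_distinct: "i \<noteq> j \<Longrightarrow> lin (xi i) (xi j) \<noteq> 0"
  using x_distinct[of i j] by (auto simp: lin_def xi_def mult.commute)

text \<open>Here \<open>u\<close> is the projection of a general point \<open>z\<close> of the blowup. The curve is \<open>x \<mapsto> (x, \<Sum>l. g l x * a l)\<close>; it contains the
  \<open>i\<close>-th point if and only if all \<open>g l\<close> except \<open>g i\<close> vanish at \<^term>\<open>xi i\<close>. Multiplication of the \<open>g l\<close> by constants does not
  affect their zeros, and so the curve can be made to pass through \<open>z\<close>.\<close>

lemma curve_inequality:
  assumes eff: "effective afac S D" and num: "numerically_equivalent afac S D (combination p \<alpha> \<beta> c)"
  shows "\<exists>u. nonz u \<and> (\<forall>i. lin (xi i) u \<noteq> 0) \<and> (\<forall>e g. (\<forall>l. bform e (g l)) \<longrightarrow> (\<forall>l. g l u \<noteq> 0) \<longrightarrow>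
     (\<forall>x. nonz x \<longrightarrow> (\<exists>l. g l x \<noteq> 0)) \<longrightarrow>
     0 \<le> \<alpha> + int e * \<beta> + (\<Sum>i | \<forall>l. l \<noteq> i \<longrightarrow> g l (xi i) = 0. c i))"
proof -
  obtain d V z0 where V: "form yfac d V" "V z0 \<noteq> 0" and Vgen:
    "\<And>z h. valid z \<Longrightarrow> V z \<noteq> 0 \<Longrightarrow> regular_at afac S (graph z) h \<Longrightarrow> rat_eq afac S (D (graph z)) h \<Longrightarrow> h (graph z) \<noteq> 0"
    using effective_general_point[OF eff] by blast
  obtain z1 where "valid z1" using ex_valid by blast
  then obtain d' W where W: "form yfac d' W" "W z1 \<noteq> 0" "\<And>w. W w \<noteq> 0 \<Longrightarrow> valid w" using valid_form by blast
  define L where "L = (\<lambda>i (z :: yvar \<Rightarrow> complex). lin (xi i) (\<lambda>j. z (XVar j)))"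
  have L: "form yfac (\<lambda>b. if b = FacP1 then 1 else 0) (L i)" for i
    unfolding L_def lin_def
    using form_diff[OF form_cmult[OF form_var', of _ yfac "XVar 0" "xi i 1"] form_cmult[OF form_var', of _ yfac "XVar 1" "xi i 0"]]
    by (simp add: mult.commute)
  have L0: "\<exists>w. L i w \<noteq> 0" for i
  proof -
    obtain x0 where "lin (xi i) x0 \<noteq> 0" using lin_nonzero[OF xi_nonz[of i]] by blast
    then show ?thesis unfolding L_def by (intro exI[of _ "\<lambda>v. case v of XVar j \<Rightarrow> x0 j | YVar _ \<Rightarrow> 0"]) simp
  qed
  have "\<exists>z. \<forall>F\<in>{V, W, \<lambda>z. z (YVar 0)} \<union> range eta \<union> range L. F z \<noteq> 0"
  proof (rule forms_common_nonzero[where g = yfac])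
    fix F assume "F \<in> {V, W, \<lambda>z. z (YVar 0)} \<union> range eta \<union> range L"
    then show "\<exists>d. form yfac d F" using V W form.var[of yfac "YVar 0"] form_eta L by auto
  next
    fix F assume F: "F \<in> {V, W, \<lambda>z. z (YVar 0)} \<union> range eta \<union> range L"
    have "(\<lambda>z. z (YVar 0)) (\<lambda>_. 1 :: complex) \<noteq> 0" by simp
    moreover have "eta l (a l) \<noteq> 0" for l by (simp add: eta_a)
    ultimately show "\<exists>w. F w \<noteq> 0" using F V(2) W(2) L0 by fastforce
  qed simp
  then obtain z where z0: "\<forall>F\<in>{V, W, \<lambda>z. z (YVar 0)} \<union> range eta \<union> range L. F z \<noteq> 0" ..
  then have z: "V z \<noteq> 0" "W z \<noteq> 0" "z (YVar 0) \<noteq> 0" "\<And>l. eta l z \<noteq> 0" "\<And>i. L i z \<noteq> 0" by auto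
  define u where "u = (\<lambda>j. z (XVar j))"
  have u: "lin (xi i) u \<noteq> 0" for i using z(5)[of i] by (simp add: L_def u_def)
  then have nu: "nonz u" using u[of 0] by (auto simp: lin_def)
  have "0 \<le> \<alpha> + int e * \<beta> + (\<Sum>i | \<forall>l. l \<noteq> i \<longrightarrow> g l (xi i) = 0. c i)"
    if g: "\<forall>l. bform e (g l)" "\<forall>l. g l u \<noteq> 0" "\<forall>x. nonz x \<longrightarrow> (\<exists>l. g l x \<noteq> 0)" for e g
  proof -
    define G where "G l x = eta l z / g l u * g l x" for l x
    have G0: "G l x = 0 \<longleftrightarrow> g l x = 0" for l x using z(4) g(2) by (simp add: G_def)
    define f where "f k x = (\<Sum>l\<in>UNIV. a l (YVar k) * G l x)" for k x
    have f: "bform e (f k)" for k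
      unfolding f_def[abs_def] G_def using g(1) by (intro form_sum form_cmult) auto
    define fv where "fv x v = (case v of XVar j \<Rightarrow> x j | YVar k \<Rightarrow> f k x)" for x :: "2 \<Rightarrow> complex" and v
    have eta_f: "eta l (fv x) = G l x" for l x
      by (rule eta_combination) (simp add: fv_def f_def mult.commute)
    have fnz: "\<exists>k. f k x \<noteq> 0" if "nonz x" for x
    proof (rule ccontr)
      assume "\<not> ?thesis"
      then have "eta l (fv x) = 0" for l by (simp add: eta_def fv_def)
      then show False using eta_f G0 g(3) that by metis
    qed
    interpret bc: blowup_curve a f e
      by unfold_locales (use f fnz in auto)
    have bv: "bc.bv x = fv x" for x by (simp add: bc.bv_def fv_def fun_eq_iff)
    have bvu: "bc.bv u = z"
    proof
      fix v show "bc.bv u v = z v"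
      proof (cases v)
        case (XVar j) then show ?thesis by (simp add: u_def)
      next
        case (YVar k)
        have "f k u = (\<Sum>l\<in>UNIV. eta l z * a l (YVar k))"
          unfolding f_def G_def using g(2) by (simp add: mult.commute)
        then show ?thesis using YVar eta_expansion[of z k] by simp
      qed
    qed
    have gu: "bc.cv.\<gamma> u = graph z" using bc.curve_point_graph[OF nu u] bvu by simp
    have T: "i \<in> bc.T \<longleftrightarrow> (\<forall>l. l \<noteq> i \<longrightarrow> g l (xi i) = 0)" for i
    proof
      assume "i \<in> bc.T"
      then have "bc.bv (xi i) \<in> mpoint yfac (a i)" by (simp add: bc.T_def p_def)
      then obtain t where "bc.bv (xi i) = (\<lambda>v. t (yfac v) * a i v)" by (auto elim: mpointE)
      then have "fv (xi i) (YVar k) = t FacP3 * a i (YVar k)" for k by (simp add: bv)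
      then have "eta l (fv (xi i)) = t FacP3 * eta l (a i)" for l
        by (simp add: eta_def sum_distrib_left mult.left_commute)
      then have "G l (xi i) = 0" if "l \<noteq> i" for l using that by (simp add: eta_f eta_a)
      then show "\<forall>l. l \<noteq> i \<longrightarrow> g l (xi i) = 0" using G0 by blast
    next
      assume zero: "\<forall>l. l \<noteq> i \<longrightarrow> g l (xi i) = 0"
      then have nz: "G i (xi i) \<noteq> 0" using g(3) xi_nonz[of i] G0 by metis
      have fk: "f k (xi i) = G i (xi i) * a i (YVar k)" for k
      proof -
        have "f k (xi i) = (\<Sum>l\<in>UNIV. if l = i then G i (xi i) * a i (YVar k) else 0)"
          unfolding f_def using zero G0 by (intro sum.cong) auto
        then show ?thesis by simp
      qed
      have "bc.bv (xi i) \<in> mpoint yfac (a i)"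
      proof (rule mpointI[of "\<lambda>b. if b = FacP1 then 1 else G i (xi i)"])
        show "bc.bv (xi i) = (\<lambda>k. (if yfac k = FacP1 then 1 else G i (xi i)) * a i k)"
        proof
          fix v show "bc.bv (xi i) v = (if yfac v = FacP1 then 1 else G i (xi i)) * a i v"
            by (cases v) (simp_all add: fk, simp add: xi_def)
        qed
      qed (use nz in auto)
      then show "i \<in> bc.T" by (simp add: bc.T_def p_def)
    qed
    have "f 0 u \<noteq> 0" using bvu z(3) by (metis bc.bv_simps(2))
    from bc.degree_nonneg[OF eff num nu _ this]
    have "0 \<le> \<alpha> + int e * \<beta> + (\<Sum>i\<in>UNIV. c i * int (bc.mult i))"
      unfolding gu using Vgen[OF W(3)[OF z(2)] z(1)] by blast
    also have "(\<Sum>i\<in>UNIV. c i * int (bc.mult i)) = (\<Sum>i\<in>UNIV. if i \<in> bc.T then c i else 0)"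
      by (intro sum.cong) (auto simp: bc.mult_def)
    also have "\<dots> = (\<Sum>i\<in>bc.T. c i)" by (simp add: sum.If_cases)
    also have "bc.T = {i. \<forall>l. l \<noteq> i \<longrightarrow> g l (xi i) = 0}" using T by blast
    finally show ?thesis .
  qed
  then show ?thesis using u nu by blast
qed

lemma bform_prod_lin: "bform (card T) (\<lambda>x. \<Prod>i\<in>T. lin (xi i) x)" if "finite T" for T
proof -
  have "form (\<lambda>_. ()) (\<lambda>_. \<Sum>i\<in>T. 1) (\<lambda>x. \<Prod>i\<in>T. lin (xi i) x)"
    by (rule form_prod[OF that]) (rule bform_lin)
  then show ?thesis by simp
qed

lemma lin_xi_zero_imp:
  assumes "nonz x" "lin (xi i) x = 0" "lin (xi j) x = 0" shows "i = j"
proof (rule ccontr)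
  assume "i \<noteq> j"
  obtain t where t: "t \<noteq> 0" "x = (\<lambda>k. t * xi i k)" using lin_zero_scale[OF xi_nonz assms(1,2)] by blast
  have "lin (xi j) x = t * lin (xi j) (xi i)" by (simp add: t(2) lin_def algebra_simps)
  then show False using assms(3) t(1) xi_distinct[of j i] \<open>i \<noteq> j\<close> by simp
qed

context
  fixes D \<alpha> \<beta> c
  assumes eff: "effective afac S D" and num: "numerically_equivalent afac S D (combination p \<alpha> \<beta> c)"
begin

text \<open>Two of the coordinates \<open>g l\<close> are powers of one linear form, the other two are powers of another one. They have no common
  zero, and at none of the points \<^term>\<open>xi i\<close> do three of them vanish.\<close>

lemma inequality_none: "0 \<le> \<alpha> + int e * \<beta>"
proof -
  obtain u where u: "nonz u" "\<And>i. lin (xi i) u \<noteq> 0" and ineq: "\<And>e g. (\<forall>l. bform e (g l)) \<Longrightarrow> (\<forall>l. g l u \<noteq> 0) \<Longrightarrow>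
     (\<forall>x. nonz x \<longrightarrow> (\<exists>l. g l x \<noteq> 0)) \<Longrightarrow> 0 \<le> \<alpha> + int e * \<beta> + (\<Sum>i | \<forall>l. l \<noteq> i \<longrightarrow> g l (xi i) = 0. c i)"
    using curve_inequality[OF eff num] by blast
  define b :: "4 \<Rightarrow> 4" where "b l = (if l \<in> {0, 1} then 0 else 1)" for l
  define g where "g l x = lin (xi (b l)) x ^ e" for l x
  have ne: "(0::4) \<noteq> 1" "(0::4) \<noteq> 2" "(0::4) \<noteq> 3" "(1::4) \<noteq> 2" "(1::4) \<noteq> 3" "(2::4) \<noteq> 3" by simp_all
  have b: "b 0 = 0" "b 1 = 0" "b 2 = 1" "b 3 = 1" by (simp_all add: b_def)
  have "0 \<le> \<alpha> + int e * \<beta> + (\<Sum>i | \<forall>l. l \<noteq> i \<longrightarrow> g l (xi i) = 0. c i)"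
  proof (rule ineq; intro allI impI)
    show "bform e (g l)" for l unfolding g_def[abs_def] using bform_power[OF bform_lin, of e] by simp
    show "g l u \<noteq> 0" for l using u by (simp add: g_def)
    show "\<exists>l. g l x \<noteq> 0" if "nonz x" for x
    proof (cases "lin (xi 0) x = 0")
      case True
      then have "lin (xi 1) x \<noteq> 0" using lin_xi_zero_imp[OF that, of 0 1] ne by auto
      then show ?thesis using b by (intro exI[of _ 2]) (simp add: g_def)
    next
      case False
      then show ?thesis using b by (intro exI[of _ 0]) (simp add: g_def)
    qed
  qed
  moreover have "\<not> (\<forall>l. l \<noteq> i \<longrightarrow> g l (xi i) = 0)" for i
  proof
    assume zero: "\<forall>l. l \<noteq> i \<longrightarrow> g l (xi i) = 0"
    show False
    proof (cases "i = 0")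
      case True
      then have "g 2 (xi i) = 0" using zero ne by auto
      then show False using b xi_distinct[of 1 i] True ne by (simp add: g_def)
    next
      case False
      have "g 0 (xi i) \<noteq> 0" using b xi_distinct[of 0 i] False by (simp add: g_def)
      then show False using zero False by auto
    qed
  qed
  ultimately show ?thesis by simp
qed

text \<open>Lagrange interpolation: \<open>g l\<close> is the product of the linear forms of the other points in \<^term>\<open>T\<close>, so that only \<open>g i\<close> survives at
  \<^term>\<open>xi i\<close>. For \<open>l \<in> T\<close> one linear factor is still free; a zero at \<open>xi (b l)\<close> with \<open>b l \<noteq> l\<close> keeps the \<open>g l\<close> free of common zeros. The
  curve must also avoid the remaining points. If \<^term>\<open>T\<close> has at least two elements, this follows from \<open>b l \<in> T\<close> for \<open>l \<in> T\<close>;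
  otherwise there is, for each remaining point, a further index outside \<^term>\<open>T\<close>, whose \<open>g l\<close> does not vanish there.\<close>

lemma inequality_some:
  assumes T: "T \<noteq> {}" "card T \<le> 3"
  shows "0 \<le> \<alpha> + int (card T) * \<beta> + (\<Sum>i\<in>T. c i)"
proof -
  obtain u where u: "nonz u" "\<And>i. lin (xi i) u \<noteq> 0" and ineq: "\<And>e g. (\<forall>l. bform e (g l)) \<Longrightarrow> (\<forall>l. g l u \<noteq> 0) \<Longrightarrow>
     (\<forall>x. nonz x \<longrightarrow> (\<exists>l. g l x \<noteq> 0)) \<Longrightarrow> 0 \<le> \<alpha> + int e * \<beta> + (\<Sum>i | \<forall>l. l \<noteq> i \<longrightarrow> g l (xi i) = 0. c i)"
    using curve_inequality[OF eff num] by blast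
  have fin: "finite T" by simp
  have "\<exists>b. b \<noteq> l \<and> (card T \<ge> 2 \<longrightarrow> b \<in> T)" for l
  proof (cases "card T \<ge> 2")
    case True
    then have "\<not> T \<subseteq> {l}" using card_mono[of "{l}" T] by auto
    then show ?thesis by blast
  next
    case False
    have "(UNIV :: 4 set) \<noteq> {l}" by (metis UNIV_I singletonD zero_neq_one)
    then show ?thesis using False by auto
  qed
  then obtain b where b: "\<And>l. b l \<noteq> l" "\<And>l. card T \<ge> 2 \<Longrightarrow> b l \<in> T" by metis
  define g where "g l x = (if l \<in> T then (\<Prod>i\<in>T - {l}. lin (xi i) x) * lin (xi (b l)) x else (\<Prod>i\<in>T. lin (xi i) x))" for l x
  have T1: "card T \<ge> 1" using T(1) by (simp add: Suc_le_eq card_gt_0_iff)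
  have "card T < CARD(4)" using T(2) by simp
  then obtain j0 where j0: "j0 \<notin> T" by (metis UNIV_eq_I less_irrefl)
  have form: "bform (card T) (g l)" for l
  proof (cases "l \<in> T")
    case True
    have "bform (card (T - {l}) + 1) (\<lambda>x. (\<Prod>i\<in>T - {l}. lin (xi i) x) * lin (xi (b l)) x)"
      by (intro bform_mult bform_prod_lin bform_lin) simp
    moreover have "card (T - {l}) + 1 = card T" using True T1 by simp
    ultimately show ?thesis using True by (simp add: g_def[abs_def])
  next
    case False
    then show ?thesis using bform_prod_lin[OF fin] by (simp add: g_def[abs_def])
  qed
  have nz: "\<exists>l. g l x \<noteq> 0" if x: "nonz x" for x
  proof (cases "\<exists>i\<in>T. lin (xi i) x = 0")
    case True
    then obtain i where i: "i \<in> T" "lin (xi i) x = 0" by blast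
    have "lin (xi l) x \<noteq> 0" if "l \<noteq> i" for l using lin_xi_zero_imp[OF x i(2)] that by blast
    then have "g i x \<noteq> 0" using i(1) b(1)[of i] by (auto simp: g_def prod_zero_iff)
    then show ?thesis by blast
  next
    case False
    then have "g j0 x \<noteq> 0" using j0 by (auto simp: g_def prod_zero_iff)
    then show ?thesis by blast
  qed
  have "0 \<le> \<alpha> + int (card T) * \<beta> + (\<Sum>i | \<forall>l. l \<noteq> i \<longrightarrow> g l (xi i) = 0. c i)"
  proof (rule ineq; intro allI impI)
    show "bform (card T) (g l)" for l by (rule form)
    show "g l u \<noteq> 0" for l using u by (auto simp: g_def prod_zero_iff)
  qed (rule nz)
  moreover have "(\<forall>l. l \<noteq> i \<longrightarrow> g l (xi i) = 0) \<longleftrightarrow> i \<in> T" for i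
  proof
    assume i: "i \<in> T"
    show "\<forall>l. l \<noteq> i \<longrightarrow> g l (xi i) = 0" using i by (auto simp: g_def prod_zero_iff intro: bexI[of _ i])
  next
    assume zero: "\<forall>l. l \<noteq> i \<longrightarrow> g l (xi i) = 0"
    show "i \<in> T"
    proof (rule ccontr)
      assume i: "i \<notin> T"
      have away: "lin (xi l) (xi i) \<noteq> 0" if "l \<noteq> i" for l using xi_distinct[OF that] .
      then have awayT: "\<forall>m\<in>T. lin (xi m) (xi i) \<noteq> 0" using i by metis
      show False
      proof (cases "card T \<ge> 2")
        case True
        obtain l where l: "l \<in> T" using T(1) by blast
        have "g l (xi i) \<noteq> 0" using l b(2)[OF True, of l] awayT by (auto simp: g_def prod_zero_iff)
        then show False using zero l i by auto
      next
        case False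
        then have "card (insert i T) < CARD(4)" using i by simp
        then obtain l where l: "l \<notin> insert i T" by (metis UNIV_eq_I less_irrefl)
        have "g l (xi i) \<noteq> 0" using l awayT by (auto simp: g_def prod_zero_iff)
        then show False using zero l by auto
      qed
    qed
  qed
  ultimately show ?thesis by simp
qed

text \<open>Twisted cubics: at \<^term>\<open>xi i\<close> all the products \<open>g l\<close> vanish, except for \<open>g i\<close>.\<close>

lemma inequality_all: "0 \<le> \<alpha> + 3 * \<beta> + (\<Sum>i\<in>UNIV. c i)"
proof -
  obtain u where u: "nonz u" "\<And>i. lin (xi i) u \<noteq> 0" and ineq: "\<And>e g. (\<forall>l. bform e (g l)) \<Longrightarrow> (\<forall>l. g l u \<noteq> 0) \<Longrightarrow>
     (\<forall>x. nonz x \<longrightarrow> (\<exists>l. g l x \<noteq> 0)) \<Longrightarrow> 0 \<le> \<alpha> + int e * \<beta> + (\<Sum>i | \<forall>l. l \<noteq> i \<longrightarrow> g l (xi i) = 0. c i)"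
    using curve_inequality[OF eff num] by blast
  define g where "g l x = (\<Prod>i\<in>UNIV - {l}. lin (xi i) x)" for l x
  have "0 \<le> \<alpha> + int 3 * \<beta> + (\<Sum>i | \<forall>l. l \<noteq> i \<longrightarrow> g l (xi i) = 0. c i)"
  proof (rule ineq; intro allI impI)
    show "bform 3 (g l)" for l
      using bform_prod_lin[of "UNIV - {l}"] by (simp add: g_def[abs_def] card_Diff_singleton)
    show "g l u \<noteq> 0" for l using u by (simp add: g_def prod_zero_iff)
    fix x :: "2 \<Rightarrow> complex" assume x: "nonz x"
    show "\<exists>l. g l x \<noteq> 0"
    proof (cases "\<exists>i. lin (xi i) x = 0")
      case True
      then obtain i where i: "lin (xi i) x = 0" by blast
      have "lin (xi l) x \<noteq> 0" if "l \<noteq> i" for l using lin_xi_zero_imp[OF x i] that by blast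
      then show ?thesis by (intro exI[of _ i]) (simp add: g_def prod_zero_iff)
    qed (simp add: g_def prod_zero_iff)
  qed
  moreover have "g l (xi i) = 0" if "l \<noteq> i" for i l
    using that by (auto simp: g_def prod_zero_iff intro!: bexI[of _ i])
  ultimately show ?thesis by simp
qed

end

end

section \<open>The cone\<close>

definition cone_ineq :: "real \<Rightarrow> real \<Rightarrow> (4 \<Rightarrow> real) \<Rightarrow> bool" where
  "cone_ineq d1 d2 m \<longleftrightarrow> 0 \<le> d1 \<and> 0 \<le> d2 \<and>
     (\<forall>T. T \<noteq> {} \<longrightarrow> card T \<le> 3 \<longrightarrow> sum m T \<le> d1 + real (card T) * d2) \<and> sum m UNIV \<le> d1 + 3 * d2"

definition class_of :: "real \<Rightarrow> real \<Rightarrow> (4 \<Rightarrow> real) \<Rightarrow> N1" where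
  "class_of d1 d2 m = d1 *\<^sub>R H1_class + d2 *\<^sub>R H2_class - (\<Sum>i\<in>UNIV. m i *\<^sub>R E_class i)"

definition generators :: "N1 set" where
  "generators = range E_class \<union> range (\<lambda>i. H1_class - E_class i) \<union>
       {H2_class - E_class i - E_class j - E_class k | i j k. i < j \<and> j < k}"

lemma ex_bij_image:
  fixes A B :: "'a::finite set"
  assumes "card A = card B" shows "\<exists>\<sigma>. bij \<sigma> \<and> \<sigma> ` A = B"
proof -
  obtain f where f: "bij_betw f A B" using finite_same_card_bij[of A B] assms by auto
  have "card (- A) = card (- B)" using assms by (simp add: Compl_eq_Diff_UNIV card_Diff_subset)
  then obtain g where g: "bij_betw g (- A) (- B)" using finite_same_card_bij[of "- A" "- B"] by auto
  have "bij_betw (\<lambda>x. if x \<in> A then f x else g x) (A \<union> - A) (B \<union> - B)"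
    by (rule bij_betw_disjoint_Un[OF f g]) auto
  moreover have "(\<lambda>x. if x \<in> A then f x else g x) ` A = B" using f by (auto simp: bij_betw_def)
  ultimately show ?thesis by (intro exI[of _ "\<lambda>x. if x \<in> A then f x else g x"]) simp
qed

lemma sum_permuted: "bij \<sigma> \<Longrightarrow> sum (\<lambda>i. m (\<sigma> i)) A = sum m (\<sigma> ` A)" for m :: "4 \<Rightarrow> real"
  using sum.reindex[of \<sigma> A m] by (simp add: inj_on_subset[of \<sigma> UNIV] bij_is_inj)

text \<open>Sums over the first few indices, permuted, are sums over arbitrary subsets of the same size.\<close>

lemma cone_ineq_iff:
  "cone_ineq d1 d2 m \<longleftrightarrow> (\<forall>\<sigma> :: 4 \<Rightarrow> 4. bij \<sigma> \<longrightarrow>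
          (\<forall>(\<alpha>1, \<alpha>2, \<beta>) \<in>
             {(1, 0, vector [0, 0, 0, 0]), (0, 1, vector [0, 0, 0, 0]),
              (1, 1, vector [1, 0, 0, 0]), (1, 2, vector [1, 1, 0, 0]),
              (1, 3, vector [1, 1, 1, 0]), (1, 3, vector [1, 1, 1, 1])
                :: real \<times> real \<times> (real ^ 4)}.
             \<alpha>1 * d1 + \<alpha>2 * d2 \<ge> (\<Sum>i\<in>UNIV. \<beta> $ i * m (\<sigma> i))))"
proof -
  have vec: "(vector [x, y, z, w] :: real ^ 4) $ 1 = x" "(vector [x, y, z, w] :: real ^ 4) $ 2 = y"
    "(vector [x, y, z, w] :: real ^ 4) $ 3 = z" "(vector [x, y, z, w] :: real ^ 4) $ 4 = w" for x y z w :: real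
    by (simp_all add: vector_def)
  have ne: "(1::4) \<noteq> 2" "(1::4) \<noteq> 3" "(2::4) \<noteq> 3" by simp_all
  have c: "card {1::4} = 1" "card {1::4, 2} = 2" "card {1::4, 2, 3} = 3" using ne by simp_all
  have "(\<forall>\<sigma> :: 4 \<Rightarrow> 4. bij \<sigma> \<longrightarrow> 0 \<le> d1 \<and> 0 \<le> d2 \<and> sum m (\<sigma> ` {1}) \<le> d1 + d2 \<and>
      sum m (\<sigma> ` {1, 2}) \<le> d1 + 2 * d2 \<and> sum m (\<sigma> ` {1, 2, 3}) \<le> d1 + 3 * d2 \<and> sum m UNIV \<le> d1 + 3 * d2) \<longleftrightarrow>
    cone_ineq d1 d2 m" (is "?L \<longleftrightarrow> ?R")
  proof
    assume L: ?L
    have "sum m T \<le> d1 + real (card T) * d2" if T: "T \<noteq> {}" "card T \<le> 3" for T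
    proof -
      have "card T \<ge> 1" using T(1) by (simp add: Suc_le_eq card_gt_0_iff)
      then consider "card {1::4} = card T" | "card {1::4, 2} = card T" | "card {1::4, 2, 3} = card T" using T(2) c by fastforce
      then show ?thesis
      proof cases
        case 1
        then obtain \<sigma> where "bij \<sigma>" "\<sigma> ` {1::4} = T" using ex_bij_image by metis
        then show ?thesis using L 1 c by fastforce
      next
        case 2
        then obtain \<sigma> where "bij \<sigma>" "\<sigma> ` {1::4, 2} = T" using ex_bij_image by metis
        then show ?thesis using L 2 c by fastforce
      next
        case 3
        then obtain \<sigma> where "bij \<sigma>" "\<sigma> ` {1::4, 2, 3} = T" using ex_bij_image by metis
        then show ?thesis using L 3 c by fastforce
      qed
    qed
    then show ?R using L bij_id unfolding cone_ineq_def by blast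
  next
    assume R: ?R
    have "sum m (\<sigma> ` A) \<le> d1 + real (card A) * d2" if "bij \<sigma>" "A \<noteq> {}" "card A \<le> 3" for \<sigma> :: "4 \<Rightarrow> 4" and A
    proof -
      have "card (\<sigma> ` A) = card A" using that by (intro card_image) (auto simp: bij_def inj_on_def)
      then show ?thesis using R that unfolding cone_ineq_def by (metis image_is_empty)
    qed
    note this[of _ "{1}"] this[of _ "{1, 2}"] this[of _ "{1, 2, 3}"]
    then show ?L using R c unfolding cone_ineq_def by auto
  qed
  moreover have "sum m (\<sigma> ` {1}) = m (\<sigma> 1)" "sum m (\<sigma> ` {1, 2}) = m (\<sigma> 1) + m (\<sigma> 2)"
    "sum m (\<sigma> ` {1, 2, 3}) = m (\<sigma> 1) + m (\<sigma> 2) + m (\<sigma> 3)"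
    "sum m UNIV = m (\<sigma> 1) + m (\<sigma> 2) + m (\<sigma> 3) + m (\<sigma> 4)" if "bij \<sigma>" for \<sigma> :: "4 \<Rightarrow> 4"
  proof -
    show "sum m (\<sigma> ` {1}) = m (\<sigma> 1)" by simp
    show "sum m (\<sigma> ` {1, 2}) = m (\<sigma> 1) + m (\<sigma> 2)" "sum m (\<sigma> ` {1, 2, 3}) = m (\<sigma> 1) + m (\<sigma> 2) + m (\<sigma> 3)"
      unfolding sum_permuted[OF that, symmetric] using ne by simp_all
    show "sum m UNIV = m (\<sigma> 1) + m (\<sigma> 2) + m (\<sigma> 3) + m (\<sigma> 4)"
      using sum_permuted[OF that, of m UNIV] that by (simp add: sum_4 bij_is_surj)
  qed
  ultimately show ?thesis by (simp add: sum_4 vec)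
qed

lemma convex_cone_sum:
  "convex_cone K \<Longrightarrow> finite I \<Longrightarrow> (\<And>i. i \<in> I \<Longrightarrow> f i \<in> K) \<Longrightarrow> sum f I \<in> K"
  by (induction I rule: infinite_finite_induct)
    (auto intro: convex_cone_add convex_cone_contains_0)

lemma triple_generator: "H2_class - (\<Sum>i\<in>UNIV. E_class i) + E_class l \<in> generators"
proof -
  have o: "(0::4) < 1" "(1::4) < 2" "(2::4) < 3" "(0::4) < 2" "(1::4) < 3"
    by (simp_all add: less_bit0_def bit0.Rep_0 bit0.Rep_1 bit0.Rep_numeral)
  have s: "(\<Sum>i\<in>UNIV. E_class i) = E_class 0 + E_class 1 + E_class 2 + E_class 3"
  proof -
    have "(4::4) = 0" by simp
    then show ?thesis unfolding sum_4 by (simp only: add_ac)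
  qed
  have 4: "l = 0 \<or> l = 1 \<or> l = 2 \<or> l = 3" using exhaust_4[of l] by auto
  have mem: "H2_class - E_class i - E_class j - E_class k \<in> generators" if "i < j" "j < k" for i j k
    unfolding generators_def using that by blast
  show ?thesis
    using 4 mem[OF o(2) o(3)] mem[OF o(4) o(3)] mem[OF o(1) o(5)] mem[OF o(1) o(2)]
    by (auto simp: s algebra_simps)
qed

text \<open>The part \<open>a i\<close> of \<^term>\<open>m i\<close> is contributed by \<^term>\<open>H1_class - E_class i\<close> and the rest \<open>n i\<close> by the planes through three points, where the
  plane that misses the \<open>i\<close>-th point has the weight \<open>b i\<close>. Weights with sum \<^term>\<open>d2\<close> exist if and only if all \<open>n i\<close> are at most \<^term>\<open>d2\<close> and their
  sum is at most \<^term>\<open>3 * d2\<close>. Suitable \<open>n i\<close> are found by truncation of \<^term>\<open>m i\<close> to the interval from 0 to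
  \<^term>\<open>d2\<close>, followed by a proportional reduction when the sum is still too large. The sum of the \<open>a i\<close> is at most \<^term>\<open>d1\<close> by the inequality for
  the set of all indices with \<^term>\<open>m i > d2\<close>, or for the set of all indices.\<close>

lemma cone_ineq_imp_hull:
  assumes K: "cone_ineq d1 d2 m"
  shows "class_of d1 d2 m \<in> convex_cone hull generators"
proof -
  have d: "0 \<le> d1" "0 \<le> d2" using K by (auto simp: cone_ineq_def)
  have KT: "sum m T \<le> d1 + real (card T) * d2" if "T \<noteq> {}" "card T \<le> 3" for T
    using K that by (simp add: cone_ineq_def)
  define q where "q i = max 0 (m i)" for i
  have q0: "q i \<ge> 0" "q i \<ge> m i" for i by (auto simp: q_def)
  have qT: "sum q T \<le> d1 + min 3 (real (card T)) * d2" for T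
  proof -
    let ?P = "{i\<in>T. m i > 0}"
    have "sum q T = sum q ?P" by (rule sum.mono_neutral_right) (auto simp: q_def)
    also have "\<dots> = sum m ?P" by (rule sum.cong) (auto simp: q_def)
    also have "\<dots> \<le> d1 + min 3 (real (card ?P)) * d2"
    proof (cases "?P = {}")
      case True
      show ?thesis unfolding True using d by simp
    next
      case False
      show ?thesis
      proof (cases "card ?P \<le> 3")
        case True
        then show ?thesis using KT[OF False] by simp
      next
        case False
        have "card ?P \<le> CARD(4)" by (rule card_mono) auto
        then have "card ?P = CARD(4)" using False by simp
        then have "?P = UNIV" by (intro card_subset_eq) simp_all
        then have "sum m ?P = sum m UNIV" by (rule arg_cong)
        also have "\<dots> \<le> d1 + 3 * d2" using K by (simp add: cone_ineq_def)
        finally show ?thesis using False by simp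
      qed
    qed
    also have "\<dots> \<le> d1 + min 3 (real (card T)) * d2"
    proof -
      have "card ?P \<le> card T" by (rule card_mono) auto
      then show ?thesis using d by (intro add_left_mono mult_right_mono) auto
    qed
    finally show ?thesis .
  qed
  define t where "t i = min (q i) d2" for i
  have t: "0 \<le> t i" "t i \<le> d2" "t i \<le> q i" for i using q0 d by (auto simp: t_def)
  define shrink where "shrink = (if sum t UNIV \<le> 3 * d2 then 1 else 3 * d2 / sum t UNIV)"
  have shrink: "0 \<le> shrink" "shrink \<le> 1" using d sum_nonneg[of UNIV t] t by (auto simp: shrink_def divide_le_eq_1)
  define n where "n i = shrink * t i" for i
  have n: "0 \<le> n i" "n i \<le> d2" "n i \<le> q i" for i
  proof -
    show "0 \<le> n i" using shrink t[of i] by (simp add: n_def)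
    have "n i \<le> 1 * t i" unfolding n_def using shrink t[of i] by (intro mult_right_mono) auto
    then show "n i \<le> d2" "n i \<le> q i" using t[of i] by auto
  qed
  have sn: "sum n UNIV = shrink * sum t UNIV" by (simp add: n_def sum_distrib_left)
  define a where "a i = q i - n i" for i
  have a: "0 \<le> a i" for i using n by (simp add: a_def)
  have n3: "sum n UNIV \<le> 3 * d2" and ad: "sum a UNIV \<le> d1"
  proof -
    show "sum n UNIV \<le> 3 * d2"
      unfolding sn using d by (auto simp: shrink_def)
    show "sum a UNIV \<le> d1"
    proof (cases "sum t UNIV \<le> 3 * d2")
      case True
      let ?P = "{i. q i > d2}"
      have "sum a UNIV = (\<Sum>i\<in>UNIV. if i \<in> ?P then q i - d2 else 0)"
        by (rule sum.cong) (use True in \<open>auto simp: a_def n_def shrink_def t_def\<close>)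
      also have "\<dots> = sum q ?P - real (card ?P) * d2" by (simp add: sum.If_cases sum_subtractf)
      also have "\<dots> \<le> d1 + min 3 (real (card ?P)) * d2 - real (card ?P) * d2" using qT[of ?P] by simp
      also have "\<dots> \<le> d1 + real (card ?P) * d2 - real (card ?P) * d2"
        using d by (intro diff_right_mono add_left_mono mult_right_mono) auto
      finally show ?thesis by simp
    next
      case False
      then have "sum t UNIV \<noteq> 0" using d by auto
      then have "sum n UNIV = 3 * d2" unfolding sn using False by (simp add: shrink_def)
      then have "sum a UNIV = sum q UNIV - 3 * d2" by (simp add: a_def sum_subtractf)
      then show ?thesis using qT[of UNIV] by simp
    qed
  qed
  \<comment> \<open>The bounds \<open>d2 - n i\<close> for the weights have a sum of at least \<open>d2\<close>; they are scaled down to the sum \<open>d2\<close>.\<close>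
  define s where "s = sum (\<lambda>i. d2 - n i) UNIV"
  have s: "s \<ge> d2" using n3 by (simp add: s_def sum_subtractf)
  define b where "b i = (d2 - n i) * (d2 / s)" for i
  have ds: "0 \<le> d2 / s" "d2 / s \<le> 1" using s d by (auto simp: divide_le_eq_1)
  have b: "0 \<le> b i" "b i \<le> d2 - n i" for i
  proof -
    show "0 \<le> b i" unfolding b_def using n(2)[of i] ds by (intro mult_nonneg_nonneg) auto
    have "b i \<le> (d2 - n i) * 1" unfolding b_def using n(2)[of i] ds by (intro mult_left_mono) auto
    then show "b i \<le> d2 - n i" by simp
  qed
  have sb: "sum b UNIV = d2"
  proof -
    have "sum b UNIV = (\<Sum>i\<in>UNIV. d2 - n i) * (d2 / s)" unfolding b_def by (rule sum_distrib_right[symmetric])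
    then have "sum b UNIV = s * (d2 / s)" by (simp add: s_def)
    then show ?thesis using s d by (cases "s = 0") auto
  qed
  define r where "r i = a i + d2 - b i - m i" for i
  have r: "0 \<le> r i" for i using b(2)[of i] q0(2)[of i] by (simp add: r_def a_def)
  let ?E = "\<Sum>i\<in>UNIV. E_class i"
  let ?K = "convex_cone hull generators"
  have K: "convex_cone ?K" by (rule convex_cone_convex_cone_hull)
  have gen: "g \<in> ?K" if "g \<in> generators" for g using that by (rule hull_inc)
  have gE: "E_class i \<in> ?K" and gH: "H1_class - E_class i \<in> ?K" for i
    by (rule gen, simp add: generators_def)+
  have "class_of d1 d2 m = (\<Sum>i\<in>UNIV. a i *\<^sub>R (H1_class - E_class i)) +
     ((d1 - sum a UNIV) *\<^sub>R (H1_class - E_class 0) + (d1 - sum a UNIV) *\<^sub>R E_class 0) +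
     (\<Sum>l\<in>UNIV. b l *\<^sub>R (H2_class - ?E + E_class l)) + (\<Sum>i\<in>UNIV. r i *\<^sub>R E_class i)"
  proof -
    have 1: "(\<Sum>i\<in>UNIV. a i *\<^sub>R (H1_class - E_class i)) = sum a UNIV *\<^sub>R H1_class - (\<Sum>i\<in>UNIV. a i *\<^sub>R E_class i)"
      by (simp add: scaleR_diff_right sum_subtractf scaleR_sum_left)
    have 2: "(d1 - sum a UNIV) *\<^sub>R (H1_class - E_class 0) + (d1 - sum a UNIV) *\<^sub>R E_class 0 = d1 *\<^sub>R H1_class - sum a UNIV *\<^sub>R H1_class"
      by (simp add: scaleR_diff_right scaleR_diff_left)
    have "(\<Sum>l\<in>UNIV. b l *\<^sub>R (H2_class - ?E + E_class l)) = sum b UNIV *\<^sub>R (H2_class - ?E) + (\<Sum>l\<in>UNIV. b l *\<^sub>R E_class l)"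
      by (simp add: scaleR_add_right sum.distrib scaleR_sum_left)
    then have 3: "(\<Sum>l\<in>UNIV. b l *\<^sub>R (H2_class - ?E + E_class l)) =
        d2 *\<^sub>R H2_class - (\<Sum>i\<in>UNIV. d2 *\<^sub>R E_class i) + (\<Sum>l\<in>UNIV. b l *\<^sub>R E_class l)"
      unfolding sb by (simp add: scaleR_diff_right scaleR_sum_right)
    have 4: "(\<Sum>i\<in>UNIV. r i *\<^sub>R E_class i) = (\<Sum>i\<in>UNIV. a i *\<^sub>R E_class i) + (\<Sum>i\<in>UNIV. d2 *\<^sub>R E_class i) -
       (\<Sum>i\<in>UNIV. b i *\<^sub>R E_class i) - (\<Sum>i\<in>UNIV. m i *\<^sub>R E_class i)"
      unfolding r_def by (simp only: scaleR_diff_left scaleR_add_left sum.distrib sum_subtractf)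
    show ?thesis unfolding 1 2 3 4 class_of_def by (simp add: algebra_simps)
  qed
  also have "\<dots> \<in> ?K"
    using ad a b(1) r
    by (intro convex_cone_add[OF K] convex_cone_sum[OF K] convex_cone_scaleR[OF K] gE gH gen[OF triple_generator] finite) auto
  finally show ?thesis .
qed

lemma convex_cone_ineq: "convex_cone {class_of d1 d2 m | d1 d2 m. cone_ineq d1 d2 m}"
  unfolding convex_cone_iff
proof (intro conjI ballI allI impI)
  have "cone_ineq 0 0 (\<lambda>_. 0)" "class_of 0 0 (\<lambda>_. 0) = 0" by (simp_all add: cone_ineq_def class_of_def)
  then show "0 \<in> {class_of d1 d2 m | d1 d2 m. cone_ineq d1 d2 m}" by force
next
  fix x y assume "x \<in> {class_of d1 d2 m | d1 d2 m. cone_ineq d1 d2 m}" "y \<in> {class_of d1 d2 m | d1 d2 m. cone_ineq d1 d2 m}"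
  then obtain d1 d2 m d1' d2' m' where *: "x = class_of d1 d2 m" "cone_ineq d1 d2 m" "y = class_of d1' d2' m'" "cone_ineq d1' d2' m'"
    by blast
  have "x + y = class_of (d1 + d1') (d2 + d2') (\<lambda>i. m i + m' i)"
    unfolding *(1,3) class_of_def by (simp add: scaleR_add_left sum.distrib algebra_simps)
  moreover have "cone_ineq (d1 + d1') (d2 + d2') (\<lambda>i. m i + m' i)"
    unfolding cone_ineq_def sum.distrib
  proof (intro conjI allI impI)
    fix T :: "4 set" assume "T \<noteq> {}" "card T \<le> 3"
    then have "sum m T \<le> d1 + real (card T) * d2" "sum m' T \<le> d1' + real (card T) * d2'"
      using *(2,4) by (auto simp: cone_ineq_def)
    then show "sum m T + sum m' T \<le> d1 + d1' + real (card T) * (d2 + d2')" by (simp add: algebra_simps)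
  qed (use *(2,4) in \<open>auto simp: cone_ineq_def\<close>)
  ultimately show "x + y \<in> {class_of d1 d2 m | d1 d2 m. cone_ineq d1 d2 m}" by blast
next
  fix x and c :: real assume "x \<in> {class_of d1 d2 m | d1 d2 m. cone_ineq d1 d2 m}" and c: "0 \<le> c"
  then obtain d1 d2 m where *: "x = class_of d1 d2 m" "cone_ineq d1 d2 m" by blast
  have "c *\<^sub>R x = class_of (c * d1) (c * d2) (\<lambda>i. c * m i)"
    unfolding *(1) class_of_def by (simp add: scaleR_add_right scaleR_diff_right scaleR_sum_right)
  moreover have "cone_ineq (c * d1) (c * d2) (\<lambda>i. c * m i)"
    unfolding cone_ineq_def sum_distrib_left[symmetric]
  proof (intro conjI allI impI)
    fix T :: "4 set" assume "T \<noteq> {}" "card T \<le> 3"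
    then have "c * sum m T \<le> c * (d1 + real (card T) * d2)"
      using *(2) c by (intro mult_left_mono) (auto simp: cone_ineq_def)
    then show "c * sum m T \<le> c * d1 + real (card T) * (c * d2)" by (simp add: algebra_simps)
  next
    have "c * sum m UNIV \<le> c * (d1 + 3 * d2)" using *(2) c by (intro mult_left_mono) (auto simp: cone_ineq_def)
    then show "c * sum m UNIV \<le> c * d1 + 3 * (c * d2)" by (simp add: algebra_simps)
  qed (use *(2) c in \<open>auto simp: cone_ineq_def\<close>)
  ultimately show "c *\<^sub>R x \<in> {class_of d1 d2 m | d1 d2 m. cone_ineq d1 d2 m}" by blast
qed

section \<open>The effective cone\<close>

context general_points
begin

text \<open>Nonnegativity of \<^term>\<open>\<beta>\<close> follows from curves whose degree is larger than \<^term>\<open>\<alpha>\<close>.\<close>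

lemma effective_class_cone:
  assumes eff: "effective afac S D" and num: "numerically_equivalent afac S D (combination p \<alpha> \<beta> c)"
  shows "cone_ineq (of_int \<alpha>) (of_int \<beta>) (\<lambda>i. - of_int (c i))"
  unfolding cone_ineq_def
proof (intro conjI allI impI)
  note none = inequality_none[OF eff num]
  show \<alpha>: "0 \<le> real_of_int \<alpha>" using none[of 0] by simp
  show "0 \<le> real_of_int \<beta>"
  proof (rule ccontr)
    assume "\<not> ?thesis"
    then have "\<beta> \<le> -1" by simp
    then have "(\<alpha> + 1) * \<beta> \<le> (\<alpha> + 1) * (-1)" using \<alpha> by (intro mult_left_mono) auto
    then show False using none[of "nat (\<alpha> + 1)"] \<alpha> by simp
  qed
  show "(\<Sum>i\<in>T. - real_of_int (c i)) \<le> real_of_int \<alpha> + real (card T) * real_of_int \<beta>" if "T \<noteq> {}" "card T \<le> 3" for T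
  proof -
    have "0 \<le> real_of_int (\<alpha> + int (card T) * \<beta> + (\<Sum>i\<in>T. c i))"
      using inequality_some[OF eff num that] by (simp only: of_int_0_le_iff)
    then show ?thesis by (simp add: sum_negf)
  qed
  have "0 \<le> real_of_int (\<alpha> + 3 * \<beta> + (\<Sum>i\<in>UNIV. c i))"
    using inequality_all[OF eff num] by (simp only: of_int_0_le_iff)
  then show "(\<Sum>i\<in>UNIV. - real_of_int (c i)) \<le> real_of_int \<alpha> + 3 * real_of_int \<beta>" by (simp add: sum_negf)
qed

definition eff_classes :: "N1 set" where
  "eff_classes = {of_int a *\<^sub>R H1_class + of_int b *\<^sub>R H2_class + (\<Sum>i\<in>UNIV. of_int (c i) *\<^sub>R E_class i) | a b c.
        \<exists>D. effective afac S D \<and> numerically_equivalent afac S D (combination p a b c)}"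

lemma eff_classesI:
  "effective afac S D \<Longrightarrow> numerically_equivalent afac S D (combination p \<alpha> \<beta> c) \<Longrightarrow>
    x = of_int \<alpha> *\<^sub>R H1_class + of_int \<beta> *\<^sub>R H2_class + (\<Sum>i\<in>UNIV. of_int (c i) *\<^sub>R E_class i) \<Longrightarrow> x \<in> eff_classes"
  unfolding eff_classes_def by blast

lemma Eff_eq: "Eff p = convex_cone hull eff_classes"
  by (simp add: Eff_def eff_classes_def)

lemma sum_E_indicator: "(\<Sum>l\<in>UNIV. of_int (if l \<in> T then -1 else 0) *\<^sub>R E_class l) = - (\<Sum>l\<in>T. E_class l)"
proof -
  have "(\<Sum>l\<in>UNIV. of_int (if l \<in> T then -1 else 0) *\<^sub>R E_class l) = (\<Sum>l\<in>UNIV. if l \<in> T then - E_class l else 0)"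
    by (rule sum.cong) auto
  then show ?thesis by (simp add: sum.If_cases sum_negf)
qed

lemma generators_effective: "generators \<subseteq> eff_classes"
proof
  fix x assume "x \<in> generators"
  then consider i where "x = E_class i" | i where "x = H1_class - E_class i"
    | i j k where "x = H2_class - E_class i - E_class j - E_class k" "i < j" "j < k"
    unfolding generators_def by blast
  then show "x \<in> eff_classes"
  proof cases
    case 1
    have "x = of_int 0 *\<^sub>R H1_class + of_int 0 *\<^sub>R H2_class + (\<Sum>l\<in>UNIV. of_int (if l = i then 1 else 0) *\<^sub>R E_class l)"
      using 1 by (simp add: if_distrib[of of_int] if_distrib[of "\<lambda>x. x *\<^sub>R _"] cong: if_cong)
    moreover obtain D where "effective afac S D" "numerically_equivalent afac S D (combination p 0 0 (\<lambda>l. if l = i then 1 else 0))"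
      using E_class_realized[of i] by blast
    ultimately show ?thesis by (intro eff_classesI)
  next
    case 2
    let ?c = "\<lambda>l. if l \<in> {i} then -1 else 0 :: int"
    define L where "L = lin (xi i) \<circ> (\<lambda>(z :: yvar \<Rightarrow> complex) j. z (XVar j))"
    have "form yfac (\<lambda>b. if b = yfac (XVar 0) then 1 else 0) L"
      unfolding L_def lin_def comp_def
      using form_diff[OF form_cmult[OF form_var', of _ yfac "XVar 0" "xi i 1"] form_cmult[OF form_var', of _ yfac "XVar 1" "xi i 0"]]
      by (simp add: mult.commute)
    moreover obtain j where j: "j \<noteq> i" by (metis (full_types) zero_neq_one)
    then have "L (a j) \<noteq> 0" using xi_distinct[of i j] by (auto simp: L_def xi_def[abs_def])
    moreover have "L (a l) = 0" if "l \<in> {i}" for l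
      using that lin_self[of "xi i"] by (simp add: L_def xi_def[abs_def])
    ultimately obtain D where D: "effective afac S D" "numerically_equivalent afac S D
        (\<lambda>P R. H1_div P R * (\<Prod>l\<in>UNIV. E_div p l P R powi ?c l))"
      using hyperplane_realized[of "XVar 0" L "a j" "{i}", folded H1_div_eq] by blast
    have comb: "combination p 1 0 ?c = (\<lambda>P R. H1_div P R * (\<Prod>l\<in>UNIV. E_div p l P R powi ?c l))"
      by (simp add: combination_def fun_eq_iff)
    have "x = of_int 1 *\<^sub>R H1_class + of_int 0 *\<^sub>R H2_class + (\<Sum>l\<in>UNIV. of_int (?c l) *\<^sub>R E_class l)"
      unfolding sum_E_indicator using 2 by simp
    with D(1) D(2)[folded comb] show ?thesis by (rule eff_classesI)
  next
    case 3
    let ?T = "{i, j, k}"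
    let ?c = "\<lambda>l. if l \<in> ?T then -1 else 0 :: int"
    have ne: "i \<noteq> j" "j \<noteq> k" "i \<noteq> k" using 3 by auto
    then have "card ?T < CARD(4)" by simp
    then obtain l where l: "l \<notin> ?T" by (metis UNIV_eq_I less_irrefl)
    have "form yfac (\<lambda>b. if b = yfac (YVar 0) then 1 else 0) (eta l)" using form_eta[of l] by simp
    moreover have "eta l (a l) \<noteq> 0" by (simp add: eta_a)
    moreover have "eta l (a i') = 0" if "i' \<in> ?T" for i' using l that by (auto simp: eta_a)
    ultimately obtain D where D: "effective afac S D" "numerically_equivalent afac S D
        (\<lambda>P R. H2_div P R * (\<Prod>l\<in>UNIV. E_div p l P R powi ?c l))"
      using hyperplane_realized[of "YVar 0" "eta l" "a l" ?T, folded H2_div_eq] by blast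
    have comb: "combination p 0 1 ?c = (\<lambda>P R. H2_div P R * (\<Prod>l\<in>UNIV. E_div p l P R powi ?c l))"
      by (simp add: combination_def fun_eq_iff)
    have "x = of_int 0 *\<^sub>R H1_class + of_int 1 *\<^sub>R H2_class + (\<Sum>l\<in>UNIV. of_int (?c l) *\<^sub>R E_class l)"
      unfolding sum_E_indicator using 3(1) ne by (simp add: algebra_simps)
    with D(1) D(2)[folded comb] show ?thesis by (rule eff_classesI)
  qed
qed

theorem Eff_general:
  "Eff p = convex_cone hull generators" "Eff p = {class_of d1 d2 m | d1 d2 m. cone_ineq d1 d2 m}"
proof -
  let ?R = "{class_of d1 d2 m | d1 d2 m. cone_ineq d1 d2 m}"
  have "eff_classes \<subseteq> ?R"
  proof
    fix x assume "x \<in> eff_classes"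
    then obtain \<alpha> \<beta> c D where x: "x = of_int \<alpha> *\<^sub>R H1_class + of_int \<beta> *\<^sub>R H2_class + (\<Sum>i\<in>UNIV. of_int (c i) *\<^sub>R E_class i)"
      and D: "effective afac S D" "numerically_equivalent afac S D (combination p \<alpha> \<beta> c)"
      unfolding eff_classes_def by blast
    have "x = class_of (of_int \<alpha>) (of_int \<beta>) (\<lambda>i. - of_int (c i))" unfolding x class_of_def by (simp add: sum_negf)
    then show "x \<in> ?R" using effective_class_cone[OF D] by blast
  qed
  then have 1: "Eff p \<subseteq> ?R" unfolding Eff_eq
    by (rule hull_minimal[where S = convex_cone and s = eff_classes and t = ?R]) (rule convex_cone_ineq)
  have 2: "?R \<subseteq> convex_cone hull generators" using cone_ineq_imp_hull by blast
  have 3: "convex_cone hull generators \<subseteq> Eff p" unfolding Eff_eq by (rule hull_mono[OF generators_effective])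
  show "Eff p = convex_cone hull generators" "Eff p = ?R" using 1 2 3 by blast+
qed

end

section \<open>General position\<close>

definition distinct_x :: "(4 \<times> yvar \<Rightarrow> complex) \<Rightarrow> bool" where
  "distinct_x z \<longleftrightarrow> (\<forall>i j. i \<noteq> j \<longrightarrow> z (i, XVar 0) * z (j, XVar 1) \<noteq> z (i, XVar 1) * z (j, XVar 0))"

text \<open>A single form, so that the quadruples on which it does not vanish are an open set.\<close>

definition general :: "(4 \<times> yvar \<Rightarrow> complex) \<Rightarrow> complex" where
  "general z = (\<Prod>(i, j)\<in>{(i, j). i \<noteq> j}. z (i, XVar 0) * z (j, XVar 1) - z (i, XVar 1) * z (j, XVar 0)) *
     det (\<chi> i k. z (i, YVar k))"

lemma general_iff: "general z \<noteq> 0 \<longleftrightarrow> distinct_x z \<and> det (\<chi> i k. z (i, YVar k)) \<noteq> 0"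
  by (auto simp: general_def distinct_x_def prod_zero_iff)

lemma form_general: "\<exists>d. form qfac d general"
proof -
  let ?F = "\<lambda>(i, j) (z :: 4 \<times> yvar \<Rightarrow> complex). z (i, XVar 0) * z (j, XVar 1) - z (i, XVar 1) * z (j, XVar 0)"
  let ?d = "\<lambda>(i, j) b. (if b = (i, FacP1) then 1 else 0) + (if b = (j, FacP1) then 1 else 0) :: nat"
  have F: "form qfac (?d ij) (?F ij)" for ij
  proof (cases ij)
    case (Pair i j)
    have "form qfac (?d (i, j)) (\<lambda>z. z (i, XVar 0) * z (j, XVar 1) - z (i, XVar 1) * z (j, XVar 0))"
      by (intro form_diff; rule form_mult'[OF form.var form.var]) simp_all
    then show ?thesis by (simp add: Pair)
  qed
  have prod: "form qfac (\<lambda>b. \<Sum>ij\<in>{(i, j). i \<noteq> j}. ?d ij b) (\<lambda>z. \<Prod>ij\<in>{(i, j). i \<noteq> j}. ?F ij z)"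
    by (rule form_prod[OF finite F])
  have det: "form qfac (\<lambda>b. \<Sum>i\<in>UNIV. if b = (i, FacP3) then 1 else 0) (\<lambda>z. det (\<chi> i k. z (i, YVar k)))"
    unfolding det_def
  proof (intro form_sum form_cmult)
    show "finite {p :: 4 \<Rightarrow> 4. p permutes UNIV}" by simp
    show "{p :: 4 \<Rightarrow> 4. p permutes UNIV} \<noteq> {}" using permutes_id by blast
    fix p :: "4 \<Rightarrow> 4"
    have "form qfac (\<lambda>b. \<Sum>i\<in>UNIV. if b = (i, FacP3) then 1 else 0) (\<lambda>z. \<Prod>i\<in>UNIV. (\<lambda>z. z (i, YVar (p i))) z)"
      by (rule form_prod) (auto intro!: form_var')
    then show "form qfac (\<lambda>b. \<Sum>i\<in>UNIV. if b = (i, FacP3) then 1 else 0)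
        (\<lambda>z. \<Prod>i\<in>UNIV. (\<chi> i k. z (i, YVar k)) $ i $ p i)" by simp
  qed
  have "general = (\<lambda>z. (\<Prod>ij\<in>{(i, j). i \<noteq> j}. ?F ij z) * det (\<chi> i k. z (i, YVar k)))"
    by (auto simp: general_def fun_eq_iff split_def)
  then show ?thesis using form.mult[OF prod det] by auto
qed

lemma coords_entry: "coords qfac z \<Longrightarrow> coords yfac (\<lambda>v. z (i, v))"
proof -
  assume z: "coords qfac z"
  show ?thesis unfolding coords_def
  proof
    fix b
    obtain k where k: "qfac k = (i, b)" "z k \<noteq> 0" using z unfolding coords_def by blast
    obtain i' v where "k = (i', v)" by (cases k)
    then show "\<exists>k. yfac k = b \<and> z (i, k) \<noteq> 0" using k by auto
  qed
qed

lemma entry_mpoint: "entry (mpoint qfac z) i = mpoint yfac (\<lambda>v. z (i, v))"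
proof (intro equalityI subsetI)
  fix w assume "w \<in> entry (mpoint qfac z) i"
  then obtain y where y: "y \<in> mpoint qfac z" "w = (\<lambda>v. y (i, v))" by (auto simp: entry_def)
  obtain c where "\<And>b. c b \<noteq> 0" "y = (\<lambda>k. c (qfac k) * z k)" using y(1) unfolding mpoint_def by blast
  then show "w \<in> mpoint yfac (\<lambda>v. z (i, v))" using y(2) by (intro mpointI[of "\<lambda>b. c (i, b)"]) auto
next
  fix w assume "w \<in> mpoint yfac (\<lambda>v. z (i, v))"
  then obtain c where c: "\<And>b. c b \<noteq> 0" "w = (\<lambda>v. c (yfac v) * z (i, v))" by (auto elim: mpointE)
  have "(\<lambda>k. c (snd (qfac k)) * z k) \<in> mpoint qfac z"
    by (rule mpointI[of "\<lambda>b. c (snd b)"]) (use c in auto)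
  moreover have "w = (\<lambda>v. (\<lambda>k. c (snd (qfac k)) * z k) (i, v))" using c by simp
  ultimately show "w \<in> entry (mpoint qfac z) i"
    unfolding entry_def by (intro image_eqI[where x = "\<lambda>k. c (snd (qfac k)) * z k"])
qed

lemma permuted_mpoint:
  assumes "bij \<sigma>"
  shows "(\<lambda>z (i, v). z (\<sigma> i, v)) ` mpoint qfac z = mpoint qfac (\<lambda>(i, v). z (\<sigma> i, v))"
proof (intro equalityI subsetI)
  fix w assume "w \<in> (\<lambda>z (i, v). z (\<sigma> i, v)) ` mpoint qfac z"
  then obtain y where y: "y \<in> mpoint qfac z" "w = (\<lambda>(i, v). y (\<sigma> i, v))" by blast
  obtain c where "\<And>b. c b \<noteq> 0" "y = (\<lambda>k. c (qfac k) * z k)" using y(1) unfolding mpoint_def by blast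
  then show "w \<in> mpoint qfac (\<lambda>(i, v). z (\<sigma> i, v))"
    using y(2) by (intro mpointI[of "\<lambda>(i, b). c (\<sigma> i, b)"]) auto
next
  fix w assume "w \<in> mpoint qfac (\<lambda>(i, v). z (\<sigma> i, v))"
  then obtain c where c: "\<And>b. c b \<noteq> 0" "w = (\<lambda>k. c (qfac k) * (\<lambda>(i, v). z (\<sigma> i, v)) k)" unfolding mpoint_def by blast
  define y where "y = (\<lambda>k. (\<lambda>(i, b). c (inv \<sigma> i, b)) (qfac k) * z k)"
  have "y \<in> mpoint qfac z" unfolding y_def by (rule mpointI[of "\<lambda>(i, b). c (inv \<sigma> i, b)"]) (use c in auto)
  moreover have "w = (\<lambda>(i, v). y (\<sigma> i, v))"
    using assms by (auto simp: c(2) y_def fun_eq_iff bij_is_inj inv_f_f)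
  ultimately show "w \<in> (\<lambda>z (i, v). z (\<sigma> i, v)) ` mpoint qfac z" by (intro image_eqI[where x = y])
qed

lemma general_permuted:
  assumes "bij \<sigma>" "general (\<lambda>(i, v). z (\<sigma> i, v)) \<noteq> 0"
  shows "general z \<noteq> 0"
  unfolding general_iff
proof
  have g: "distinct_x (\<lambda>(i, v). z (\<sigma> i, v))" "det (\<chi> i k. z (\<sigma> i, YVar k)) \<noteq> 0"
    using assms(2) by (auto simp: general_iff)
  show "distinct_x z" unfolding distinct_x_def
  proof (intro allI impI)
    fix i j :: 4 assume "i \<noteq> j"
    obtain i' j' where ij: "i = \<sigma> i'" "j = \<sigma> j'" using assms(1) by (metis bij_pointE)
    then have "i' \<noteq> j'" using \<open>i \<noteq> j\<close> by blast
    then show "z (i, XVar 0) * z (j, XVar 1) \<noteq> z (i, XVar 1) * z (j, XVar 0)"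
      using g(1) unfolding distinct_x_def ij by auto
  qed
  have "\<sigma> permutes UNIV" using assms(1) by (intro bij_imp_permutes) auto
  from det_permute_rows[OF this, of "\<chi> i k. z (i, YVar k)"] g(2)
  show "det (\<chi> i k. z (i, YVar k)) \<noteq> 0" by (auto simp: vec_lambda_eta)
qed

lemma ex_general: "\<exists>z. coords qfac z \<and> general z \<noteq> 0"
proof -
  obtain f :: "4 \<Rightarrow> nat" where f: "inj f" using finite_imp_inj_to_nat_seg[of "UNIV :: 4 set"] by blast
  define z :: "4 \<times> yvar \<Rightarrow> complex" where
    "z = (\<lambda>(i, v). case v of XVar j \<Rightarrow> (if j = 0 then 1 else of_nat (f i)) | YVar k \<Rightarrow> (if i = k then 1 else 0))"
  have "coords qfac z" unfolding coords_def
  proof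
    fix b :: "4 \<times> factor" obtain i c where b: "b = (i, c)" by (cases b)
    show "\<exists>k. qfac k = b \<and> z k \<noteq> 0"
    proof (cases c)
      case FacP1 then show ?thesis using b by (intro exI[of _ "(i, XVar 0)"]) (simp add: z_def)
    next
      case FacP3 then show ?thesis using b by (intro exI[of _ "(i, YVar i)"]) (simp add: z_def)
    qed
  qed
  moreover have "distinct_x z" using f by (auto simp: distinct_x_def z_def inj_def)
  moreover have "(\<chi> i k. z (i, YVar k)) = mat 1" by (simp add: z_def mat_def vec_eq_iff)
  then have "det (\<chi> i k. z (i, YVar k)) \<noteq> 0" by simp
  ultimately show ?thesis using general_iff by blast
qed

theorem theorem5p1:
  shows "in_general_position (\<lambda>p.
    Eff p = convex_cone hull
      (range E_class \<union> range (\<lambda>i. H1_class - E_class i) \<union>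
       {H2_class - E_class i - E_class j - E_class k | i j k. i < j \<and> j < k}) \<and>
    Eff p =
      {d1 *\<^sub>R H1_class + d2 *\<^sub>R H2_class - (\<Sum>i\<in>UNIV. m i *\<^sub>R E_class i)
        | (d1 :: real) (d2 :: real) (m :: 4 \<Rightarrow> real).
        \<forall>\<sigma> :: 4 \<Rightarrow> 4. bij \<sigma> \<longrightarrow>
          (\<forall>(\<alpha>1, \<alpha>2, \<beta>) \<in>
             {(1, 0, vector [0, 0, 0, 0]), (0, 1, vector [0, 0, 0, 0]),
              (1, 1, vector [1, 0, 0, 0]), (1, 2, vector [1, 1, 0, 0]),
              (1, 3, vector [1, 1, 1, 0]), (1, 3, vector [1, 1, 1, 1])
                :: real \<times> real \<times> (real ^ 4)}.
             \<alpha>1 * d1 + \<alpha>2 * d2 \<ge> (\<Sum>i\<in>UNIV. \<beta> $ i * m (\<sigma> i)))})"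
proof -
  obtain d where form: "form qfac d general" using form_general by blast
  define W where "W = mproj qfac - nonvanishing qfac general"
  have mem_W: "mpoint qfac z \<in> W \<longleftrightarrow> general z = 0" if "coords qfac z" for z
    using nonvanishing_iff(1)[OF form mpoint_in_mproj[OF that] mpoint_refl] mpoint_in_mproj[OF that] by (simp add: W_def)
  show ?thesis
    unfolding in_general_position_def cone_ineq_iff[symmetric] class_of_def[symmetric] generators_def[symmetric]
  proof (intro exI[of _ W] conjI allI impI ballI)
    show "closedin (zariski qfac) W"
      unfolding W_def using openin_nonvanishing[OF form] by (metis closedin_diff closedin_topspace topspace_zariski)
    show "W \<noteq> mproj qfac"
      using ex_general mem_W mpoint_in_mproj by metis
  next
    fix \<sigma> :: "4 \<Rightarrow> 4" and q assume \<sigma>: "bij \<sigma>" and q: "q \<in> W"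
    then have "q \<in> mproj qfac" by (simp add: W_def)
    then obtain z where z: "coords qfac z" "q = mpoint qfac z" unfolding mproj_iff by blast
    have "general z = 0" using q z mem_W by blast
    then have "general (\<lambda>(i, v). z (\<sigma> i, v)) = 0" using general_permuted[OF \<sigma>] by blast
    moreover have "coords qfac (\<lambda>(i, v). z (\<sigma> i, v))"
      unfolding coords_def
    proof
      fix b :: "4 \<times> factor" obtain i c where b: "b = (i, c)" by (cases b)
      obtain v where "yfac v = c" "z (\<sigma> i, v) \<noteq> 0" using coords_entry[OF z(1), of "\<sigma> i"] unfolding coords_def by blast
      then show "\<exists>k. qfac k = b \<and> (case k of (i, v) \<Rightarrow> z (\<sigma> i, v)) \<noteq> 0" using b by (intro exI[of _ "(i, v)"]) simp
    qed
    ultimately show "(\<lambda>z (i, v). z (\<sigma> i, v)) ` q \<in> W"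
      unfolding z(2) permuted_mpoint[OF \<sigma>] using mem_W by blast
  next
    fix q assume "q \<in> mproj qfac - W"
    then have qW: "q \<in> mproj qfac" "q \<notin> W" by auto
    then obtain z where z: "coords qfac z" "q = mpoint qfac z" unfolding mproj_iff by blast
    then have g: "distinct_x z" "det (\<chi> i k. z (i, YVar k)) \<noteq> 0" using qW(2) mem_W general_iff by blast+
    interpret general_points "\<lambda>i v. z (i, v)"
      by unfold_locales (use coords_entry[OF z(1)] g in \<open>auto simp: distinct_x_def\<close>)
    have p: "entry q = p" unfolding z(2) by (auto simp: fun_eq_iff entry_mpoint p_def)
    show "Eff (entry q) = convex_cone hull generators" "Eff (entry q) = {class_of d1 d2 m | d1 d2 m. cone_ineq d1 d2 m}"
      unfolding p by (rule Eff_general)+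
  qed
qed

end
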